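(* Let $\gamma\in(\tfrac12,1]$ and let $X=\{x_n\}_{n=0}^\infty$ with $x_0=0$, $x_n=x_{n-1}+\dfrac{1}{n^{\gamma}}$ for $n\in\mathbb{N}$. Let $\alpha=\{\alpha_n\}_{n=1}^\infty$ be a real sequence. Then: (1) if $\alpha_n\le -2\bigl(n^{\gamma}+(n+1)^{\gamma}\bigr)+C_1n^{-\gamma}$ for all $n\in\mathbb{N}$, for some $C_1>0$, then $\mathrm{H}_{X,\alpha}$ is self-adjoint; (2) if $\alpha_n=a\bigl(n^{\gamma}+(n+1)^{\gamma}\bigr)+O(n^{-\gamma})$ for some $a\in(-2,0)$, then $n_\pm(\mathrm{H}_{X,\alpha})=1$; (3) if $\alpha_n\ge -C_2n^{-\gamma}$ for all $n\in\mathbb{N}$, for some $C_2>0$, then $\mathrm{H}_{X,\alpha}$ is self-adjoint.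
   Context: $\mathbb{N}=\{1,2,\dots\}$, $\mathbb{R}_+=(0,\infty)$. For a positive sequence $(b_n)$, $a_n=c_n+O(b_n)$ means that there is $K>0$ with $|a_n-c_n|\le K b_n$ for all sufficiently large $n$. Given a strictly increasing sequence $X=\{x_n\}_{n=0}^\infty$ with $x_0=0$, $x_n\to\infty$, and a real sequence $\alpha=\{\alpha_n\}_{n=1}^\infty$, let $\mathrm{H}^0_{X,\alpha}$ be the operator $f\mapsto -f''$ (derivatives taken on $\mathbb{R}_+\setminus X$) in $L^2(\mathbb{R}_+)$ with domain consisting of all $f\in W^{2,2}(\mathbb{R}_+\setminus X)$ with compact support in $[0,\infty)$ such that $f'(0+)=0$ and, for every $n\ge1$, $f(x_n+)=f(x_n-)=:f(x_n)$ and $f'(x_n+)-f'(x_n-)=\alpha_n f(x_n)$. The Hamiltonian $\mathrm{H}_{X,\alpha}$ is the closure of $\mathrm{H}^0_{X,\alpha}$ in $L^2(\mathbb{R}_+)$; it is the realization of $-\frac{d^2}{dx^2}+\sum_{n\ge1}\alpha_n\delta(x-x_n)$. Its deficiency indices are $n_\pm(\mathrm{H}_{X,\alpha})=\dim\ker(\mathrm{H}_{X,\alpha}^*\mp i)$. *)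

theory Defs
  imports "HOL-Analysis.Analysis" "HOL-Library.Landau_Symbols"
begin

section \<open>Square-integrable functions\<close>

definition sq_integrable_on :: "(real \<Rightarrow> complex) \<Rightarrow> real set \<Rightarrow> bool"
    (infix \<open>sq'_integrable'_on\<close> 46) where
  "f sq_integrable_on S \<longleftrightarrow>
     f \<in> borel_measurable (lebesgue_on S) \<and>
     integrable (lebesgue_on S) (\<lambda>x. (cmod (f x))\<^sup>2)"

lemma borel_measurable_mult_cnj:
  fixes f g :: "'a \<Rightarrow> complex"
  assumes [measurable]: "f \<in> borel_measurable M" "g \<in> borel_measurable M"
  shows "(\<lambda>x. f x * cnj (g x)) \<in> borel_measurable M"
proof -
  have [measurable]: "cnj \<in> borel_measurable borel"
    by (intro borel_measurable_continuous_onI continuous_intros)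
  show ?thesis by measurable
qed

lemma sq_integrable_mult_cnj:
  assumes "f sq_integrable_on S" "g sq_integrable_on S"
  shows "integrable (lebesgue_on S) (\<lambda>x. f x * cnj (g x))"
proof (rule Bochner_Integration.integrable_bound)
  show "integrable (lebesgue_on S) (\<lambda>x. (cmod (f x))\<^sup>2 + (cmod (g x))\<^sup>2)"
    using assms by (simp add: sq_integrable_on_def)
  show "(\<lambda>x. f x * cnj (g x)) \<in> borel_measurable (lebesgue_on S)"
    using assms by (simp add: sq_integrable_on_def borel_measurable_mult_cnj)
  have "cmod (f x * cnj (g x)) \<le> (cmod (f x))\<^sup>2 + (cmod (g x))\<^sup>2" for x
  proof -
    have "0 \<le> (cmod (f x) - cmod (g x))\<^sup>2" by simp
    moreover have "0 \<le> cmod (f x) * cmod (g x)" by simp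
    ultimately show ?thesis
      unfolding norm_mult complex_mod_cnj power2_diff by linarith
  qed
  then show "AE x in lebesgue_on S. norm (f x * cnj (g x))
      \<le> norm ((cmod (f x))\<^sup>2 + (cmod (g x))\<^sup>2)"
    by simp
qed

lemma sq_integrable_zero: "(\<lambda>x. 0) sq_integrable_on S"
  by (simp add: sq_integrable_on_def)

lemma sq_integrable_mult:
  assumes "f sq_integrable_on S"
  shows "(\<lambda>x. c * f x) sq_integrable_on S"
  using assms unfolding sq_integrable_on_def
  by (auto simp: norm_mult power_mult_distrib intro: borel_measurable_times)

lemma sq_integrable_uminus:
  assumes "f sq_integrable_on S"
  shows "(\<lambda>x. - f x) sq_integrable_on S"
  using assms by (simp add: sq_integrable_on_def)

lemma sq_integrable_add:
  assumes "f sq_integrable_on S" "g sq_integrable_on S"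
  shows "(\<lambda>x. f x + g x) sq_integrable_on S"
proof -
  have "integrable (lebesgue_on S) (\<lambda>x. (cmod (f x + g x))\<^sup>2)"
  proof (rule Bochner_Integration.integrable_bound)
    show "integrable (lebesgue_on S) (\<lambda>x. 2 * (cmod (f x))\<^sup>2 + 2 * (cmod (g x))\<^sup>2)"
      using assms by (simp add: sq_integrable_on_def)
    show "(\<lambda>x. (cmod (f x + g x))\<^sup>2) \<in> borel_measurable (lebesgue_on S)"
      using assms unfolding sq_integrable_on_def
      by (intro borel_measurable_power borel_measurable_norm borel_measurable_add) auto
    have "(cmod (f x + g x))\<^sup>2 \<le> 2 * (cmod (f x))\<^sup>2 + 2 * (cmod (g x))\<^sup>2" for x
    proof -
      have "(cmod (f x + g x))\<^sup>2 \<le> (cmod (f x) + cmod (g x))\<^sup>2"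
        by (intro power_mono norm_triangle_ineq) simp
      moreover have "0 \<le> (cmod (f x) - cmod (g x))\<^sup>2" by simp
      ultimately show ?thesis
        by (simp add: power2_diff power2_sum)
    qed
    then show "AE x in lebesgue_on S. norm ((cmod (f x + g x))\<^sup>2)
        \<le> norm (2 * (cmod (f x))\<^sup>2 + 2 * (cmod (g x))\<^sup>2)"
      by simp
  qed
  then show ?thesis
    using assms by (simp add: sq_integrable_on_def borel_measurable_add)
qed

lemma sq_integrable_diff:
  assumes "f sq_integrable_on S" "g sq_integrable_on S"
  shows "(\<lambda>x. f x - g x) sq_integrable_on S"
  using sq_integrable_add[OF assms(1) sq_integrable_uminus[OF assms(2)]] by simp


section \<open>The Hilbert space of classes of square-integrable functions on the half-line\<close>

quotient_type L2 = "real \<Rightarrow> complex" / partial: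
  "\<lambda>f g. f sq_integrable_on {0<..} \<and> g sq_integrable_on {0<..} \<and>
         (AE x in lebesgue_on {0<..}. f x = g x)"
proof (rule part_equivpI)
  show "\<exists>f. f sq_integrable_on {0<..} \<and> f sq_integrable_on {0<..} \<and>
         (AE x in lebesgue_on {0<..}. f x = f x)"
    using sq_integrable_zero by auto
  show "symp (\<lambda>f g. f sq_integrable_on {0<..} \<and> g sq_integrable_on {0<..} \<and>
         (AE x in lebesgue_on {0<..}. f x = g x))"
    by (auto intro!: sympI)
  show "transp (\<lambda>f g. f sq_integrable_on {0<..} \<and> g sq_integrable_on {0<..} \<and>
         (AE x in lebesgue_on {0<..}. f x = g x))"
    by (rule transpI) (auto elim: AE_mp)
qed

instantiation L2 :: ab_group_add
begin

lift_definition zero_L2 :: L2 is "\<lambda>x. 0"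
  by (simp add: sq_integrable_zero)

lift_definition plus_L2 :: "L2 \<Rightarrow> L2 \<Rightarrow> L2" is "\<lambda>f g x. f x + g x"
  by (auto simp: sq_integrable_add)

lift_definition uminus_L2 :: "L2 \<Rightarrow> L2" is "\<lambda>f x. - f x"
  by (auto simp: sq_integrable_uminus)

lift_definition minus_L2 :: "L2 \<Rightarrow> L2 \<Rightarrow> L2" is "\<lambda>f g x. f x - g x"
  by (auto simp: sq_integrable_diff)

instance
  by standard (transfer; auto simp: sq_integrable_add sq_integrable_uminus
      sq_integrable_diff sq_integrable_zero algebra_simps)+

end

lift_definition scaleC :: "complex \<Rightarrow> L2 \<Rightarrow> L2" (infixr \<open>*\<^sub>C\<close> 75)
  is "\<lambda>c f x. c * f x"
  by (auto simp: sq_integrable_mult)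

global_interpretation L2: vector_space scaleC
  by standard (transfer; auto simp: sq_integrable_add sq_integrable_mult algebra_simps)+

lift_definition cinner :: "L2 \<Rightarrow> L2 \<Rightarrow> complex"
  is "\<lambda>f g. LINT x|lebesgue_on {0<..}. f x * cnj (g x)"
  by (rule integral_cong_AE) (auto simp: sq_integrable_on_def borel_measurable_mult_cnj)

instantiation L2 :: real_vector
begin

definition scaleR_L2 :: "real \<Rightarrow> L2 \<Rightarrow> L2" where
  "scaleR_L2 r f = complex_of_real r *\<^sub>C f"

instance
proof
  fix f g :: L2 and a b :: real
  show "a *\<^sub>R (f + g) = a *\<^sub>R f + a *\<^sub>R g"
    by (simp add: scaleR_L2_def L2.scale_right_distrib)
  show "(a + b) *\<^sub>R f = a *\<^sub>R f + b *\<^sub>R f"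
    by (simp add: scaleR_L2_def L2.scale_left_distrib)
  show "a *\<^sub>R b *\<^sub>R f = (a * b) *\<^sub>R f"
    by (simp add: scaleR_L2_def)
  show "1 *\<^sub>R f = f"
    by (simp add: scaleR_L2_def)
qed

end

text \<open>The norm and the topology come from the underlying real inner product.\<close>

instantiation L2 :: real_inner
begin

definition inner_L2 :: "L2 \<Rightarrow> L2 \<Rightarrow> real" where
  "inner_L2 f g = Re (cinner f g)"

definition norm_L2 :: "L2 \<Rightarrow> real" where
  "norm_L2 f = sqrt (f \<bullet> f)"

definition dist_L2 :: "L2 \<Rightarrow> L2 \<Rightarrow> real" where
  "dist_L2 f g = norm (f - g)"

definition sgn_L2 :: "L2 \<Rightarrow> L2" where
  "sgn_L2 f = f /\<^sub>R norm f"

definition uniformity_L2 :: "(L2 \<times> L2) filter" where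
  "uniformity_L2 = (INF e\<in>{0<..}. principal {(f, g). dist f g < e})"

definition open_L2 :: "L2 set \<Rightarrow> bool" where
  "open_L2 U \<longleftrightarrow> (\<forall>f\<in>U. \<forall>\<^sub>F (f', g) in uniformity. f' = f \<longrightarrow> g \<in> U)"

instance
proof
  fix f g h :: L2 and a b :: real
  show "dist f g = norm (f - g)"
    by (rule dist_L2_def)
  show "sgn f = f /\<^sub>R norm f"
    by (rule sgn_L2_def)
  show "(uniformity :: (L2 \<times> L2) filter) =
      (INF e\<in>{0<..}. principal {(x, y). dist x y < e})"
    by (rule uniformity_L2_def)
  show "open U = (\<forall>x\<in>U. \<forall>\<^sub>F (x', y) in uniformity. x' = x \<longrightarrow> y \<in> U)" for U :: "L2 set"
    by (rule open_L2_def)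
  show "f \<bullet> g = g \<bullet> f"
    unfolding inner_L2_def
  proof transfer
    fix f g :: "real \<Rightarrow> complex"
    have "(LINT x|lebesgue_on {0<..}. g x * cnj (f x))
        = (LINT x|lebesgue_on {0<..}. cnj (f x * cnj (g x)))"
      by (simp add: mult.commute)
    also have "\<dots> = cnj (LINT x|lebesgue_on {0<..}. f x * cnj (g x))"
      by (rule Bochner_Integration.integral_cnj)
    finally show "Re (LINT x|lebesgue_on {0<..}. f x * cnj (g x)) =
        Re (LINT x|lebesgue_on {0<..}. g x * cnj (f x))"
      by simp
  qed
  show "(f + g) \<bullet> h = f \<bullet> h + g \<bullet> h"
    unfolding inner_L2_def
    by transfer (simp add: distrib_right sq_integrable_mult_cnj)
  show "(a *\<^sub>R f) \<bullet> g = a * (f \<bullet> g)"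
    unfolding inner_L2_def scaleR_L2_def
    by transfer (simp add: mult.assoc)
  have inner_self: "Re (LINT x|lebesgue_on {0<..}. f x * cnj (f x))
      = (LINT x|lebesgue_on {0<..}. (cmod (f x))\<^sup>2)"
    if "f sq_integrable_on {0<..}" for f
    using integral_Re[OF sq_integrable_mult_cnj[OF that that]]
    by (simp add: complex_mult_cnj cmod_power2 del: of_real_add of_real_power)
  show "0 \<le> f \<bullet> f"
    unfolding inner_L2_def
    by transfer (simp add: inner_self)
  show "(f \<bullet> f = 0) = (f = 0)"
    unfolding inner_L2_def
  proof transfer
    fix f :: "real \<Rightarrow> complex"
    assume *: "f sq_integrable_on {0<..} \<and> f sq_integrable_on {0<..} \<and>
      (AE x in lebesgue_on {0<..}. f x = f x)"
    then have "integrable (lebesgue_on {0<..}) (\<lambda>x. (cmod (f x))\<^sup>2)"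
      by (simp add: sq_integrable_on_def)
    then have "(LINT x|lebesgue_on {0<..}. (cmod (f x))\<^sup>2) = 0 \<longleftrightarrow>
        (AE x in lebesgue_on {0<..}. f x = 0)"
      by (subst integral_nonneg_eq_0_iff_AE) auto
    with * show "(Re (LINT x|lebesgue_on {0<..}. f x * cnj (f x)) = 0) =
       (f sq_integrable_on {0<..} \<and> (\<lambda>x. 0) sq_integrable_on {0<..} \<and>
        (AE x in lebesgue_on {0<..}. f x = 0))"
      by (simp add: inner_self sq_integrable_zero)
  qed
  show "norm f = sqrt (f \<bullet> f)"
    by (rule norm_L2_def)
qed

end


section \<open>Unbounded operators\<close>

text \<open>
  An operator is represented by its graph: \<open>(f, g) \<in> H\<close> means that \<open>f\<close> is in the domain
  and \<open>g\<close> is its image. The closure of an operator is then the topological \<^const>\<open>closure\<close>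
  of its graph.
\<close>

type_synonym L2_operator = "(L2 \<times> L2) set"

definition densely_defined :: "L2_operator \<Rightarrow> bool" where
  "densely_defined H \<longleftrightarrow> closure (Domain H) = UNIV"

definition adjoint :: "L2_operator \<Rightarrow> L2_operator" where
  "adjoint H = {(g, h). \<forall>(f, k) \<in> H. cinner k g = cinner f h}"

definition self_adjoint :: "L2_operator \<Rightarrow> bool" where
  "self_adjoint H \<longleftrightarrow> densely_defined H \<and> adjoint H = H"

text \<open>The kernel of \<open>H - z\<close>.\<close>

definition ker_shift :: "L2_operator \<Rightarrow> complex \<Rightarrow> L2 set" where
  "ker_shift H z = {f. (f, z *\<^sub>C f) \<in> H}"

text \<open>
  \<^const>\<open>L2.dim\<close> is the dimension over the complex numbers; it is \<open>0\<close>, not infinite, on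
  infinite-dimensional subspaces.
\<close>

definition deficiency_plus :: "L2_operator \<Rightarrow> nat" where
  "deficiency_plus H = L2.dim (ker_shift (adjoint H) \<i>)"

definition deficiency_minus :: "L2_operator \<Rightarrow> nat" where
  "deficiency_minus H = L2.dim (ker_shift (adjoint H) (- \<i>))"


section \<open>Sobolev functions on open subsets of the line\<close>

text \<open>
  As in Brezis, Functional Analysis, Sobolev Spaces and Partial Differential Equations,
  Section 8.2, weak derivatives on the line are tested against continuously differentiable
  functions with compact support. Real-valued test functions suffice by linearity.
\<close>

definition test_function :: "real set \<Rightarrow> (real \<Rightarrow> real) \<Rightarrow> bool" where
  "test_function U \<phi> \<longleftrightarrow>
     (\<forall>x. \<phi> differentiable (at x)) \<and> continuous_on UNIV (deriv \<phi>) \<and>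
     compact (closure {x. \<phi> x \<noteq> 0}) \<and> closure {x. \<phi> x \<noteq> 0} \<subseteq> U"

definition weak_derivative ::
    "real set \<Rightarrow> (real \<Rightarrow> complex) \<Rightarrow> (real \<Rightarrow> complex) \<Rightarrow> bool" where
  "weak_derivative U f g \<longleftrightarrow> (\<forall>\<phi>. test_function U \<phi> \<longrightarrow>
     (LINT x|lebesgue_on U. deriv \<phi> x *\<^sub>R f x) = - (LINT x|lebesgue_on U. \<phi> x *\<^sub>R g x))"

text \<open>
  \<open>W22 U f f1 f2\<close>: \<open>f\<close> belongs to the Sobolev space of order 2 and exponent 2 on the
  open set \<open>U\<close>, with first and second weak derivatives \<open>f1\<close> and \<open>f2\<close>.
\<close>

definition W22 ::
    "real set \<Rightarrow> (real \<Rightarrow> complex) \<Rightarrow> (real \<Rightarrow> complex) \<Rightarrow> (real \<Rightarrow> complex) \<Rightarrow> bool" where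
  "W22 U f f1 f2 \<longleftrightarrow>
     f sq_integrable_on U \<and> f1 sq_integrable_on U \<and> f2 sq_integrable_on U \<and>
     weak_derivative U f f1 \<and> weak_derivative U f1 f2"


section \<open>The Hamiltonian with point interactions\<close>

text \<open>
  A \<open>W22\<close>-class and its first derivative have unique continuous representatives on the open
  set; \<open>f\<close> and \<open>f1\<close> below are these, so that the one-sided limits are meaningful.
  Since \<open>X = range x\<close> is a null set, \<open>L2\<close> on \<open>U\<close> and on the half-line agree, and the values
  at points of \<open>X\<close> are irrelevant. Only \<open>\<alpha> n\<close> with \<open>n \<ge> 1\<close> is used.
\<close>

definition pre_hamiltonian :: "(nat \<Rightarrow> real) \<Rightarrow> (nat \<Rightarrow> real) \<Rightarrow> L2_operator" where
  "pre_hamiltonian x \<alpha> = (let U = {0<..} - range x in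
     {(abs_L2 f, abs_L2 (\<lambda>t. - f2 t)) | f f1 f2.
        W22 U f f1 f2 \<and> continuous_on U f \<and> continuous_on U f1 \<and>
        compact (closure {t \<in> U. f t \<noteq> 0}) \<and>
        (f1 \<longlongrightarrow> 0) (at_right 0) \<and>
        (\<forall>n\<ge>1. \<exists>c l r.
           (f \<longlongrightarrow> c) (at_left (x n)) \<and> (f \<longlongrightarrow> c) (at_right (x n)) \<and>
           (f1 \<longlongrightarrow> l) (at_left (x n)) \<and> (f1 \<longlongrightarrow> r) (at_right (x n)) \<and>
           r - l = of_real (\<alpha> n) * c)})"

definition hamiltonian :: "(nat \<Rightarrow> real) \<Rightarrow> (nat \<Rightarrow> real) \<Rightarrow> L2_operator" where
  "hamiltonian x \<alpha> = closure (pre_hamiltonian x \<alpha>)"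

end

theory Submission
  imports Defs "HOL-Real_Asymp.Real_Asymp"
begin

text \<open>
  The adjoint of the pre-Hamiltonian consists of the pairs \<open>(f, - f'')\<close> for which \<open>f\<close> is
  continuous, \<open>f'\<close> starts from \<open>0\<close>, is absolutely continuous between the nodes and jumps by
  \<open>\<alpha>\<^sub>n f(x\<^sub>n)\<close> at \<open>x\<^sub>n\<close>, and \<open>f, f''\<close> are square-integrable. Such triples
  \<open>(f, f', f'')\<close> are described by one integral equation, called \<open>sol\<close> below, and the description
  of the adjoint is \<open>adjointI\<close> and \<open>adjointE\<close>. What remains is the behaviour of
  solutions at infinity.

  \<^bold>\<open>Self-adjointness.\<close> By orthogonal projection in the graph space, the Hamiltonian is
  self-adjoint as soon as the boundary form \<open>\<integral>(g'' v - g v'')\<close> vanishes for all such \<open>g, v\<close>; by the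
  Green formula it is the limit of the Wronskians \<open>W\<^sub>n\<close> at \<open>x\<^sub>n\<close>. Let \<open>y\<^sub>n = g(x\<^sub>n)\<close> and let
  \<open>d\<^sub>n\<close> be the length of the gap to the right of \<open>x\<^sub>n\<close>. On a gap \<open>g\<close> is affine up to an error
  controlled by \<open>g''\<close>. Hence \<open>\<Sum>d\<^sub>n |y\<^sub>n|\<^sup>2\<close> converges, and so does \<open>\<Sum>|r\<^sub>n|\<^sup>2/d\<^sub>n\<close> for the
  Jacobi expression \<open>r\<^sub>n = - (y\<^sub>n\<^sub>+\<^sub>1 - y\<^sub>n)/d\<^sub>n + (y\<^sub>n - y\<^sub>n\<^sub>-\<^sub>1)/d\<^sub>n\<^sub>-\<^sub>1 + \<alpha>\<^sub>n y\<^sub>n\<close>. If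
  \<open>\<alpha>\<^sub>n \<ge> - C d\<^sub>n\<close>, the Dirichlet sum \<open>\<Sum>|y\<^sub>n\<^sub>+\<^sub>1 - y\<^sub>n|\<^sup>2/d\<^sub>n\<close> is finite
  (\<open>Dirichlet_sum_finite\<close>). In the strongly attractive case the signs \<open>y\<^sub>n \<mapsto> (-1)\<^sup>n y\<^sub>n\<close> turn
  the Jacobi expression into the negative of one with the potential
  \<open>- \<alpha>\<^sub>n - 2(1/d\<^sub>n + 1/d\<^sub>n\<^sub>-\<^sub>1)\<close>, which is bounded below in the same sense, and it is
  \<open>\<Sum>|y\<^sub>n\<^sub>+\<^sub>1 + y\<^sub>n|\<^sup>2/d\<^sub>n\<close> that is finite. Either way \<open>\<Sum>d\<^sub>n |W\<^sub>n|\<close> is finite while \<open>\<Sum>d\<^sub>n\<close>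
  is not, so that the limit of \<open>W\<^sub>n\<close> can only be \<open>0\<close>.

  \<^bold>\<open>Deficiency.\<close> The kernel of \<open>H\<^sup>* - z\<close> consists of the multiples of the solution \<open>\<phi>\<close> of
  \<open>- \<phi>'' = z \<phi>\<close> that are square-integrable. For the intermediate couplings put
  \<open>\<phi>(x\<^sub>n) = s\<^sub>n u\<^sub>n\<close> with \<open>s\<^sub>n = (n + 1/2)\<^sup>-\<^sup>\<gamma>\<^sup>/\<^sup>2\<close>. The Jacobi expression then becomes
  \<open>u\<^sub>n\<^sub>+\<^sub>1 + u\<^sub>n\<^sub>-\<^sub>1 - 2(1 + a) u\<^sub>n = O(n\<^sup>-\<^sup>2\<^sup>\<gamma>)\<close> relative to the size of \<open>u\<close>. As \<open>|1 + a| < 1\<close>,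
  the unperturbed recurrence preserves a positive definite quadratic form, and as \<open>2\<gamma> > 1\<close> the
  perturbation is summable; hence \<open>u\<close> is bounded (\<open>bounded_if_almost_elliptic_recurrence\<close>).
  So \<open>|\<phi>|\<^sup>2\<close> is \<open>O(n\<^sup>-\<^sup>\<gamma>)\<close> on a gap of length about \<open>n\<^sup>-\<^sup>\<gamma>\<close>, and \<open>\<Sum>n\<^sup>-\<^sup>2\<^sup>\<gamma>\<close> converges.
\<close>

section \<open>Orthogonality and completeness of the space of square-integrable classes\<close>

text \<open>
  The projection theorem, in the form in which it is used for the graph of the
  operator and for its domain: a minimizing sequence for the distance from \<open>z\<close> to \<open>M\<close> is Cauchy by
  the parallelogram law, and the difference between \<open>z\<close> and its limit is orthogonal to \<open>M\<close>, hence
  to \<open>z\<close>.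
\<close>

lemma closure_subspace_if_orthogonal:
  fixes M :: "'a::{real_inner,complete_space} set"
  assumes M: "subspace M" and z: "\<And>u. (\<And>m. m \<in> M \<Longrightarrow> m \<bullet> u = 0) \<Longrightarrow> z \<bullet> u = 0"
  shows "z \<in> closure M"
proof -
  define d where "d = infdist z M"
  have M0: "M \<noteq> {}" using subspace_0[OF M] by auto
  have dle: "d \<le> norm (z - m)" if "m \<in> M" for m
    using infdist_le[OF that, of z] by (simp add: d_def dist_norm)
  have d0: "d \<ge> 0" by (simp add: d_def infdist_nonneg)
  have "\<exists>m\<in>M. norm (z - m) < d + 1 / real (Suc n)" for n
  proof (rule ccontr)
    assume "\<not> ?thesis"
    then have "d + 1 / real (Suc n) \<le> dist z m" if "m \<in> M" for m
      using that by (auto simp: dist_norm not_less)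
    then have "d + 1 / real (Suc n) \<le> infdist z M"
      using M0 by (simp add: infdist_def cINF_greatest)
    then show False by (simp add: d_def)
  qed
  then obtain m where m: "\<And>n. m n \<in> M" "\<And>n. norm (z - m n) < d + 1 / real (Suc n)"
    by metis
  have lim: "(\<lambda>n. norm (z - m n)) \<longlonglongrightarrow> d"
  proof (rule tendsto_sandwich[of "\<lambda>_. d" _ _ "\<lambda>n. d + 1 / real (Suc n)"])
    show "(\<lambda>n. d + 1 / real (Suc n)) \<longlonglongrightarrow> d"
      using tendsto_add[OF tendsto_const[of d] LIMSEQ_inverse_real_of_nat]
      by (simp add: inverse_eq_divide)
  qed (use m dle in \<open>auto intro!: always_eventually less_imp_le[OF m(2), unfolded of_nat_Suc]\<close>)
  have par: "(norm (m i - m j))\<^sup>2 \<le> 2 * (norm (z - m i))\<^sup>2 + 2 * (norm (z - m j))\<^sup>2 - 4 * d\<^sup>2" for i j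
  proof -
    have "(1/2) *\<^sub>R (m i + m j) \<in> M"
      using M m by (auto intro: subspace_scale subspace_add)
    from dle[OF this] d0 have "d\<^sup>2 \<le> (norm (z - (1/2) *\<^sub>R (m i + m j)))\<^sup>2"
      by (intro power_mono)
    then show ?thesis
      by (simp add: power2_norm_eq_inner algebra_simps inner_commute)
  qed
  have "Cauchy m"
  proof (rule metric_CauchyI)
    fix e :: real assume e: "e > 0"
    have "(\<lambda>n. (norm (z - m n))\<^sup>2) \<longlonglongrightarrow> d\<^sup>2" using lim by (intro tendsto_intros)
    then have "eventually (\<lambda>n. (norm (z - m n))\<^sup>2 < d\<^sup>2 + e\<^sup>2 / 4) sequentially"
      using e by (intro order_tendstoD) auto
    then obtain N where N: "\<And>n. n \<ge> N \<Longrightarrow> (norm (z - m n))\<^sup>2 < d\<^sup>2 + e\<^sup>2 / 4"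
      by (auto simp: eventually_sequentially)
    show "\<exists>N. \<forall>i\<ge>N. \<forall>j\<ge>N. dist (m i) (m j) < e"
    proof (intro exI allI impI)
      fix i j assume "N \<le> i" "N \<le> j"
      with par[of i j] N[of i] N[of j] have "(norm (m i - m j))\<^sup>2 < e\<^sup>2" by linarith
      then show "dist (m i) (m j) < e"
        using e by (simp add: dist_norm power_less_imp_less_base)
    qed
  qed
  then obtain p where p: "m \<longlonglongrightarrow> p"
    by (auto simp: Cauchy_convergent_iff convergent_def)
  have pc: "p \<in> closure M" using p m(1) by (auto simp: closure_sequential)
  have np: "norm (z - p) = d"
    by (rule LIMSEQ_unique[OF _ lim]) (intro tendsto_intros p)
  have orth: "k \<bullet> (z - p) = 0" if k: "k \<in> M" for k
  proof -
    have ge: "(norm (z - p))\<^sup>2 \<le> (norm (z - p - t *\<^sub>R k))\<^sup>2" for t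
    proof -
      have "m n + t *\<^sub>R k \<in> M" for n
        using M m k by (auto intro: subspace_scale subspace_add)
      then have "d \<le> norm (z - (m n + t *\<^sub>R k))" for n using dle by blast
      moreover have "(\<lambda>n. norm (z - (m n + t *\<^sub>R k))) \<longlonglongrightarrow> norm (z - (p + t *\<^sub>R k))"
        by (intro tendsto_intros p)
      ultimately have "d \<le> norm (z - (p + t *\<^sub>R k))"
        by (intro LIMSEQ_le_const) auto
      then show ?thesis using np d0 by (intro power_mono) (auto simp: algebra_simps)
    qed
    show ?thesis
    proof (cases "k = 0")
      case False
      define q where "q = k \<bullet> (z - p)"
      have "0 \<le> - 2 * t * q + t\<^sup>2 * (k \<bullet> k)" for t
        using ge[of t] unfolding power2_norm_eq_inner q_def
        by (simp add: algebra_simps inner_commute power2_eq_square)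
      from this[of "q / (k \<bullet> k)"] have "q\<^sup>2 / (k \<bullet> k) \<le> 0"
        using False by (simp add: power2_eq_square field_simps)
      moreover have "k \<bullet> k > 0" using False by simp
      ultimately have "q\<^sup>2 \<le> 0" by (simp add: divide_le_0_iff not_le)
      then show ?thesis by (simp add: q_def)
    qed simp
  qed
  have "z \<bullet> (z - p) = 0" by (rule z) (rule orth)
  moreover have "p \<bullet> (z - p) = 0"
  proof -
    have "(\<lambda>n. m n \<bullet> (z - p)) \<longlonglongrightarrow> p \<bullet> (z - p)" by (intro tendsto_intros p)
    with orth[OF m(1)] show ?thesis by (simp add: LIMSEQ_const_iff)
  qed
  ultimately have "(z - p) \<bullet> (z - p) = 0" by (simp add: inner_diff_left)
  then have "z = p" by simp
  with pc show ?thesis by simp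
qed

lemma abs_L2_eq_iff:
  assumes "f sq_integrable_on {0<..}" "g sq_integrable_on {0<..}"
  shows "abs_L2 f = abs_L2 g \<longleftrightarrow> (AE t in lebesgue_on {0<..}. f t = g t)"
  using Quotient3_rel[OF Quotient3_L2, of f g] assms by simp

lemma L2_cases:
  obtains f where "f sq_integrable_on {0<..}" "F = abs_L2 f"
  by (induct F rule: L2.abs_induct) auto

lemma plus_abs_L2:
  "f sq_integrable_on {0<..} \<Longrightarrow> g sq_integrable_on {0<..} \<Longrightarrow>
    abs_L2 f + abs_L2 g = abs_L2 (\<lambda>t. f t + g t)"
  by (simp add: plus_L2.abs_eq)

lemma minus_abs_L2:
  "f sq_integrable_on {0<..} \<Longrightarrow> g sq_integrable_on {0<..} \<Longrightarrow>
    abs_L2 f - abs_L2 g = abs_L2 (\<lambda>t. f t - g t)"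
  by (simp add: minus_L2.abs_eq)

lemma scaleC_abs_L2:
  "f sq_integrable_on {0<..} \<Longrightarrow> c *\<^sub>C abs_L2 f = abs_L2 (\<lambda>t. c * f t)"
  by (simp add: scaleC.abs_eq)

lemma cinner_abs_L2:
  "f sq_integrable_on {0<..} \<Longrightarrow> g sq_integrable_on {0<..} \<Longrightarrow>
    cinner (abs_L2 f) (abs_L2 g) = (LINT t|lebesgue_on {0<..}. f t * cnj (g t))"
  by (simp add: cinner.abs_eq)

lemma norm_abs_L2:
  assumes "f sq_integrable_on {0<..}"
  shows "(norm (abs_L2 f))\<^sup>2 = (LINT t|lebesgue_on {0<..}. (cmod (f t))\<^sup>2)"
proof -
  have "(norm (abs_L2 f))\<^sup>2 = Re (LINT t|lebesgue_on {0<..}. f t * cnj (f t))"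
    using assms by (simp add: power2_norm_eq_inner inner_L2_def cinner_abs_L2)
  also have "\<dots> = (LINT t|lebesgue_on {0<..}. (cmod (f t))\<^sup>2)"
    using integral_Re[OF sq_integrable_mult_cnj[OF assms assms]]
    by (simp add: complex_mult_cnj cmod_power2 del: of_real_add of_real_power)
  finally show ?thesis .
qed

lemma sq_integrable_exp: "(\<lambda>t. of_real (exp (- t))) sq_integrable_on {0<..}"
proof -
  have "(\<lambda>t::real. exp (- 2 * t)) absolutely_integrable_on {0..}"
    using integrable_on_exp_minus_to_infinity[of 2 0]
    by (intro nonnegative_absolutely_integrable_1) auto
  then have "(\<lambda>t::real. exp (- 2 * t)) absolutely_integrable_on {0<..}"
    by (rule set_integrable_subset) auto
  then have "integrable (lebesgue_on {0<..}) (\<lambda>t::real. exp (- 2 * t))"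
    by (simp add: set_integrable_def integrable_restrict_space)
  moreover have "(\<lambda>t. complex_of_real (exp (- t))) \<in> borel_measurable (lebesgue_on {0<..})"
    by (intro continuous_imp_measurable_on_sets_lebesgue continuous_intros) auto
  ultimately show ?thesis
    by (simp add: sq_integrable_on_def power2_eq_square flip: exp_add)
qed

text \<open>
  Riesz-Fischer. The half-line has infinite measure, so \<open>L\<^sup>2\<close>-Cauchy sequences need not be
  \<open>L\<^sup>1\<close>-Cauchy; after multiplication by \<open>exp (- t)\<close>, which is itself square-integrable, they are.
  This gives a subsequence that converges almost everywhere, and Fatou's lemma identifies its limit
  as the limit in norm.
\<close>

instance L2 :: complete_space
proof
  fix X :: "nat \<Rightarrow> L2" assume X: "Cauchy X"
  let ?M = "lebesgue_on {0::real<..}"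
  have "\<forall>n. \<exists>f. f sq_integrable_on {0<..} \<and> X n = abs_L2 f" by (metis L2_cases)
  then obtain f where f: "\<And>n. f n sq_integrable_on {0<..}" "\<And>n. X n = abs_L2 (f n)"
    by metis
  define w where "w = (\<lambda>t::real. complex_of_real (exp (- t)))"
  have w: "w sq_integrable_on {0<..}" unfolding w_def by (rule sq_integrable_exp)
  define s where "s = (\<lambda>n t. f n t * cnj (w t))"
  have s: "integrable ?M (s n)" for n unfolding s_def by (rule sq_integrable_mult_cnj[OF f(1) w])
  have fd: "(\<lambda>t. f i t - f j t) sq_integrable_on {0<..}" for i j by (rule sq_integrable_diff[OF f(1) f(1)])
  have normd: "(norm (X i - X j))\<^sup>2 = (LINT t|?M. (cmod (f i t - f j t))\<^sup>2)" for i j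
    by (simp add: f minus_abs_L2 norm_abs_L2 fd)
  have sb: "(LINT t|?M. norm (s i t - s j t)) \<le> norm (X i - X j) * norm (abs_L2 w)" for i j
  proof -
    let ?g = "\<lambda>t. complex_of_real (cmod (f i t - f j t))"
    have g: "?g sq_integrable_on {0<..}" using fd[of i j]
      by (auto simp: sq_integrable_on_def)
    have ng: "norm (abs_L2 ?g) = norm (X i - X j)"
      by (rule power2_eq_imp_eq) (simp_all add: normd norm_abs_L2 g)
    have "of_real (LINT t|?M. norm (s i t - s j t)) = (LINT t|?M. ?g t * cnj (w t))"
      unfolding integral_complex_of_real[symmetric] by (rule Bochner_Integration.integral_cong)
       (auto simp: s_def w_def norm_mult simp flip: left_diff_distrib)
    then have "(LINT t|?M. norm (s i t - s j t)) = Re (cinner (abs_L2 ?g) (abs_L2 w))"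
      using g w by (simp add: cinner_abs_L2) (metis Re_complex_of_real)
    also have "\<dots> = abs_L2 ?g \<bullet> abs_L2 w" by (simp add: inner_L2_def)
    also have "\<dots> \<le> norm (abs_L2 ?g) * norm (abs_L2 w)" by (rule norm_cauchy_schwarz)
    finally show ?thesis by (simp add: ng)
  qed
  have "\<exists>N. \<forall>i\<ge>N. \<forall>j\<ge>N. (LINT t|?M. norm (s i t - s j t)) < e" if e: "e > 0" for e
  proof -
    have "e / (norm (abs_L2 w) + 1) > 0" using e by (simp add: add_nonneg_pos)
    from CauchyD[OF X this] obtain N where
      N: "\<And>i j. i \<ge> N \<Longrightarrow> j \<ge> N \<Longrightarrow> norm (X i - X j) < e / (norm (abs_L2 w) + 1)" by blast
    have "(LINT t|?M. norm (s i t - s j t)) < e" if "i \<ge> N" "j \<ge> N" for i j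
    proof -
      have "norm (X i - X j) * norm (abs_L2 w) \<le> norm (X i - X j) * (norm (abs_L2 w) + 1)"
        by (intro mult_left_mono) auto
      also have "\<dots> < e" using N[OF that] by (simp add: pos_less_divide_eq add_nonneg_pos)
      finally show ?thesis using sb[of i j] by linarith
    qed
    then show ?thesis by blast
  qed
  from cauchy_L1_AE_cauchy_subseq[OF s this] obtain r where r: "strict_mono r"
    and AEC: "AE t in ?M. Cauchy (\<lambda>i. s (r i) t)" by blast
  define F where "F = (\<lambda>t. lim (\<lambda>i. f (r i) t))"
  have fm: "f n \<in> borel_measurable ?M" for n using f(1)[of n] by (simp add: sq_integrable_on_def)
  have Fm: "F \<in> borel_measurable ?M" unfolding F_def by (intro borel_measurable_lim_metric fm)
  have AEL: "AE t in ?M. (\<lambda>i. f (r i) t) \<longlonglongrightarrow> F t"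
    using AEC
  proof eventually_elim
    case (elim t)
    then have "convergent (\<lambda>i. s (r i) t)" by (simp add: Cauchy_convergent_iff)
    then have "convergent (\<lambda>i. s (r i) t * (1 / cnj (w t)))"
      by (intro convergent_mult convergent_const)
    then have "convergent (\<lambda>i. f (r i) t)" by (simp add: s_def w_def)
    then show ?case by (simp add: F_def convergent_LIMSEQ_iff)
  qed
  have key: "(\<lambda>t. F t - f i t) sq_integrable_on {0<..} \<and>
      (LINT t|?M. (cmod (F t - f i t))\<^sup>2) \<le> e\<^sup>2"
    if N: "\<And>i j. i \<ge> N \<Longrightarrow> j \<ge> N \<Longrightarrow> norm (X i - X j) < e" and i: "i \<ge> N" and e: "e > 0" for i N e
  proof -
    have "(\<integral>\<^sup>+t. ennreal ((cmod (F t - f i t))\<^sup>2) \<partial>?M)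
        = (\<integral>\<^sup>+t. liminf (\<lambda>j. ennreal ((cmod (f (r j) t - f i t))\<^sup>2)) \<partial>?M)"
    proof (rule nn_integral_cong_AE, use AEL in eventually_elim)
      case (elim t)
      have "(\<lambda>j. ennreal ((cmod (f (r j) t - f i t))\<^sup>2)) \<longlonglongrightarrow> ennreal ((cmod (F t - f i t))\<^sup>2)"
        by (intro tendsto_intros elim)
      then show ?case by (rule lim_imp_Liminf[OF sequentially_bot, symmetric])
    qed
    also have "\<dots> \<le> liminf (\<lambda>j. (\<integral>\<^sup>+t. ennreal ((cmod (f (r j) t - f i t))\<^sup>2) \<partial>?M))"
      using fm by (intro nn_integral_liminf) measurable
    also have "\<dots> \<le> liminf (\<lambda>j::nat. ennreal (e\<^sup>2))"
    proof (rule Liminf_mono, rule eventually_sequentiallyI[of N])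
      fix j assume j: "j \<ge> N"
      then have rj: "r j \<ge> N" using seq_suble[OF r, of j] by linarith
      have "(\<integral>\<^sup>+t. ennreal ((cmod (f (r j) t - f i t))\<^sup>2) \<partial>?M)
          = ennreal (LINT t|?M. (cmod (f (r j) t - f i t))\<^sup>2)"
        using fd[of "r j" i] by (intro nn_integral_eq_integral) (auto simp: sq_integrable_on_def)
      also have "\<dots> \<le> ennreal (e\<^sup>2)"
        unfolding normd[symmetric] using N[OF rj i] by (intro ennreal_leI power_mono) auto
      finally show "(\<integral>\<^sup>+t. ennreal ((cmod (f (r j) t - f i t))\<^sup>2) \<partial>?M) \<le> ennreal (e\<^sup>2)" .
    qed
    also have "\<dots> = ennreal (e\<^sup>2)" by (simp add: Liminf_const)
    finally have le: "(\<integral>\<^sup>+t. ennreal ((cmod (F t - f i t))\<^sup>2) \<partial>?M) \<le> ennreal (e\<^sup>2)" .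
    have int: "integrable ?M (\<lambda>t. (cmod (F t - f i t))\<^sup>2)"
    proof (rule integrableI_bounded)
      show "(\<lambda>t. (cmod (F t - f i t))\<^sup>2) \<in> borel_measurable ?M"
        using Fm fm[of i] by measurable
      show "(\<integral>\<^sup>+t. ennreal (norm ((cmod (F t - f i t))\<^sup>2)) \<partial>?M) < \<infinity>"
        using le_less_trans[OF le ennreal_less_top] by simp
    qed
    have "ennreal (LINT t|?M. (cmod (F t - f i t))\<^sup>2) \<le> ennreal (e\<^sup>2)"
      using le nn_integral_eq_integral[OF int] by simp
    then have "(LINT t|?M. (cmod (F t - f i t))\<^sup>2) \<le> e\<^sup>2"
      by simp
    with int Fm fm[of i] show ?thesis by (simp add: sq_integrable_on_def)
  qed
  obtain N1 where N1: "\<And>i j. i \<ge> N1 \<Longrightarrow> j \<ge> N1 \<Longrightarrow> norm (X i - X j) < 1"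
    using CauchyD[OF X zero_less_one] by blast
  have "(\<lambda>t. (F t - f N1 t) + f N1 t) sq_integrable_on {0<..}"
    using key[OF N1 order_refl] f(1) by (intro sq_integrable_add) auto
  then have F: "F sq_integrable_on {0<..}" by simp
  have "X \<longlonglongrightarrow> abs_L2 F"
  proof (rule metric_LIMSEQ_I)
    fix e :: real assume e: "e > 0"
    then obtain N where N: "\<And>i j. i \<ge> N \<Longrightarrow> j \<ge> N \<Longrightarrow> norm (X i - X j) < e/2"
      using CauchyD[OF X, of "e/2"] by auto
    have "dist (X i) (abs_L2 F) < e" if "i \<ge> N" for i
    proof -
      have "(norm (abs_L2 F - X i))\<^sup>2 \<le> (e/2)\<^sup>2"
        using key[OF N that] e by (simp add: f minus_abs_L2[OF F f(1)] norm_abs_L2)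
      then have "norm (abs_L2 F - X i) \<le> e/2" by (rule power2_le_imp_le) (use e in simp)
      then show ?thesis using e by (simp add: dist_norm norm_minus_commute)
    qed
    then show "\<exists>N. \<forall>i\<ge>N. dist (X i) (abs_L2 F) < e" by blast
  qed
  then show "convergent X" by (auto simp: convergent_def)
qed

section \<open>Integration by parts and square-integrable functions on the half-line\<close>

lemma absint_subinterval: "f absolutely_integrable_on {a..b::real} \<Longrightarrow> a \<le> c \<Longrightarrow> d \<le> b \<Longrightarrow>
   f absolutely_integrable_on {c..d}"
  for f :: "real \<Rightarrow> 'a::euclidean_space"
  by (erule set_integrable_subset) auto

lemma absint_norm: "f absolutely_integrable_on S \<Longrightarrow> (\<lambda>t. norm (f t)) integrable_on S"
  for f :: "real \<Rightarrow> 'a::euclidean_space"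
  by (simp add: absolutely_integrable_on_def)

lemma absint_imp_integrable: "f absolutely_integrable_on S \<Longrightarrow> f integrable_on S"
  for f :: "real \<Rightarrow> 'a::euclidean_space"
  by (simp add: absolutely_integrable_on_def)

lemma absint_mult_bounded:
  fixes f g :: "real \<Rightarrow> complex"
  assumes "g absolutely_integrable_on S" "f \<in> borel_measurable (lebesgue_on S)" "S \<in> sets lebesgue"
    "bounded (f ` S)"
  shows "(\<lambda>t. g t * f t) absolutely_integrable_on S"
proof -
  have "bilinear ((*) :: complex \<Rightarrow> complex \<Rightarrow> complex)"
    by (simp add: bilinear_conv_bounded_bilinear bounded_bilinear_mult)
  from absolutely_integrable_bounded_measurable_product[OF this assms(2,3,4,1)]
  show ?thesis by (simp add: mult.commute)
qed

lemma absint_mult_continuous: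
  fixes f g :: "real \<Rightarrow> complex"
  assumes "g absolutely_integrable_on {a..b}" "continuous_on {a..b} f"
  shows "(\<lambda>t. g t * f t) absolutely_integrable_on {a..b}"
  using assms
  by (intro absint_mult_bounded continuous_imp_measurable_on_sets_lebesgue)
     (auto intro: compact_imp_bounded compact_continuous_image)

lemma integral_split: "f absolutely_integrable_on {a..b} \<Longrightarrow> a \<le> c \<Longrightarrow> c \<le> b \<Longrightarrow>
   integral {c..b} f = integral {a..b} f - integral {a..c} f"
  for f :: "real \<Rightarrow> 'a::euclidean_space"
  using Henstock_Kurzweil_Integration.integral_combine[of a c b, OF _ _ absint_imp_integrable, of f]
  by (simp add: algebra_simps)

lemma norm_integral_le: "f absolutely_integrable_on S \<Longrightarrow> norm (integral S f) \<le> integral S (\<lambda>t. norm (f t))"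
  for f :: "real \<Rightarrow> 'a::euclidean_space"
  by (rule integral_norm_bound_integral) (auto intro: absint_imp_integrable absint_norm)

text \<open>
  The increments over a partition add up to at most the largest increment of \<open>M\<close>
  times its total increment, and the former becomes small with the mesh. In the next lemma this
  replaces differentiation, which for a primitive of an integrable function is possible only
  almost everywhere.
\<close>

lemma quadratically_dominated_imp_constant:
  fixes K :: "real \<Rightarrow> complex" and M :: "real \<Rightarrow> real"
  assumes T: "0 \<le> T" and M: "continuous_on {0..T} M"
    and mono: "\<And>s t. 0 \<le> s \<Longrightarrow> s \<le> t \<Longrightarrow> t \<le> T \<Longrightarrow> M s \<le> M t"
    and K: "\<And>s t. 0 \<le> s \<Longrightarrow> s \<le> t \<Longrightarrow> t \<le> T \<Longrightarrow> norm (K t - K s) \<le> (M t - M s)\<^sup>2"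
  shows "K T = K 0"
proof -
  have "norm (K T - K 0) \<le> e * (M T - M 0)" if e: "e > 0" for e
  proof -
    have "uniformly_continuous_on {0..T} M"
      using M by (intro compact_uniformly_continuous) auto
    then obtain d where d: "d > 0"
      "\<And>s t. s \<in> {0..T} \<Longrightarrow> t \<in> {0..T} \<Longrightarrow> dist s t < d \<Longrightarrow> dist (M s) (M t) < e"
      using e unfolding uniformly_continuous_on_def by metis
    obtain N :: nat where N: "T / d < N" using reals_Archimedean2 by blast
    then have N0: "N > 0" using T d(1) by (metis divide_nonneg_pos le_less_trans of_nat_0_less_iff)
    define s where "s = (\<lambda>i::nat. T * i / N)"
    have s: "0 \<le> s i" "s i \<le> s (Suc i)" for i using T N0 by (auto simp: s_def divide_simps mult_left_mono)
    have sT: "s i \<le> T" if "i \<le> N" for i using that T N0 by (simp add: s_def divide_simps mult_left_mono)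
    have "norm (K (s (Suc i)) - K (s i)) \<le> e * (M (s (Suc i)) - M (s i))" if i: "i < N" for i
    proof -
      have "s (Suc i) - s i = T / N" using N0 by (simp add: s_def divide_simps) (simp add: algebra_simps)
      also have "\<dots> < d" using N N0 d(1) by (simp add: field_simps)
      finally have "dist (s (Suc i)) (s i) < d" using s[of i] by (simp add: dist_real_def)
      then have "dist (M (s (Suc i))) (M (s i)) < e"
        using i s[of i] s(1)[of "Suc i"] sT[of i] sT[of "Suc i"] by (intro d(2)) auto
      then have le: "M (s (Suc i)) - M (s i) \<le> e" by (simp add: dist_real_def)
      have ge: "0 \<le> M (s (Suc i)) - M (s i)" using mono[of "s i" "s (Suc i)"] s sT[of "Suc i"] i by auto
      have "norm (K (s (Suc i)) - K (s i)) \<le> (M (s (Suc i)) - M (s i))\<^sup>2"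
        using K[of "s i" "s (Suc i)"] s sT[of "Suc i"] i by auto
      also have "\<dots> \<le> e * (M (s (Suc i)) - M (s i))"
        unfolding power2_eq_square using le ge by (intro mult_right_mono)
      finally show ?thesis .
    qed
    then have "(\<Sum>i<N. norm (K (s (Suc i)) - K (s i))) \<le> (\<Sum>i<N. e * (M (s (Suc i)) - M (s i)))"
      by (intro sum_mono) auto
    also have "\<dots> = e * (M (s N) - M (s 0))"
      using sum_lessThan_telescope[of "\<lambda>i. M (s i)" N] by (simp add: sum_distrib_left[symmetric])
    finally have "(\<Sum>i<N. norm (K (s (Suc i)) - K (s i))) \<le> e * (M (s N) - M (s 0))" .
    moreover have "K (s N) - K (s 0) = (\<Sum>i<N. K (s (Suc i)) - K (s i))"
      by (rule sum_lessThan_telescope[symmetric])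
    moreover have "s N = T" "s 0 = 0" using N0 by (auto simp: s_def)
    ultimately show ?thesis by (metis norm_sum order_trans)
  qed
  moreover have "M T - M 0 \<ge> 0" using mono[of 0 T] T by simp
  ultimately have "norm (K T - K 0) \<le> 0 + e" if e: "e > 0" for e
  proof -
    have "norm (K T - K 0) \<le> e / (M T - M 0 + 1) * (M T - M 0)"
      using e \<open>M T - M 0 \<ge> 0\<close> by (intro \<open>\<And>e. e > 0 \<Longrightarrow> norm (K T - K 0) \<le> e * (M T - M 0)\<close>) simp
    also have "\<dots> \<le> e" using e \<open>M T - M 0 \<ge> 0\<close> by (simp add: divide_simps algebra_simps)
    finally show ?thesis by simp
  qed
  then have "norm (K T - K 0) \<le> 0" by (rule field_le_epsilon)
  then show ?thesis by simp
qed

text \<open>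
  Over a short interval, \<open>g Q + P h\<close> integrates to the increment of \<open>P Q\<close> up to the
  square of the integral of \<open>|g| + |h|\<close>, because \<open>P\<close> and \<open>Q\<close> vary there by no more than that
  integral.
\<close>

lemma integration_by_parts_AC:
  fixes g h P Q :: "real \<Rightarrow> complex"
  assumes T: "0 \<le> T" and g: "g absolutely_integrable_on {0..T}" and h: "h absolutely_integrable_on {0..T}"
    and P: "\<And>t. 0 \<le> t \<Longrightarrow> t \<le> T \<Longrightarrow> P t = P 0 + integral {0..t} g"
    and Q: "\<And>t. 0 \<le> t \<Longrightarrow> t \<le> T \<Longrightarrow> Q t = Q 0 + integral {0..t} h"
  shows "integral {0..T} (\<lambda>t. g t * Q t) + integral {0..T} (\<lambda>t. P t * h t) = P T * Q T - P 0 * Q 0"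
proof -
  have contP: "continuous_on {0..T} P"
  proof (rule continuous_on_eq[of _ "\<lambda>t. P 0 + integral {0..t} g"])
    show "continuous_on {0..T} (\<lambda>t. P 0 + integral {0..t} g)"
      by (intro continuous_intros indefinite_integral_continuous_1 absint_imp_integrable[OF g])
  qed (metis P atLeastAtMost_iff)
  have contQ: "continuous_on {0..T} Q"
  proof (rule continuous_on_eq[of _ "\<lambda>t. Q 0 + integral {0..t} h"])
    show "continuous_on {0..T} (\<lambda>t. Q 0 + integral {0..t} h)"
      by (intro continuous_intros indefinite_integral_continuous_1 absint_imp_integrable[OF h])
  qed (metis Q atLeastAtMost_iff)
  have gQ: "(\<lambda>t. g t * Q t) absolutely_integrable_on {0..T}"
    by (rule absint_mult_continuous[OF g contQ])
  have Ph: "(\<lambda>t. P t * h t) absolutely_integrable_on {0..T}"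
    using absint_mult_continuous[OF h contP] by (simp add: mult.commute)
  define m where "m = (\<lambda>t. norm (g t) + norm (h t))"
  have m: "m absolutely_integrable_on {0..T}"
    unfolding m_def using g h by (intro set_integral_add set_integrable_norm) auto
  define M where "M = (\<lambda>t. integral {0..t} m)"
  define K where "K = (\<lambda>t. P t * Q t - (integral {0..t} (\<lambda>t. g t * Q t) + integral {0..t} (\<lambda>t. P t * h t)))"
  have Mdiff: "M t - M s = integral {s..t} m" if "0 \<le> s" "s \<le> t" "t \<le> T" for s t
    unfolding M_def using integral_split[OF absint_subinterval[OF m, of 0 t], of s] that by simp
  have mono: "M s \<le> M t" if "0 \<le> s" "s \<le> t" "t \<le> T" for s t
  proof -
    have "0 \<le> integral {s..t} m"
      by (rule Henstock_Kurzweil_Integration.integral_nonneg)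
         (use absint_imp_integrable[OF absint_subinterval[OF m, of s t]] that in \<open>simp_all add: m_def\<close>)
    then show ?thesis using Mdiff[OF that] by simp
  qed
  have Pd: "P t - P s = integral {s..t} g" "norm (P t - P s) \<le> M t - M s" 
    and Qd: "Q t - Q s = integral {s..t} h" "norm (Q t - Q s) \<le> M t - M s"
    if st: "0 \<le> s" "s \<le> t" "t \<le> T" for s t
  proof -
    have sub: "f absolutely_integrable_on {s..t}" if "f absolutely_integrable_on {0..T}" for f :: "real \<Rightarrow> 'b::euclidean_space"
      using that st by (rule_tac absint_subinterval[of 0 T f]) auto
    show *: "P t - P s = integral {s..t} g" "Q t - Q s = integral {s..t} h"
    proof -
      have "integral {s..t} g = integral {0..t} g - integral {0..s} g"
        by (rule integral_split[OF absint_subinterval[OF g]]) (use st in simp_all)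
      moreover have "integral {s..t} h = integral {0..t} h - integral {0..s} h"
        by (rule integral_split[OF absint_subinterval[OF h]]) (use st in simp_all)
      moreover have "P t = P 0 + integral {0..t} g" by (rule P) (use st in simp_all)
      moreover have "P s = P 0 + integral {0..s} g" by (rule P) (use st in simp_all)
      moreover have "Q t = Q 0 + integral {0..t} h" by (rule Q) (use st in simp_all)
      moreover have "Q s = Q 0 + integral {0..s} h" by (rule Q) (use st in simp_all)
      ultimately show "P t - P s = integral {s..t} g" "Q t - Q s = integral {s..t} h"
        by (simp_all only: add_diff_cancel_left)
    qed
    have "norm (integral {s..t} g) \<le> integral {s..t} m" "norm (integral {s..t} h) \<le> integral {s..t} m"
      by (rule integral_norm_bound_integral[OF absint_imp_integrable[OF sub] absint_imp_integrable[OF sub[OF m]]], rule g h, simp add: m_def)+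
    then show "norm (P t - P s) \<le> M t - M s" "norm (Q t - Q s) \<le> M t - M s"
      by (simp_all add: * Mdiff[OF st])
  qed
  have "K T = K 0"
  proof (rule quadratically_dominated_imp_constant[OF T _ mono])
    show "continuous_on {0..T} M"
      unfolding M_def by (intro indefinite_integral_continuous_1 absint_imp_integrable[OF m])
    fix s t assume st: "0 \<le> s" "s \<le> t" "t \<le> T"
    have sub: "f absolutely_integrable_on {s..t}" if "f absolutely_integrable_on {0..T}" for f :: "real \<Rightarrow> complex"
      using that st by (rule_tac absint_subinterval[of 0 T f]) auto
    have subm: "m absolutely_integrable_on {s..t}"
      using m st by (rule_tac absint_subinterval[of 0 T m]) auto
    have "K t - K s = P t * Q t - P s * Q s - integral {s..t} (\<lambda>t. g t * Q t) - integral {s..t} (\<lambda>t. P t * h t)"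
      using st integral_split[OF absint_subinterval[OF gQ, of 0 t], of s] integral_split[OF absint_subinterval[OF Ph, of 0 t], of s]
      by (simp add: K_def)
    also have "P t * Q t - P s * Q s = (P t - P s) * Q t + P s * (Q t - Q s)" by (simp add: algebra_simps)
    also have "\<dots> = integral {s..t} (\<lambda>u. g u * Q t) + integral {s..t} (\<lambda>u. P s * h u)"
      by (simp add: Pd[OF st] Qd[OF st] Henstock_Kurzweil_Integration.integral_mult_left Henstock_Kurzweil_Integration.integral_mult_right)
    also have "\<dots> - integral {s..t} (\<lambda>t. g t * Q t) - integral {s..t} (\<lambda>t. P t * h t)
       = integral {s..t} (\<lambda>u. g u * (Q t - Q u) + (P s - P u) * h u)"
    proof -
      have i1: "(\<lambda>u. g u * Q t) integrable_on {s..t}" "(\<lambda>u. P s * h u) integrable_on {s..t}"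
        using absint_imp_integrable[OF sub[OF g]] absint_imp_integrable[OF sub[OF h]]
        by (auto intro: integrable_on_mult_left integrable_on_mult_right)
      have i2: "(\<lambda>u. g u * Q u) integrable_on {s..t}" "(\<lambda>u. P u * h u) integrable_on {s..t}"
        using absint_imp_integrable[OF sub[OF gQ]] absint_imp_integrable[OF sub[OF Ph]] by auto
      have "integral {s..t} (\<lambda>u. g u * (Q t - Q u) + (P s - P u) * h u)
        = integral {s..t} (\<lambda>u. (g u * Q t + P s * h u) - (g u * Q u + P u * h u))"
        by (simp add: algebra_simps)
      then show ?thesis using i1 i2
        by (simp add: Henstock_Kurzweil_Integration.integral_diff Henstock_Kurzweil_Integration.integral_add integrable_add)
    qed
    finally have *: "K t - K s = integral {s..t} (\<lambda>u. g u * (Q t - Q u) + (P s - P u) * h u)" .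
    have c: "continuous_on {s..t} Q" "continuous_on {s..t} P"
      using contP contQ st by (auto elim: continuous_on_subset)
    have "norm (K t - K s) \<le> integral {s..t} (\<lambda>u. (M t - M s) * m u)"
      unfolding *
    proof (rule integral_norm_bound_integral)
      show "(\<lambda>u. (M t - M s) * m u) integrable_on {s..t}"
        using absint_imp_integrable[OF subm] by (rule integrable_on_mult_right)
      have "(\<lambda>u. g u * (Q t - Q u)) integrable_on {s..t}" "(\<lambda>u. h u * (P s - P u)) integrable_on {s..t}"
        by (intro absint_imp_integrable absint_mult_continuous sub g h continuous_intros c)+
      then show "(\<lambda>u. g u * (Q t - Q u) + (P s - P u) * h u) integrable_on {s..t}"
        by (intro integrable_add) (simp_all add: mult.commute)
      fix u assume u: "u \<in> {s..t}"
      have "norm (Q t - Q u) \<le> M t - M s"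
        using Qd(2)[of u t] mono[of s u] u st by auto
      moreover have "norm (P s - P u) \<le> M t - M s"
        using Pd(2)[of s u] mono[of u t] u st by (auto simp: norm_minus_commute)
      moreover have "norm (g u * (Q t - Q u) + (P s - P u) * h u)
         \<le> norm (g u) * norm (Q t - Q u) + norm (P s - P u) * norm (h u)"
        by (metis norm_mult norm_triangle_ineq)
      moreover have "norm (g u) * norm (Q t - Q u) \<le> norm (g u) * (M t - M s)"
        by (intro mult_left_mono calculation) auto
      moreover have "norm (P s - P u) * norm (h u) \<le> (M t - M s) * norm (h u)"
        by (intro mult_right_mono calculation) auto
      ultimately show "norm (g u * (Q t - Q u) + (P s - P u) * h u) \<le> (M t - M s) * m u"
        by (simp add: m_def algebra_simps)
    qed
    also have "\<dots> = (M t - M s)\<^sup>2"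
      by (simp add: Mdiff[OF st] power2_eq_square Henstock_Kurzweil_Integration.integral_mult_right)
    finally show "norm (K t - K s) \<le> (M t - M s)\<^sup>2" .
  qed auto
  then show ?thesis by (simp add: K_def algebra_simps)
qed

text \<open>
  Expand \<open>\<integral>(|f| - c)\<^sup>2 \<ge> 0\<close> for the mean value \<open>c\<close> of \<open>|f|\<close>.
\<close>

lemma Cauchy_Schwarz_interval:
  fixes f :: "real \<Rightarrow> complex"
  assumes ab: "a \<le> b" and f: "f absolutely_integrable_on {a..b}" and f2: "(\<lambda>t. (norm (f t))\<^sup>2) integrable_on {a..b}"
  shows "(integral {a..b} (\<lambda>t. norm (f t)))\<^sup>2 \<le> (b - a) * integral {a..b} (\<lambda>t. (norm (f t))\<^sup>2)"
proof (cases "a = b")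
  case False
  then have ab: "a < b" using ab by simp
  define q where "q = integral {a..b} (\<lambda>t. norm (f t))"
  define c where "c = q / (b - a)"
  have i1: "(\<lambda>t. norm (f t)) integrable_on {a..b}" by (rule absint_norm[OF f])
  have "((\<lambda>t. (norm (f t))\<^sup>2 - 2 * c * norm (f t) + c\<^sup>2) has_integral
      (integral {a..b} (\<lambda>t. (norm (f t))\<^sup>2) - 2 * c * q + (b - a) *\<^sub>R c\<^sup>2)) {a..b}"
    unfolding q_def using ab
    by (intro has_integral_add has_integral_diff integrable_integral f2 has_integral_mult_right i1
        has_integral_const_real[of "c\<^sup>2" a b, simplified]) 
       (use has_integral_const_real[of "c\<^sup>2" a b] in simp)
  then have "0 \<le> integral {a..b} (\<lambda>t. (norm (f t))\<^sup>2) - 2 * c * q + (b - a) *\<^sub>R c\<^sup>2"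
  proof (rule has_integral_nonneg)
    show "0 \<le> (norm (f t))\<^sup>2 - 2 * c * norm (f t) + c\<^sup>2" for t
      using zero_le_power2[of "norm (f t) - c"] by (simp add: power2_diff algebra_simps)
  qed
  also have "\<dots> = integral {a..b} (\<lambda>t. (norm (f t))\<^sup>2) - 2 * c * q + c\<^sup>2 * (b - a)"
    by simp
  also have "\<dots> = integral {a..b} (\<lambda>t. (norm (f t))\<^sup>2) - q\<^sup>2 / (b - a)"
  proof -
    have "c * (b - a) = q" using ab by (simp add: c_def)
    then have "c\<^sup>2 * (b - a) = c * q" by (simp add: power2_eq_square algebra_simps)
    moreover have "c * q = q\<^sup>2 / (b - a)" by (simp add: c_def power2_eq_square)
    ultimately show ?thesis by simp
  qed
  finally show ?thesis using ab by (simp add: q_def field_simps)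
qed simp

lemma sq_integrable_on_iff:
  "S \<in> sets lebesgue \<Longrightarrow> f sq_integrable_on S \<longleftrightarrow>
     f \<in> borel_measurable (lebesgue_on S) \<and> (\<lambda>t. (cmod (f t))\<^sup>2) integrable_on S"
  for S :: "real set"
  unfolding sq_integrable_on_def
  by (metis (no_types, lifting) absolutely_integrable_imp_integrable integrable_on_lebesgue_on
      nonnegative_absolutely_integrable_1 zero_le_power2)

lemma sq_integrable_on_subset:
  assumes "f sq_integrable_on S" "T \<subseteq> S" "S \<in> sets lebesgue" "T \<in> sets lebesgue"
  shows "f sq_integrable_on T"
proof -
  have "f \<in> borel_measurable (lebesgue_on T)"
    using assms by (auto simp: sq_integrable_on_def intro: measurable_restrict_mono)
  moreover have "(\<lambda>t. (cmod (f t))\<^sup>2) absolutely_integrable_on S"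
    using assms by (intro nonnegative_absolutely_integrable_1) (auto simp: sq_integrable_on_iff)
  then have "(\<lambda>t. (cmod (f t))\<^sup>2) absolutely_integrable_on T"
    using assms by (meson set_integrable_subset)
  ultimately show ?thesis using assms by (simp add: sq_integrable_on_iff absint_imp_integrable)
qed

lemma sq_integrable_on_minus_negligible:
  assumes "negligible N" "S \<in> sets lebesgue"
  shows "f sq_integrable_on (S - N) \<longleftrightarrow> f sq_integrable_on S"
proof -
  have N: "N \<in> sets lebesgue" using assms by (simp add: negligible_imp_sets)
  have "(\<lambda>t. (cmod (f t))\<^sup>2) integrable_on (S - N) \<longleftrightarrow> (\<lambda>t. (cmod (f t))\<^sup>2) integrable_on S"
    by (rule integrable_spike_set_eq) (rule negligible_subset[OF assms(1)], auto)
  moreover have "S \<inter> N \<in> null_sets (lebesgue_on S)"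
    using assms by (subst null_sets_restrict_space)
      (auto simp: negligible_iff_null_sets[symmetric] intro: negligible_subset)
  from borel_measurable_diff_null[OF this assms(2), of f]
  have "f \<in> borel_measurable (lebesgue_on (S - N)) \<longleftrightarrow> f \<in> borel_measurable (lebesgue_on S)"
    by (simp add: Diff_Int)
  ultimately show ?thesis
    using assms N by (simp add: sq_integrable_on_iff sets.Diff)
qed

lemma sq_integrable_on_half_closed:
  "f sq_integrable_on {0..} \<longleftrightarrow> f sq_integrable_on {0<..}"
proof -
  have "{0..} - {0} = {0::real<..}" by auto
  then show ?thesis using sq_integrable_on_minus_negligible[of "{0}" "{0..}" f] by simp
qed

lemma sq_integrable_imp_absint:
  assumes "f sq_integrable_on {0<..}" "0 \<le> a"
  shows "f absolutely_integrable_on {a..b}" "(\<lambda>t. (cmod (f t))\<^sup>2) integrable_on {a..b}"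
proof -
  have f: "f sq_integrable_on {a..b}"
    using assms unfolding sq_integrable_on_half_closed[symmetric]
    by (rule_tac sq_integrable_on_subset) auto
  then show i: "(\<lambda>t. (cmod (f t))\<^sup>2) integrable_on {a..b}"
    by (simp add: sq_integrable_on_iff)
  show "f absolutely_integrable_on {a..b}"
  proof (rule measurable_bounded_by_integrable_imp_absolutely_integrable)
    show "(\<lambda>t. 1 + (cmod (f t))\<^sup>2) integrable_on {a..b}"
      by (intro integrable_add i integrable_const_ivl)
    show "norm (f t) \<le> 1 + (cmod (f t))\<^sup>2" for t
    proof -
      have "0 \<le> (cmod (f t))\<^sup>2 + 1 - 2 * cmod (f t)" 
        using zero_le_power2[of "norm (f t) - 1"] by (simp add: power2_diff)
      then show ?thesis using norm_ge_zero[of "f t"] by linarith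
    qed
  qed (use f in \<open>auto simp: sq_integrable_on_def\<close>)
qed

lemma half_line_integral:
  fixes F :: "real \<Rightarrow> complex"
  assumes F: "integrable (lebesgue_on {0<..}) F"
  shows "(LINT t|lebesgue_on {0<..}. F t) = integral {0..} F" "F absolutely_integrable_on {0..}"
proof -
  have a: "F absolutely_integrable_on {0<..}" using F by (simp add: set_integrable_eq)
  have "F absolutely_integrable_on {0<..} \<longleftrightarrow> F absolutely_integrable_on {0..}"
    by (rule absolutely_integrable_spike_set_eq; rule negligible_subset[of "{0}"]; auto)
  with a show "F absolutely_integrable_on {0..}" by simp
  have "(LINT t|lebesgue_on {0<..}. F t) = integral {0<..} F"
    using F by (intro lebesgue_integral_eq_integral) auto
  also have "\<dots> = integral {0..} F"
    by (rule integral_spike_set) (rule negligible_subset[of "{0}"]; auto)+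
  finally show "(LINT t|lebesgue_on {0<..}. F t) = integral {0..} F" .
qed

lemma integral_restrict_interval:
  fixes F :: "real \<Rightarrow> 'a::euclidean_space"
  shows "integral {0..} (\<lambda>t. if t \<in> {0..T} then F t else 0) = integral {0..T} F"
proof -
  have "{0..} \<inter> {0..T} = {0..T}" by auto
  then show ?thesis unfolding Henstock_Kurzweil_Integration.integral_restrict_Int by simp
qed

lemma half_line_integral_vanishing:
  fixes F :: "real \<Rightarrow> complex"
  assumes F: "integrable (lebesgue_on {0<..}) F" and T: "\<And>t. t > T \<Longrightarrow> F t = 0"
  shows "(LINT t|lebesgue_on {0<..}. F t) = integral {0..T} F"
proof -
  have "integral {0..T} F = integral {0..} (\<lambda>t. if t \<in> {0..T} then F t else 0)"
    by (rule integral_restrict_interval[symmetric])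
  also have "\<dots> = integral {0..} F"
    by (rule integral_cong) (use T in \<open>auto simp: not_le\<close>)
  finally show ?thesis using half_line_integral[OF F] by simp
qed

lemma half_line_integral_limit:
  fixes F :: "real \<Rightarrow> complex"
  assumes F: "integrable (lebesgue_on {0<..}) F" and X: "filterlim X at_top sequentially"
  shows "(\<lambda>n. integral {0..X n} F) \<longlonglongrightarrow> (LINT t|lebesgue_on {0<..}. F t)"
proof -
  note F' = half_line_integral[OF F]
  have sub: "F absolutely_integrable_on {0..T}" for T
    using F'(2) by (rule set_integrable_subset) auto
  have "(\<lambda>n. integral {0..} (\<lambda>t. if t \<in> {0..X n} then F t else 0)) \<longlonglongrightarrow> integral {0..} F"
  proof (rule dominated_convergence(2))
    show "(\<lambda>t. if t \<in> {0..X n} then F t else 0) integrable_on {0..}" for n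
      using absint_imp_integrable[OF sub[of "X n"]] by (subst integrable_restrict_Int) (auto simp: Int_absorb2 Int_absorb1 subset_eq)
    show "(\<lambda>t. norm (F t)) integrable_on {0..}" by (rule absint_norm[OF F'(2)])
    fix t :: real assume t: "t \<in> {0..}"
    have "eventually (\<lambda>n. t \<le> X n) sequentially"
      using X by (simp add: filterlim_at_top)
    then have "eventually (\<lambda>n. (if t \<in> {0..X n} then F t else 0) = F t) sequentially"
      by eventually_elim (use t in auto)
    then show "(\<lambda>n. if t \<in> {0..X n} then F t else 0) \<longlonglongrightarrow> F t"
      by (rule tendsto_eventually)
  qed auto
  moreover have "integral {0..} (\<lambda>t. if t \<in> {0..X n} then F t else 0) = integral {0..X n} F" for n
    by (rule integral_restrict_interval)
  ultimately show ?thesis using F' by simp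
qed

lemma sq_integrable_on_if_bounded:
  assumes f: "f \<in> borel_measurable (lebesgue_on {0<..})"
    and i: "\<And>n. (\<lambda>t. (cmod (f t))\<^sup>2) integrable_on {0..X n}" 
    and X: "filterlim X at_top sequentially" "mono X"
    and B: "\<And>n. integral {0..X n} (\<lambda>t. (cmod (f t))\<^sup>2) \<le> B"
  shows "f sq_integrable_on {0<..}"
proof -
  let ?F = "\<lambda>t. (cmod (f t))\<^sup>2"
  have B0: "integral {0..} (\<lambda>t. if t \<in> {0..X n} then ?F t else 0) = integral {0..X n} ?F" for n
    by (rule integral_restrict_interval)
  have "?F integrable_on {0..} \<and>
     (\<lambda>n. integral {0..} (\<lambda>t. if t \<in> {0..X n} then ?F t else 0)) \<longlonglongrightarrow> integral {0..} ?F"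
  proof (rule monotone_convergence_increasing)
    show "(\<lambda>t. if t \<in> {0..X n} then ?F t else 0) integrable_on {0..}" for n
      using i[of n] by (subst integrable_restrict_Int) (auto simp: Int_absorb2 Int_absorb1 subset_eq)
    show "(if t \<in> {0..X n} then ?F t else 0) \<le> (if t \<in> {0..X (Suc n)} then ?F t else 0)" for t n
      using monoD[OF X(2), of n "Suc n"] by auto
    fix t :: real assume t: "t \<in> {0..}"
    have "eventually (\<lambda>n. t \<le> X n) sequentially"
      using X by (simp add: filterlim_at_top)
    then have "eventually (\<lambda>n. (if t \<in> {0..X n} then ?F t else 0) = ?F t) sequentially"
      by eventually_elim (use t in auto)
    then show "(\<lambda>n. if t \<in> {0..X n} then ?F t else 0) \<longlonglongrightarrow> ?F t"
      by (rule tendsto_eventually)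
  next
    show "bounded (range (\<lambda>n. integral {0..} (\<lambda>t. if t \<in> {0..X n} then ?F t else 0)))"
      unfolding B0 
      by (rule boundedI[of _ B]) (use B in \<open>auto simp: Henstock_Kurzweil_Integration.integral_nonneg i\<close>)
  qed
  then have *: "?F integrable_on {0..}" by simp
  have "?F integrable_on {0<..}"
  proof -
    have "negligible ({0..} - {0<..} \<union> ({0<..} - {0::real..}))"
      by (rule negligible_subset[of "{0}"]) auto
    from integrable_spike_set_eq[OF this, of ?F] * show ?thesis by blast
  qed
  then show ?thesis using f by (simp add: sq_integrable_on_iff)
qed

section \<open>Solutions of the jump problem: Green formula, existence, uniqueness\<close>

text \<open>
  Lebesgue differentiation recovers \<open>g\<close> almost everywhere from its integrals over
  short intervals.
\<close>

lemma zero_if_primitive_zero: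
  fixes g :: "real \<Rightarrow> complex"
  assumes g: "\<And>T. g absolutely_integrable_on {0..T}" and 0: "\<And>t. t \<ge> 0 \<Longrightarrow> integral {0..t} g = 0"
  obtains N where "negligible N" "\<And>t. t \<ge> 0 \<Longrightarrow> t \<notin> N \<Longrightarrow> g t = 0"
proof -
  \<comment> \<open>The differentiation theorem concerns functions that are integrable on all intervals of the line.\<close>
  define f where "f = (\<lambda>t. if t \<in> {0..} then g t else 0)"
  have "f integrable_on cbox a b" for a b
  proof -
    have "{0..} \<inter> {a..b} = {max 0 a..b}" by auto
    moreover have "g integrable_on {max 0 a..b}"
      by (rule absint_imp_integrable[OF absint_subinterval[OF g[of b]]]) auto
    moreover have "f integrable_on {a..b} \<longleftrightarrow> g integrable_on {0..} \<inter> {a..b}"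
      unfolding f_def by (rule integrable_restrict_Int)
    ultimately show ?thesis by simp
  qed
  then obtain N where N: "negligible N"
    "\<And>x e. \<lbrakk>x \<notin> N; 0 < e\<rbrakk> \<Longrightarrow> \<exists>d>0. \<forall>h. 0 < h \<and> h < d \<longrightarrow>
          norm (integral (cbox x (x + h *\<^sub>R One)) f /\<^sub>R h ^ DIM(real) - f x) < e"
    using integrable_ccontinuous_explicit[of f] by metis
  have "g t = 0" if t: "t \<ge> 0" "t \<notin> N" for t
  proof (rule ccontr)
    assume "g t \<noteq> 0"
    then obtain d where d: "d > 0" "\<And>h. 0 < h \<and> h < d \<Longrightarrow>
       norm (integral (cbox t (t + h *\<^sub>R One)) f /\<^sub>R h ^ DIM(real) - f t) < norm (g t)"
      using N(2)[OF t(2), of "norm (g t)"] by auto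
    have "integral {t..t + d/2} f = integral {t..t + d/2} g"
      by (rule integral_cong) (use t in \<open>auto simp: f_def\<close>)
    also have "\<dots> = integral {0..t + d/2} g - integral {0..t} g"
      by (rule integral_split[OF g]) (use t d in auto)
    also have "\<dots> = 0" using 0 t d by simp
    finally show False using d(2)[of "d/2"] d(1) t by (simp add: f_def)
  qed
  with N(1) show ?thesis by (rule that)
qed

lemma step_integral:
  fixes h :: "real \<Rightarrow> complex"
  assumes h: "h absolutely_integrable_on {s..t}" and st: "a \<le> s" "s \<le> t"
  shows "((\<lambda>u. if s < u then h u else 0) has_integral (integral {s..t} h)) {a..t}"
    "(\<lambda>u. if s < u then h u else 0) absolutely_integrable_on {a..t}"
proof -
  let ?k = "\<lambda>u. if s < u then h u else 0"
  have "(?k has_integral 0) {a..s}" by (rule has_integral_is_0) auto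
  moreover have "(?k has_integral (integral {s..t} h)) {s..t}"
    by (rule has_integral_spike_finite[of "{s}" _ _ h]) (use absint_imp_integrable[OF h] in auto)
  ultimately have "(?k has_integral (0 + integral {s..t} h)) {a..t}"
    using st by (rule_tac has_integral_combine[of a s t]) auto
  then show i: "(?k has_integral (integral {s..t} h)) {a..t}" by simp
  let ?n = "\<lambda>u. if s < u then norm (h u) else 0"
  have "(?n has_integral 0) {a..s}" by (rule has_integral_is_0) auto
  moreover have "(?n has_integral (integral {s..t} (\<lambda>u. norm (h u)))) {s..t}"
    by (rule has_integral_spike_finite[of "{s}" _ _ "\<lambda>u. norm (h u)"]) (use absint_norm[OF h] in auto)
  ultimately have "?n integrable_on {a..t}"
    using st has_integral_combine[of a s t ?n] by blast
  moreover have "(\<lambda>u. norm (?k u)) = ?n" by auto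
  ultimately show "?k absolutely_integrable_on {a..t}"
    unfolding absolutely_integrable_on_def using i by (auto simp: has_integral_integrable)
qed

lemma absint_sum: "finite I \<Longrightarrow> (\<And>i. i \<in> I \<Longrightarrow> f i absolutely_integrable_on S) \<Longrightarrow>
   (\<lambda>t. \<Sum>i\<in>I. f i t) absolutely_integrable_on S" for f :: "'i \<Rightarrow> real \<Rightarrow> complex"
  by (induction I rule: finite_induct) (auto intro: set_integral_add)

lemma absint_mult_right: "f absolutely_integrable_on S \<Longrightarrow> (\<lambda>t. c * f t) absolutely_integrable_on S"
  for c :: complex
  by (rule set_integrable_mult_right) auto

lemma absint_primitive:
  fixes g :: "real \<Rightarrow> complex"
  assumes "g absolutely_integrable_on {0..T}"
  shows "continuous_on {0..T} (\<lambda>t. integral {0..t} g)" 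
    "(\<lambda>t. integral {0..t} g) absolutely_integrable_on {0..T}"
proof -
  show c: "continuous_on {0..T} (\<lambda>t. integral {0..t} g)"
    using assms by (intro indefinite_integral_continuous_1 absint_imp_integrable)
  show "(\<lambda>t. integral {0..t} g) absolutely_integrable_on {0..T}"
    by (rule absolutely_integrable_continuous_real[OF c])
qed

lemma absint_cong:
  fixes f g :: "real \<Rightarrow> complex"
  assumes "f absolutely_integrable_on S" "\<And>t. t \<in> S \<Longrightarrow> g t = f t"
  shows "g absolutely_integrable_on S"
  by (rule absolutely_integrable_spike[OF assms(1) negligible_empty]) (use assms(2) in auto)

text \<open>
  Points \<open>0 = x\<^sub>0 < x\<^sub>1 < \<dots>\<close> without finite accumulation point; the couplings are arbitrary.
\<close>

locale nodes =
  fixes x :: "nat \<Rightarrow> real" and \<alpha> :: "nat \<Rightarrow> real"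
  assumes strict: "strict_mono x" and x0 [simp]: "x 0 = 0" and lim: "filterlim x at_top sequentially"
begin

definition nodes_below :: "real \<Rightarrow> nat set" where "nodes_below t = {n. 1 \<le> n \<and> x n < t}"

definition jumps :: "(real \<Rightarrow> complex) \<Rightarrow> real \<Rightarrow> complex" where
  "jumps f t = (\<Sum>n\<in>nodes_below t. of_real (\<alpha> n) * f (x n))"

text \<open>
  The differential equation, the jump conditions and the condition \<open>f'(0+) = 0\<close> in one
  integral equation: \<open>f1\<close> is the left-continuous first derivative, and \<open>f2\<close> is the second
  derivative, of which only the class modulo null sets matters. No condition is imposed at
  infinity.
\<close>

definition sol :: "(real \<Rightarrow> complex) \<Rightarrow> (real \<Rightarrow> complex) \<Rightarrow> (real \<Rightarrow> complex) \<Rightarrow> bool" where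
  "sol f f1 f2 \<longleftrightarrow> (\<forall>T. f2 absolutely_integrable_on {0..T}) \<and>
     (\<forall>t\<ge>0. f1 t = jumps f t + integral {0..t} f2) \<and> (\<forall>t\<ge>0. f t = f 0 + integral {0..t} f1)"

lemma x_less [simp]: "x m < x n \<longleftrightarrow> m < n" using strict by (simp add: strict_mono_less)
lemma x_le [simp]: "x m \<le> x n \<longleftrightarrow> m \<le> n" using strict by (simp add: strict_mono_less_eq)
lemma x_ge0 [simp]: "0 \<le> x n" using x_le[of 0 n] by simp
lemma x_pos [simp]: "0 < x n \<longleftrightarrow> 0 < n" using x_less[of 0 n] by simp

lemma finite_nodes_below [simp]: "finite (nodes_below t)"
proof -
  have "eventually (\<lambda>n. t < x n) sequentially" using lim by (simp add: filterlim_at_top_dense)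
  then obtain N where N: "\<And>n. n \<ge> N \<Longrightarrow> t < x n" by (auto simp: eventually_sequentially)
  have "n < N" if "n \<in> nodes_below t" for n
    by (rule ccontr) (use N[of n] that in \<open>simp add: nodes_below_def\<close>)
  then have "nodes_below t \<subseteq> {..<N}" by auto
  then show ?thesis by (rule finite_subset) auto
qed

lemma nodes_below_node [simp]: "nodes_below (x n) = {1..<n}" by (auto simp: nodes_below_def)
lemma nodes_below_0 [simp]: "nodes_below 0 = {}" using nodes_below_node[of 0] by simp
lemma nodes_below_mono: "s \<le> t \<Longrightarrow> nodes_below s \<subseteq> nodes_below t" by (auto simp: nodes_below_def)

lemma sum_nodes_below:
  fixes h :: "nat \<Rightarrow> 'a::comm_monoid_add"
  assumes "t \<le> T" shows "(\<Sum>n\<in>nodes_below t. h n) = (\<Sum>n\<in>nodes_below T. if x n < t then h n else 0)"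
proof -
  have "nodes_below t = {n\<in>nodes_below T. x n < t}" using assms by (auto simp: nodes_below_def)
  then show ?thesis by (simp add: sum.inter_filter)
qed

lemma locate:
  assumes "t > 0" obtains n where "x n < t" "t \<le> x (Suc n)"
proof -
  have "eventually (\<lambda>n. t \<le> x n) sequentially" using lim by (simp add: filterlim_at_top)
  then obtain N where "t \<le> x N" by (auto simp: eventually_sequentially)
  define m where "m = (LEAST n. t \<le> x n)"
  have m: "t \<le> x m" unfolding m_def using \<open>t \<le> x N\<close> by (rule LeastI)
  then have "m \<noteq> 0" using assms by (intro notI) simp
  then obtain n where n: "m = Suc n" using not0_implies_Suc by blast
  have "\<not> t \<le> x n" using not_less_Least[of n "\<lambda>n. t \<le> x n"] n unfolding m_def by auto
  with m n that show thesis by (simp add: not_le)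
qed

lemma absint_step_mult:
  fixes c :: "nat \<Rightarrow> complex" and g :: "real \<Rightarrow> complex"
  assumes g: "g absolutely_integrable_on {0..T}" and T: "0 \<le> T"
  shows "(\<lambda>t. (\<Sum>n\<in>nodes_below t. c n) * g t) absolutely_integrable_on {0..T}"
    "integral {0..T} (\<lambda>t. (\<Sum>n\<in>nodes_below t. c n) * g t) = (\<Sum>n\<in>nodes_below T. c n * integral {x n..T} g)"
proof -
  let ?h = "\<lambda>t. \<Sum>n\<in>nodes_below T. c n * (if x n < t then g t else 0)"
  have eq: "?h t = (\<Sum>n\<in>nodes_below t. c n) * g t" if "t \<in> {0..T}" for t
  proof -
    have "(\<Sum>n\<in>nodes_below t. c n) = (\<Sum>n\<in>nodes_below T. if x n < t then c n else 0)"
      using that by (intro sum_nodes_below) auto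
    then show ?thesis by (auto simp: sum_distrib_right intro!: sum.cong)
  qed
  have n: "g absolutely_integrable_on {x n..T}" "0 \<le> x n" "x n \<le> T" if "n \<in> nodes_below T" for n
    using that by (auto simp: nodes_below_def intro: absint_subinterval[OF g])
  have i: "(\<lambda>t. if x n < t then g t else 0) absolutely_integrable_on {0..T}"
    "((\<lambda>t. if x n < t then g t else 0) has_integral (integral {x n..T} g)) {0..T}" if "n \<in> nodes_below T" for n
    using step_integral[OF n[OF that]] by auto
  have "?h absolutely_integrable_on {0..T}"
    by (intro absint_sum absint_mult_right i) auto
  then show "(\<lambda>t. (\<Sum>n\<in>nodes_below t. c n) * g t) absolutely_integrable_on {0..T}"
    by (rule absint_cong) (rule eq[symmetric])
  have *: "(?h has_integral (\<Sum>n\<in>nodes_below T. c n * integral {x n..T} g)) {0..T}"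
    by (intro has_integral_sum has_integral_mult_right i) auto
  show "integral {0..T} (\<lambda>t. (\<Sum>n\<in>nodes_below t. c n) * g t) = (\<Sum>n\<in>nodes_below T. c n * integral {x n..T} g)"
    by (rule integral_unique, rule has_integral_eq[OF _ *], rule eq)
qed

lemma absint_const: "(\<lambda>t. c) absolutely_integrable_on {a..b::real}" for c :: complex
  by (rule absolutely_integrable_continuous_real) auto

lemma solI:
  assumes "\<And>T. f2 absolutely_integrable_on {0..T}"
    and "\<And>t. t \<ge> 0 \<Longrightarrow> f1 t = jumps f t + integral {0..t} f2"
    and "\<And>t. t \<ge> 0 \<Longrightarrow> f t = f 0 + integral {0..t} f1"
  shows "sol f f1 f2"
  unfolding sol_def using assms by blast

lemma solD:
  assumes "sol f f1 f2"
  shows "f2 absolutely_integrable_on {0..T}" 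
   "t \<ge> 0 \<Longrightarrow> f1 t = jumps f t + integral {0..t} f2"
   "t \<ge> 0 \<Longrightarrow> f t = f 0 + integral {0..t} f1"
   "f1 absolutely_integrable_on {0..T}"
   "continuous_on {0..} f" "f1 0 = 0"
proof -
  show f2: "f2 absolutely_integrable_on {0..T}" for T using assms by (simp add: sol_def)
  show f1: "t \<ge> 0 \<Longrightarrow> f1 t = jumps f t + integral {0..t} f2" for t using assms by (simp add: sol_def)
  show f: "t \<ge> 0 \<Longrightarrow> f t = f 0 + integral {0..t} f1" for t using assms unfolding sol_def by blast
  show a1: "f1 absolutely_integrable_on {0..T}" for T
  proof (cases "T \<ge> 0")
    case True
    have "(\<lambda>t. (\<Sum>n\<in>nodes_below t. of_real (\<alpha> n) * f (x n)) * 1 + integral {0..t} f2) absolutely_integrable_on {0..T}"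
      by (intro set_integral_add(1) absint_step_mult absint_const absint_primitive f2 True)
    then show ?thesis
      by (rule absint_cong) (auto simp: f1 jumps_def)
  qed simp
  show "continuous_on {0..} f"
  proof (subst continuous_on_eq_continuous_within, intro ballI)
    fix t :: real assume t: "t \<in> {0..}"
    have "continuous_on {0..t+1} (\<lambda>t. f 0 + integral {0..t} f1)"
      by (intro continuous_intros absint_primitive a1)
    then have "continuous_on {0..t+1} f"
      by (rule continuous_on_eq) (metis f atLeastAtMost_iff)
    then have "continuous (at t within {0..t+1}) f"
      using t by (simp add: continuous_on_eq_continuous_within)
    moreover have "at t within {0..t+1} = at t within {0..}"
      by (rule at_within_nhd[of _ "{..<t+1}"]) auto
    ultimately show "continuous (at t within {0..}) f" by (simp add: continuous_within)
  qed
  show "f1 0 = 0" using f1[of 0] by (simp add: jumps_def)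
qed

lemma sol_continuous: "sol f f1 f2 \<Longrightarrow> continuous_on {0..T} f"
  using solD(5) by (rule continuous_on_subset) auto

lemma sol_integral: 
  assumes "sol f f1 f2" "0 \<le> s" "s \<le> t"
  shows "f t - f s = integral {s..t} f1"
    "f1 t - f1 s = (\<Sum>n\<in>nodes_below t - nodes_below s. of_real (\<alpha> n) * f (x n)) + integral {s..t} f2"
proof -
  note D = solD[OF assms(1)]
  have "f t = f 0 + integral {0..t} f1" "f s = f 0 + integral {0..s} f1"
    using assms(2,3) by (intro D(3); simp)+
  moreover have "integral {s..t} f1 = integral {0..t} f1 - integral {0..s} f1"
    using assms(2,3) by (intro integral_split[OF D(4)]) auto
  ultimately show "f t - f s = integral {s..t} f1" by (simp only: add_diff_cancel_left)
  have "jumps f t - jumps f s = (\<Sum>n\<in>nodes_below t - nodes_below s. of_real (\<alpha> n) * f (x n))"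
    unfolding jumps_def using nodes_below_mono[OF assms(3)] by (simp add: sum_diff)
  then show "f1 t - f1 s = (\<Sum>n\<in>nodes_below t - nodes_below s. of_real (\<alpha> n) * f (x n)) + integral {s..t} f2"
    using D(2)[of t] D(2)[of s] integral_split[OF D(1)[of t], of s] assms(2,3) by (simp add: algebra_simps)
qed

text \<open>
  The jumps of \<open>f1\<close> are split off before integrating by parts, since only the rest is a
  primitive. They leave the sum over the nodes, which is symmetric in \<open>f\<close> and \<open>G\<close> and hence
  cancels in the Green formula.
\<close>

lemma green_test:
  assumes f: "sol f f1 f2" and T: "0 \<le> T" and G1: "G1 absolutely_integrable_on {0..T}"
    and G: "\<And>t. 0 \<le> t \<Longrightarrow> t \<le> T \<Longrightarrow> G t = G 0 + integral {0..t} G1"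
  shows "integral {0..T} (\<lambda>t. f2 t * G t) + integral {0..T} (\<lambda>t. f1 t * G1 t)
      = f1 T * G T - (\<Sum>n\<in>nodes_below T. of_real (\<alpha> n) * f (x n) * G (x n))"
    "(\<lambda>t. f1 t * G1 t) absolutely_integrable_on {0..T}"
proof -
  note D = solD[OF f]
  define P where "P = (\<lambda>t. integral {0..t} f2)"
  have parts: "integral {0..T} (\<lambda>t. f2 t * G t) + integral {0..T} (\<lambda>t. P t * G1 t) = P T * G T"
    using integration_by_parts_AC[OF T D(1) G1, of P G, OF _ G] by (simp add: P_def)
  have j: "(\<lambda>t. jumps f t * G1 t) absolutely_integrable_on {0..T}"
    "integral {0..T} (\<lambda>t. jumps f t * G1 t) = (\<Sum>n\<in>nodes_below T. (of_real (\<alpha> n) * f (x n)) * integral {x n..T} G1)"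
    unfolding jumps_def by (rule absint_step_mult[OF G1 T])+
  have p: "(\<lambda>t. P t * G1 t) absolutely_integrable_on {0..T}"
    unfolding P_def using absint_mult_continuous[OF G1 absint_primitive(1)[OF D(1)]] by (simp add: mult.commute)
  have eq: "f1 t * G1 t = jumps f t * G1 t + P t * G1 t" if "t \<in> {0..T}" for t
    using that D(2)[of t] by (simp add: P_def distrib_right)
  have "(\<lambda>t. jumps f t * G1 t + P t * G1 t) absolutely_integrable_on {0..T}"
    using j p by (intro set_integral_add)
  then show "(\<lambda>t. f1 t * G1 t) absolutely_integrable_on {0..T}"
    by (rule absint_cong) (auto simp: eq)
  have "integral {0..T} (\<lambda>t. f1 t * G1 t) = integral {0..T} (\<lambda>t. jumps f t * G1 t + P t * G1 t)"
    by (rule integral_cong) (rule eq)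
  also have "\<dots> = integral {0..T} (\<lambda>t. jumps f t * G1 t) + integral {0..T} (\<lambda>t. P t * G1 t)"
    by (intro Henstock_Kurzweil_Integration.integral_add absint_imp_integrable j p)
  also have "integral {0..T} (\<lambda>t. jumps f t * G1 t) = (\<Sum>n\<in>nodes_below T. (of_real (\<alpha> n) * f (x n)) * (G T - G (x n)))"
    unfolding j
  proof (rule sum.cong[OF refl])
    fix n assume "n \<in> nodes_below T"
    then have n: "0 \<le> x n" "x n \<le> T" by (auto simp: nodes_below_def)
    have "integral {x n..T} G1 = integral {0..T} G1 - integral {0..x n} G1"
      by (rule integral_split[OF G1]) (use n in auto)
    also have "\<dots> = G T - G (x n)"
    proof -
      have "G T = G 0 + integral {0..T} G1" "G (x n) = G 0 + integral {0..x n} G1"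
        using n T by (intro G; simp)+
      then show ?thesis by (simp only: add_diff_cancel_left)
    qed
    finally show "(of_real (\<alpha> n) * f (x n)) * integral {x n..T} G1 = (of_real (\<alpha> n) * f (x n)) * (G T - G (x n))" by simp
  qed
  also have "\<dots> = jumps f T * G T - (\<Sum>n\<in>nodes_below T. of_real (\<alpha> n) * f (x n) * G (x n))"
    by (simp add: jumps_def right_diff_distrib sum_subtractf sum_distrib_right)
  finally show "integral {0..T} (\<lambda>t. f2 t * G t) + integral {0..T} (\<lambda>t. f1 t * G1 t)
      = f1 T * G T - (\<Sum>n\<in>nodes_below T. of_real (\<alpha> n) * f (x n) * G (x n))"
    using parts D(2)[OF T] by (simp add: P_def algebra_simps)
qed

lemma green:
  assumes f: "sol f f1 f2" and v: "sol v v1 v2" and T: "0 \<le> T"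
  shows "integral {0..T} (\<lambda>t. f2 t * v t) - integral {0..T} (\<lambda>t. f t * v2 t) = f1 T * v T - f T * v1 T"
proof -
  have A: "integral {0..T} (\<lambda>t. f2 t * v t) + integral {0..T} (\<lambda>t. f1 t * v1 t)
      = f1 T * v T - (\<Sum>n\<in>nodes_below T. of_real (\<alpha> n) * f (x n) * v (x n))"
    by (rule green_test[OF f T solD(4)[OF v]]) (rule solD(3)[OF v])
  have B: "integral {0..T} (\<lambda>t. v2 t * f t) + integral {0..T} (\<lambda>t. v1 t * f1 t)
      = v1 T * f T - (\<Sum>n\<in>nodes_below T. of_real (\<alpha> n) * v (x n) * f (x n))"
    by (rule green_test[OF v T solD(4)[OF f]]) (rule solD(3)[OF f])
  have E: "(\<lambda>t. v2 t * f t) = (\<lambda>t. f t * v2 t)" "(\<lambda>t. v1 t * f1 t) = (\<lambda>t. f1 t * v1 t)"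
    "(\<lambda>n. of_real (\<alpha> n) * v (x n) * f (x n)) = (\<lambda>n. of_real (\<alpha> n) * f (x n) * v (x n))"
    "v1 T * f T = f T * v1 T"
    by (simp_all add: mult_ac)
  have "a - b = c - d" if "a + s = c - r" "b + s = d - r" for a b c d r s :: complex
    using that by (metis add_diff_cancel_right diff_diff_eq2 diff_add_cancel)
  from this[OF A B[unfolded E]] show ?thesis .
qed

lemma sol_add:
  assumes f: "sol f f1 f2" and g: "sol g g1 g2"
  shows "sol (\<lambda>t. f t + g t) (\<lambda>t. f1 t + g1 t) (\<lambda>t. f2 t + g2 t)"
proof -
  note D = solD[OF f] and E = solD[OF g]
  show ?thesis
  proof (rule solI)
    show "f t + g t = f 0 + g 0 + integral {0..t} (\<lambda>t. f1 t + g1 t)" if "t \<ge> 0" for t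
      unfolding Henstock_Kurzweil_Integration.integral_add[OF absint_imp_integrable[OF D(4)] absint_imp_integrable[OF E(4)]]
      by (subst D(3)[OF that], subst E(3)[OF that]) simp
    show "f1 t + g1 t = jumps (\<lambda>t. f t + g t) t + integral {0..t} (\<lambda>t. f2 t + g2 t)" if "t \<ge> 0" for t
      unfolding Henstock_Kurzweil_Integration.integral_add[OF absint_imp_integrable[OF D(1)] absint_imp_integrable[OF E(1)]]
      by (simp add: D(2) E(2) that jumps_def distrib_left sum.distrib)
  qed (intro set_integral_add D E)
qed

lemma sol_mult:
  assumes f: "sol f f1 f2"
  shows "sol (\<lambda>t. c * f t) (\<lambda>t. c * f1 t) (\<lambda>t. c * f2 t)"
proof -
  note D = solD[OF f]
  show ?thesis
  proof (rule solI)
    show "c * f t = c * f 0 + integral {0..t} (\<lambda>t. c * f1 t)" if "t \<ge> 0" for t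
      unfolding Henstock_Kurzweil_Integration.integral_mult_right
      by (subst D(3)[OF that]) (simp add: distrib_left)
    show "c * f1 t = jumps (\<lambda>t. c * f t) t + integral {0..t} (\<lambda>t. c * f2 t)" if "t \<ge> 0" for t
      unfolding Henstock_Kurzweil_Integration.integral_mult_right
      by (simp add: D(2) that jumps_def distrib_left sum_distrib_left mult_ac)
  qed (intro absint_mult_right D)
qed

lemma sol_cnj:
  assumes f: "sol f f1 f2"
  shows "sol (\<lambda>t. cnj (f t)) (\<lambda>t. cnj (f1 t)) (\<lambda>t. cnj (f2 t))"
proof -
  note D = solD[OF f]
  show ?thesis
  proof (rule solI)
    show "cnj (f t) = cnj (f 0) + integral {0..t} (\<lambda>t. cnj (f1 t))" if "t \<ge> 0" for t
      unfolding integral_cnj[symmetric] by (subst D(3)[OF that]) simp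
    show "(\<lambda>t. cnj (f2 t)) absolutely_integrable_on {0..T}" for T
      using D(1) by (simp add: absolutely_integrable_on_def integrable_on_cnj_iff)
    show "cnj (f1 t) = jumps (\<lambda>t. cnj (f t)) t + integral {0..t} (\<lambda>t. cnj (f2 t))" if "t \<ge> 0" for t
      unfolding integral_cnj[symmetric] by (simp add: D(2) that jumps_def)
  qed
qed

lemma sol_cong_negligible:
  assumes f: "sol f f1 f2" and N: "negligible N" and g: "\<And>t. t \<ge> 0 \<Longrightarrow> t \<notin> N \<Longrightarrow> f2 t = g2 t"
  shows "sol f f1 g2"
proof -
  note D = solD[OF f]
  have "g2 absolutely_integrable_on {0..T}" for T
    by (rule absolutely_integrable_spike[OF D(1) N]) (use g in auto)
  moreover have "integral {0..t} f2 = integral {0..t} g2" for t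
    by (rule integral_spike[OF N]) (use g in auto)
  ultimately show ?thesis by (intro solI D(3)) (simp_all add: D(2))
qed

text \<open>
  Here \<open>z\<close> is \<open>0\<close> or a spectral parameter. On a bounded interval \<open>[T, t]\<close> there are finitely many
  nodes, and the integral equation is a contraction for the supremum norm with weight
  \<open>exp (- l (u - T))\<close> once \<open>l\<close> is large compared with \<open>|z|\<close> and the sum \<open>A\<close> of the couplings.
\<close>

lemma sol_unique:
  assumes f: "sol w w1 w2" and T: "0 \<le> T" "w T = 0" "w1 T = 0"
    and w2: "\<And>t. t > T \<Longrightarrow> w2 t = - z * w t"
  shows "t \<ge> T \<Longrightarrow> w t = 0" "t \<ge> T \<Longrightarrow> w1 t = 0"
proof -
  note D = solD[OF f]
  show w0: "w t = 0" if t: "t \<ge> T" for t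
  proof -
    define A where "A = (\<Sum>n\<in>nodes_below t. \<bar>\<alpha> n\<bar>)"
    have A0: "A \<ge> 0" by (simp add: A_def sum_nonneg)
    define l where "l = 2 * (norm z + A + 1)"
    have l: "l \<ge> 2" using A0 by (simp add: l_def)
    define e where "e = (\<lambda>u. exp (l * (u - T)))"
    have e0: "e u > 0" for u by (simp add: e_def)
    have emono: "e u \<le> e v" if "u \<le> v" for u v using that l by (simp add: e_def)
    have int_e: "(e has_integral (e v / l - 1 / l)) {T..v}" if "T \<le> v" for v
    proof -
      have "((\<lambda>u. e u / l) has_real_derivative e u) (at u within {T..v})" for u
        unfolding e_def using l by (auto intro!: derivative_eq_intros)
      then have "(e has_integral (e v / l - e T / l)) {T..v}"
        using that by (intro fundamental_theorem_of_calculus)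
          (auto simp: has_real_derivative_iff_has_vector_derivative)
      then show ?thesis by (simp add: e_def)
    qed
    have "continuous_on {T..t} (\<lambda>u. norm (w u) / e u)"
      unfolding e_def using T by (intro continuous_intros continuous_on_subset[OF D(5)]) auto
    then obtain m where m: "m \<in> {T..t}" "\<And>u. u \<in> {T..t} \<Longrightarrow> norm (w u) / e u \<le> norm (w m) / e m"
      using continuous_attains_sup[of "{T..t}" "\<lambda>u. norm (w u) / e u"] t by auto
    define M where "M = norm (w m) / e m"
    have M0: "M \<ge> 0" using e0[of m] by (simp add: M_def)
    have wM: "norm (w u) \<le> M * e u" if "T \<le> u" "u \<le> t" for u
      using m(2)[of u] that e0[of u] by (simp add: M_def divide_le_eq)
    have w1M: "norm (w1 u) \<le> (A + norm z) * M * e u" if u: "T \<le> u" "u \<le> t" for u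
    proof -
      have "w1 u = (\<Sum>n\<in>nodes_below u - nodes_below T. of_real (\<alpha> n) * w (x n)) + integral {T..u} w2"
        using sol_integral(2)[OF f T(1) u(1)] T by simp
      moreover have "norm (\<Sum>n\<in>nodes_below u - nodes_below T. of_real (\<alpha> n) * w (x n)) \<le> A * (M * e u)"
      proof -
        have "norm (\<Sum>n\<in>nodes_below u - nodes_below T. of_real (\<alpha> n) * w (x n)) \<le> (\<Sum>n\<in>nodes_below u - nodes_below T. \<bar>\<alpha> n\<bar> * (M * e u))"
        proof (rule sum_norm_le)
          fix n assume "n \<in> nodes_below u - nodes_below T"
          then have n: "T \<le> x n" "x n < u" by (auto simp: nodes_below_def not_less)
          have "norm (w (x n)) \<le> M * e (x n)" using n u by (intro wM) auto
          also have "\<dots> \<le> M * e u" using n M0 by (intro mult_left_mono emono) auto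
          finally show "norm (of_real (\<alpha> n) * w (x n)) \<le> \<bar>\<alpha> n\<bar> * (M * e u)"
            by (simp add: norm_mult mult_left_mono)
        qed
        also have "\<dots> = (\<Sum>n\<in>nodes_below u - nodes_below T. \<bar>\<alpha> n\<bar>) * (M * e u)" by (simp add: sum_distrib_right)
        also have "\<dots> \<le> A * (M * e u)"
          unfolding A_def using M0 e0[of u] nodes_below_mono[OF u(2)] 
          by (intro mult_right_mono sum_mono2) auto
        finally show ?thesis .
      qed
      moreover have "norm (integral {T..u} w2) \<le> norm z * M * e u"
      proof -
        have "integral {T..u} w2 = integral {T..u} (\<lambda>v. - z * w v)"
          by (rule integral_spike[of "{T}"]) (use w2 in auto)
        also have "norm \<dots> \<le> integral {T..u} (\<lambda>v. norm z * M * e v)"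
        proof (rule integral_norm_bound_integral)
          show "(\<lambda>v. - z * w v) integrable_on {T..u}"
            using T by (intro integrable_continuous_real continuous_intros continuous_on_subset[OF D(5)]) auto
          show "(\<lambda>v. norm z * M * e v) integrable_on {T..u}"
            using int_e[OF u(1)] by (intro integrable_on_mult_right) auto
          fix v assume v: "v \<in> {T..u}"
          have "norm (w v) \<le> M * e v" using v u by (intro wM) auto
          then have "norm z * norm (w v) \<le> norm z * (M * e v)" by (intro mult_left_mono) auto
          then show "norm (- z * w v) \<le> norm z * M * e v" by (simp add: norm_mult mult.assoc)
        qed
        also have "\<dots> = norm z * M * (e u / l - 1 / l)"
          using int_e[OF u(1)] by (simp add: Henstock_Kurzweil_Integration.integral_mult_right integral_unique)
        also have "\<dots> \<le> norm z * M * e u"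
        proof -
          have "e u / l - 1 / l \<le> e u / 1" using l e0[of u] by (intro order_trans[OF _ divide_left_mono[of 1 l]]) auto
          then show ?thesis using M0 by (intro mult_left_mono) auto
        qed
        finally show ?thesis .
      qed
      ultimately have "norm (w1 u) \<le> A * (M * e u) + norm z * M * e u"
        by (simp only: norm_triangle_mono)
      then show ?thesis by (simp add: algebra_simps)
    qed
    have "norm (w m) \<le> (A + norm z) * M * (e m / l)"
    proof -
      have m': "T \<le> m" "m \<le> t" using m by auto
      have "w m = integral {T..m} w1" using sol_integral(1)[OF f T(1) m'(1)] T by simp
      also have "norm \<dots> \<le> integral {T..m} (\<lambda>v. (A + norm z) * M * e v)"
      proof (rule integral_norm_bound_integral)
        show "w1 integrable_on {T..m}" using T by (intro absint_imp_integrable[OF absint_subinterval[OF D(4)[of m]]]) auto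
        show "(\<lambda>v. (A + norm z) * M * e v) integrable_on {T..m}"
          using int_e[OF m'(1)] by (intro integrable_on_mult_right) auto
      qed (use w1M m' in auto)
      also have "\<dots> = (A + norm z) * M * (e m / l - 1 / l)"
        using int_e[OF m'(1)] by (simp add: Henstock_Kurzweil_Integration.integral_mult_right integral_unique)
      also have "\<dots> \<le> (A + norm z) * M * (e m / l)"
        using l A0 M0 by (intro mult_left_mono) auto
      finally show ?thesis .
    qed
    also have "\<dots> = M * e m * ((A + norm z) / l)" by simp
    also have "\<dots> \<le> M * e m * (1/2)"
    proof (rule mult_left_mono)
      show "(A + norm z) / l \<le> 1/2" using l by (simp add: pos_divide_le_eq l_def)
    qed (use M0 e0[of m] in auto)
    finally have "M * e m \<le> M * e m * (1/2)" using e0[of m] by (simp add: M_def)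
    then have "M = 0" using M0 e0[of m] by (simp add: mult_le_0_iff)
    then show ?thesis using wM[of t] t by simp
  qed
  show "w1 t = 0" if t: "t \<ge> T" for t
  proof -
    have "(\<Sum>n\<in>nodes_below t - nodes_below T. of_real (\<alpha> n) * w (x n)) = 0"
      by (rule sum.neutral) (auto simp: nodes_below_def not_less w0)
    moreover have "integral {T..t} w2 = 0"
      by (rule integral_unique, rule has_integral_spike_finite[of "{T}" _ _ "\<lambda>_. 0"]) (use w2 w0 in auto)
    ultimately show ?thesis using sol_integral(2)[OF f T(1) t] T by simp
  qed
qed

text \<open>
  Every node emits a multiple of the fundamental solution \<open>S(t - x\<^sub>n)\<close> of \<open>S'' = - z S\<close>,
  with \<open>S(0) = 0\<close> and \<open>C = S'\<close>, \<open>C(0) = 1\<close>; it produces the jump of the derivative. The values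
  \<open>a\<^sub>n\<close> at the nodes are determined successively. For \<open>z = 0\<close>, where \<open>S(t) = t\<close>, this solves the
  equation with an arbitrary right-hand side, and for \<open>F = C\<close> the eigenvalue equation.
\<close>

lemma sol_exists:
  fixes S C F F1 F2 :: "real \<Rightarrow> complex"
  assumes S: "\<And>t. t \<ge> 0 \<Longrightarrow> S t = integral {0..t} C" and C: "\<And>t. t \<ge> 0 \<Longrightarrow> C t = 1 - z * integral {0..t} S"
    and cont: "continuous_on {0..} C" "continuous_on {0..} S"
    and F: "\<And>t. t \<ge> 0 \<Longrightarrow> F t = F 0 + integral {0..t} F1" and F1: "\<And>t. t \<ge> 0 \<Longrightarrow> F1 t = integral {0..t} F2"
    and F2: "\<And>T. F2 absolutely_integrable_on {0..T}" 
  obtains f f1 where "sol f f1 (\<lambda>t. F2 t - z * (f t - F t))" "f 0 = F 0"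
proof -
  have "\<exists>a. \<forall>n. a n = F (x n) + (\<Sum>m\<in>{1..<n}. of_real (\<alpha> m) * a m * S (x n - x m))"
  proof -
    define H where "H = (\<lambda>(a::nat\<Rightarrow>complex) n. F (x n) + (\<Sum>m\<in>{1..<n}. of_real (\<alpha> m) * a m * S (x n - x m)))"
    have "wfrec less_than H n = H (wfrec less_than H) n" for n
    proof -
      have "wfrec less_than H n = H (cut (wfrec less_than H) less_than n) n" by (rule wfrec) simp
      also have "\<dots> = H (wfrec less_than H) n"
        unfolding H_def by (auto intro!: sum.cong simp: cut_apply)
      finally show ?thesis .
    qed
    then show ?thesis unfolding H_def by blast
  qed
  then obtain a where a: "\<And>n. a n = F (x n) + (\<Sum>m\<in>{1..<n}. of_real (\<alpha> m) * a m * S (x n - x m))" by blast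
  define f where "f = (\<lambda>t. F t + (\<Sum>n\<in>nodes_below t. of_real (\<alpha> n) * a n * S (t - x n)))"
  define f1 where "f1 = (\<lambda>t. F1 t + (\<Sum>n\<in>nodes_below t. of_real (\<alpha> n) * a n * C (t - x n)))"
  have fx: "f (x n) = a n" for n using a[of n] by (simp add: f_def)
  have f0: "f 0 = F 0" by (simp add: f_def)
  have F1a: "F1 absolutely_integrable_on {0..T}" for T
    using absint_primitive(2)[OF F2[of T]]
    by (rule absint_cong) (auto simp: F1)
  have shift: "((\<lambda>u. \<Sum>n\<in>nodes_below u. c n * h (u - x n)) has_integral (\<Sum>n\<in>nodes_below t. c n * integral {0..t - x n} h)) {0..t}"
    "(\<lambda>u. \<Sum>n\<in>nodes_below u. c n * h (u - x n)) absolutely_integrable_on {0..t}"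
    if h: "continuous_on {0..} h" for c :: "nat \<Rightarrow> complex" and h t
  proof -
    have hn: "(\<lambda>u. h (u - x n)) absolutely_integrable_on {x n..t}" for n
      by (intro absolutely_integrable_continuous_real continuous_on_compose2[OF h] continuous_intros) auto
    have eq: "(\<Sum>n\<in>nodes_below u. c n * h (u - x n)) = (\<Sum>n\<in>nodes_below t. c n * (if x n < u then h (u - x n) else 0))"
      if "u \<in> {0..t}" for u
      using that by (subst sum_nodes_below[of u t]) (auto intro!: sum.cong)
    have i: "integral {x n..t} (\<lambda>u. h (u - x n)) = integral {0..t - x n} h" if "x n \<le> t" for n
      using integral_shift_Icc_real[of 0 "t - x n" "\<lambda>u. h (u - x n)" "x n"] by (simp add: o_def)
    have *: "((\<lambda>u. \<Sum>n\<in>nodes_below t. c n * (if x n < u then h (u - x n) else 0)) has_integral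
        (\<Sum>n\<in>nodes_below t. c n * integral {0..t - x n} h)) {0..t}"
      using step_integral(1)[OF hn, where a=0]
      by (intro has_integral_sum has_integral_mult_right finite_nodes_below) (auto simp: i[symmetric] nodes_below_def)
    show "((\<lambda>u. \<Sum>n\<in>nodes_below u. c n * h (u - x n)) has_integral (\<Sum>n\<in>nodes_below t. c n * integral {0..t - x n} h)) {0..t}"
      by (rule has_integral_eq[OF _ *]) (simp only: eq)
    have "(\<lambda>u. \<Sum>n\<in>nodes_below t. c n * (if x n < u then h (u - x n) else 0)) absolutely_integrable_on {0..t}"
      using step_integral(2)[OF hn, where a=0]
      by (intro absint_sum absint_mult_right finite_nodes_below) (auto simp: nodes_below_def)
    then show "(\<lambda>u. \<Sum>n\<in>nodes_below u. c n * h (u - x n)) absolutely_integrable_on {0..t}"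
      by (rule absint_cong) (simp_all only: eq)
  qed
  have f_eq: "f t = f 0 + integral {0..t} f1" if t: "t \<ge> 0" for t
  proof -
    have "integral {0..t} f1 = integral {0..t} F1 + (\<Sum>n\<in>nodes_below t. of_real (\<alpha> n) * a n * integral {0..t - x n} C)"
      unfolding f1_def using shift(1)[OF cont(1), of "\<lambda>n. of_real (\<alpha> n) * a n" t]
      by (intro integral_unique has_integral_add integrable_integral absint_imp_integrable F1a)
    also have "(\<Sum>n\<in>nodes_below t. of_real (\<alpha> n) * a n * integral {0..t - x n} C) = (\<Sum>n\<in>nodes_below t. of_real (\<alpha> n) * a n * S (t - x n))"
      by (intro sum.cong) (auto simp: S nodes_below_def)
    finally show ?thesis using F[OF t] by (simp add: f_def)
  qed
  have g: "f t - F t = (\<Sum>n\<in>nodes_below t. of_real (\<alpha> n) * a n * S (t - x n))" for t by (simp add: f_def)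
  have ga: "(\<lambda>t. z * (f t - F t)) absolutely_integrable_on {0..T}" for T
    unfolding g by (intro absint_mult_right shift cont)
  have f1_eq: "f1 t = jumps f t + integral {0..t} (\<lambda>t. F2 t - z * (f t - F t))" if t: "t \<ge> 0" for t
  proof -
    have "integral {0..t} (\<lambda>t. F2 t - z * (f t - F t)) =
       integral {0..t} F2 - z * (\<Sum>n\<in>nodes_below t. of_real (\<alpha> n) * a n * integral {0..t - x n} S)"
      unfolding g using shift(1)[OF cont(2), of "\<lambda>n. of_real (\<alpha> n) * a n" t]
      by (intro integral_unique has_integral_diff has_integral_mult_right integrable_integral absint_imp_integrable F2)
    moreover have "(\<Sum>n\<in>nodes_below t. of_real (\<alpha> n) * a n * C (t - x n)) = (\<Sum>n\<in>nodes_below t. of_real (\<alpha> n) * a n * (1 - z * integral {0..t - x n} S))"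
      by (intro sum.cong) (auto simp: C nodes_below_def)
    ultimately show ?thesis
      using F1[OF t] by (simp add: f1_def jumps_def fx right_diff_distrib sum_subtractf sum_distrib_left mult_ac)
  qed
  have "sol f f1 (\<lambda>t. F2 t - z * (f t - F t))"
    by (rule solI[OF _ f1_eq f_eq]) (intro set_integral_diff F2 ga)
  from this f0 show thesis by (rule that)
qed

lemma sol_exists_0:
  assumes F2: "\<And>T. F2 absolutely_integrable_on {0..T}"
  obtains f f1 where "sol f f1 F2" "f 0 = c"
proof -
  define F where "F = (\<lambda>t. c + integral {0..t} (\<lambda>t. integral {0..t} F2))"
  have "complex_of_real t = integral {0..t} (\<lambda>_. 1)" if "t \<ge> 0" for t
    using that by (simp add: scaleR_conv_of_real)
  then obtain f f1 where "sol f f1 (\<lambda>t. F2 t - 0 * (f t - F t))" "f 0 = F 0"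
    by (rule sol_exists[of complex_of_real "\<lambda>_. 1" 0 F "\<lambda>t. integral {0..t} F2" F2])
      (auto simp: F_def intro!: continuous_intros F2)
  then show thesis using that[of f f1] by (simp add: F_def)
qed

end

section \<open>From weak derivatives to primitives\<close>

text \<open>
  The weight \<open>w = (u - s)(t - u)\<close> is positive inside the interval. Take for \<open>c\<close> the
  \<open>w\<close>-average of \<open>\<rho>\<close>; then \<open>\<eta> = w (\<rho> - c)\<close> has mean zero, so its primitive vanishes outside the
  interval, and orthogonality to \<open>\<eta>\<close> says \<open>\<integral>w (\<rho> - c)\<^sup>2 = 0\<close>. Being the primitive of a continuous
  function, \<open>\<phi>\<close> is continuously differentiable, as a test function should be.
\<close>

lemma du_Bois_Reymond_real:
  fixes \<rho> :: "real \<Rightarrow> real"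
  assumes st: "s < t" and \<rho>: "continuous_on {s..t} \<rho>"
    and orth: "\<And>\<eta> \<phi>. continuous_on UNIV \<eta> \<Longrightarrow> (\<And>u. u \<notin> {s..t} \<Longrightarrow> \<eta> u = 0) \<Longrightarrow>
       (\<And>u. u \<notin> {s..t} \<Longrightarrow> \<phi> u = 0) \<Longrightarrow> (\<And>u. (\<phi> has_real_derivative \<eta> u) (at u)) \<Longrightarrow>
       integral {s..t} (\<lambda>u. \<eta> u * \<rho> u) = 0"
  obtains c where "\<And>u. u \<in> {s<..<t} \<Longrightarrow> \<rho> u = c"
proof -
  define w where "w = (\<lambda>u::real. max 0 ((u - s) * (t - u)))"
  have wc: "continuous_on A w" for A unfolding w_def by (intro continuous_intros)
  have w0: "w u \<ge> 0" for u by (simp add: w_def)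
  have wpos: "w u > 0" if "u \<in> {s<..<t}" for u using that by (simp add: w_def)
  have wz: "w u = 0" if "u \<notin> {s<..<t}" for u
  proof -
    have "(u - s) * (t - u) \<le> 0"
      using that st by (auto simp: mult_le_0_iff not_less)
    then show ?thesis by (simp add: w_def)
  qed
  define W where "W = integral {s..t} w"
  have "W \<noteq> 0"
  proof
    assume "W = 0"
    then have "(w has_integral 0) (cbox s t)"
      unfolding W_def using integrable_integral[OF integrable_continuous_real[OF wc], of s t] by simp
    moreover have "(s + t)/2 \<in> {s<..<t}" using st by (simp add: field_simps)
    ultimately have "w ((s+t)/2) = 0"
      using st by (intro has_integral_0_cbox_imp_0[OF wc w0]) (auto simp: box_real)
    then show False using wpos[of "(s+t)/2"] st by (simp add: field_simps)
  qed
  define c where "c = integral {s..t} (\<lambda>u. w u * \<rho> u) / W"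
  define \<eta> where "\<eta> = (\<lambda>u. if u \<in> {s..t} then w u * (\<rho> u - c) else 0)"
  have etac: "continuous_on UNIV \<eta>"
  proof -
    have "continuous_on ({s..t} \<union> ({..s} \<union> {t..})) \<eta>"
      unfolding \<eta>_def
    proof (rule continuous_on_cases)
      show "continuous_on {s..t} (\<lambda>u. w u * (\<rho> u - c))" by (intro continuous_intros wc \<rho>)
      show "\<forall>u. u \<in> {s..t} \<and> u \<notin> {s..t} \<or> u \<in> {..s} \<union> {t..} \<and> u \<in> {s..t} \<longrightarrow> w u * (\<rho> u - c) = 0"
        using wz by auto
    qed auto
    moreover have "{s..t} \<union> ({..s} \<union> {t..}) = UNIV" by auto
    ultimately show ?thesis by simp
  qed
  have eta0: "\<eta> u = 0" if "u \<notin> {s<..<t}" for u using wz[OF that] by (simp add: \<eta>_def)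
  have wr: "(\<lambda>u. w u * \<rho> u) integrable_on {s..t}"
    by (intro integrable_continuous_real continuous_intros wc \<rho>)
  have wi: "w integrable_on {s..t}" by (intro integrable_continuous_real wc)
  have int_eta: "integral {s..t} \<eta> = 0"
  proof -
    have "integral {s..t} \<eta> = integral {s..t} (\<lambda>u. w u * \<rho> u - c * w u)"
      by (rule integral_cong) (simp add: \<eta>_def algebra_simps)
    also have "\<dots> = integral {s..t} (\<lambda>u. w u * \<rho> u) - c * W"
      unfolding W_def by (intro integral_unique has_integral_diff has_integral_mult_right integrable_integral wr wi)
    also have "\<dots> = 0" using \<open>W \<noteq> 0\<close> by (simp add: c_def)
    finally show ?thesis .
  qed
  define \<phi> where "\<phi> = (\<lambda>u. integral {s - 1..u} \<eta>)"
  have eta_i: "\<eta> integrable_on {a..b}" for a b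
    by (rule integrable_continuous_real) (rule continuous_on_subset[OF etac], simp)
  have phi0: "\<phi> u = 0" if "u \<notin> {s..t}" for u
  proof (cases "u < s")
    case True
    have "integral {s-1..u} \<eta> = integral {s-1..u} (\<lambda>_. 0)"
      by (rule integral_cong) (use True eta0 in auto)
    then show ?thesis by (simp add: \<phi>_def)
  next
    case False
    then have u: "u > t" using that by auto
    have "\<phi> u = integral {s-1..s} \<eta> + integral {s..u} \<eta>"
      unfolding \<phi>_def using u st by (intro Henstock_Kurzweil_Integration.integral_combine[symmetric] eta_i) auto
    also have "integral {s..u} \<eta> = integral {s..t} \<eta> + integral {t..u} \<eta>"
      using u st by (intro Henstock_Kurzweil_Integration.integral_combine[symmetric] eta_i) auto
    also have "integral {t..u} \<eta> = integral {t..u} (\<lambda>_. 0)"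
      by (rule integral_cong) (use eta0 in auto)
    also have "integral {s-1..s} \<eta> = integral {s-1..s} (\<lambda>_. 0)"
      by (rule integral_cong) (use eta0 in auto)
    finally show ?thesis by (simp add: int_eta)
  qed
  have deriv: "(\<phi> has_real_derivative \<eta> u) (at u)" for u
  proof (cases "u < s")
    case True
    have "((\<lambda>_. 0) has_real_derivative 0) (at u)" by simp
    moreover have "eventually (\<lambda>v. v \<in> {..<s}) (nhds u)"
      using True by (intro eventually_nhds_in_open) auto
    then have "eventually (\<lambda>v. 0 = \<phi> v) (nhds u)"
      by eventually_elim (use phi0 in auto)
    ultimately have "(\<phi> has_real_derivative 0) (at u)"
      using DERIV_cong_ev[OF refl _ refl, of "\<lambda>_. 0" \<phi> u 0] by simp
    then show ?thesis using eta0[of u] True by auto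
  next
    case False
    have "((\<lambda>u. integral {s-1..u} \<eta>) has_real_derivative \<eta> u) (at u within {s-1..u+1})"
      using False by (intro integral_has_real_derivative continuous_on_subset[OF etac]) auto
    then show ?thesis
      unfolding \<phi>_def using False by (subst (asm) at_within_interior) auto
  qed
  have "integral {s..t} (\<lambda>u. \<eta> u * \<rho> u) = 0"
    using etac eta0 phi0 deriv by (intro orth[of \<eta> \<phi>]) auto
  moreover have "integral {s..t} (\<lambda>u. w u * (\<rho> u - c)\<^sup>2) = integral {s..t} (\<lambda>u. \<eta> u * \<rho> u) - c * integral {s..t} \<eta>"
  proof -
    have "integral {s..t} (\<lambda>u. w u * (\<rho> u - c)\<^sup>2) = integral {s..t} (\<lambda>u. \<eta> u * \<rho> u - c * \<eta> u)"
      by (rule integral_cong) (simp add: \<eta>_def algebra_simps power2_eq_square)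
    also have "\<dots> = integral {s..t} (\<lambda>u. \<eta> u * \<rho> u) - c * integral {s..t} \<eta>"
      by (intro integral_unique has_integral_diff has_integral_mult_right integrable_integral eta_i
         integrable_continuous_real continuous_intros \<rho> continuous_on_subset[OF etac]) auto
    finally show ?thesis .
  qed
  ultimately have 0: "integral {s..t} (\<lambda>u. w u * (\<rho> u - c)\<^sup>2) = 0" by (simp add: int_eta)
  have cont: "continuous_on {s..t} (\<lambda>u. w u * (\<rho> u - c)\<^sup>2)" by (intro continuous_intros wc \<rho>)
  then have "((\<lambda>u. w u * (\<rho> u - c)\<^sup>2) has_integral 0) (cbox s t)"
    using integrable_integral[OF integrable_continuous_real[OF cont]] 0 by simp
  then have "w u * (\<rho> u - c)\<^sup>2 = 0" if "u \<in> {s<..<t}" for u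
    using that cont w0 st by (intro has_integral_0_cbox_imp_0[where f="\<lambda>u. w u * (\<rho> u - c)\<^sup>2"]) (auto simp: box_real)
  then have "\<rho> u = c" if "u \<in> {s<..<t}" for u using wpos[OF that] that by force
  then show thesis by (rule that)
qed

text \<open>
  Integrating \<open>\<phi> g\<close> by parts moves the derivative onto \<open>\<phi>\<close>, so \<open>f\<close> minus the primitive of \<open>g\<close>
  is orthogonal to the derivatives of all test functions. Test functions are real, which is why real
  and imaginary part are treated separately.
\<close>

lemma weak_derivative_primitive:
  fixes f g :: "real \<Rightarrow> complex"
  assumes U: "U \<subseteq> {0<..}" "open U" "negligible ({0<..} - U)"
    and wd: "weak_derivative U f g" and f: "continuous_on U f"
    and g: "\<And>T. g absolutely_integrable_on {0..T}"
    and st: "s < t" "{s..t} \<subseteq> U"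
  obtains c where "\<And>u. u \<in> {s<..<t} \<Longrightarrow> f u - integral {0..u} g = c"
proof -
  define G where "G = (\<lambda>u. integral {0..u} g)"
  have "s \<in> U" using st by auto
  then have s0: "s > 0" using U(1) by auto
  have fc: "continuous_on {s..t} f" using f st(2) by (rule continuous_on_subset)
  have Gc: "continuous_on {s..t} G"
    unfolding G_def using s0 by (intro continuous_on_subset[OF absint_primitive(1)[OF g[of t]]]) auto
  have LU: "(LINT u|lebesgue_on U. h u) = integral {s..t} h"
    if h: "h absolutely_integrable_on {s..t}" "\<And>u. u \<notin> {s..t} \<Longrightarrow> h u = 0" for h :: "real \<Rightarrow> complex"
  proof -
    have e: "{u \<in> {s..t} - U. h u \<noteq> 0} = {}" "{u \<in> U - {s..t}. h u \<noteq> 0} = {}"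
      using h(2) st by auto
    have "h absolutely_integrable_on U"
      by (rule absolutely_integrable_spike_set[OF h(1)]) (simp_all only: e negligible_empty)
    then have "integrable (lebesgue_on U) h" using U by (intro absolutely_integrable_imp_integrable) auto
    then have "(LINT u|lebesgue_on U. h u) = integral U h" using U by (intro lebesgue_integral_eq_integral) auto
    also have "\<dots> = integral {s..t} h"
      by (rule integral_spike_set) (simp_all only: e negligible_empty)
    finally show ?thesis .
  qed
  have main: "integral {s..t} (\<lambda>u. of_real (\<eta> u) * (f u - G u)) = 0"
    if eta: "continuous_on UNIV \<eta>" "\<And>u. u \<notin> {s..t} \<Longrightarrow> \<eta> u = 0"
     and phi: "\<And>u. u \<notin> {s..t} \<Longrightarrow> \<phi> u = 0" "\<And>u. (\<phi> has_real_derivative \<eta> u) (at u)" for \<eta> \<phi> :: "real \<Rightarrow> real"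
  proof -
    have der: "deriv \<phi> = \<eta>" using phi(2) by (auto intro: DERIV_imp_deriv)
    have supp: "closure {u. \<phi> u \<noteq> 0} \<subseteq> {s..t}"
    proof (rule closure_minimal)
      show "{u. \<phi> u \<noteq> 0} \<subseteq> {s..t}" using phi(1) by blast
    qed simp
    have "test_function U \<phi>"
      unfolding test_function_def der
    proof (intro conjI allI)
      show "\<phi> differentiable at u" for u using phi(2) by (auto simp: real_differentiable_def)
      show "compact (closure {u. \<phi> u \<noteq> 0})"
        using supp by (metis compact_Icc compact_Int_closed closed_closure inf.absorb_iff2)
    qed (use eta supp st in auto)
    with wd have *: "(LINT u|lebesgue_on U. \<eta> u *\<^sub>R f u) = - (LINT u|lebesgue_on U. \<phi> u *\<^sub>R g u)"
      unfolding weak_derivative_def der[symmetric] by blast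
    have etac: "continuous_on {a..b} (\<lambda>u. complex_of_real (\<eta> u))" for a b
      by (intro continuous_intros continuous_on_subset[OF eta(1)]) auto
    have phic: "continuous_on {a..b} (\<lambda>u. complex_of_real (\<phi> u))" for a b
      by (intro continuous_intros continuous_at_imp_continuous_on ballI DERIV_isCont[OF phi(2)])
    have gs: "g absolutely_integrable_on {s..t}" using s0 by (rule_tac absint_subinterval[OF g[of t]]) auto
    have 1: "(LINT u|lebesgue_on U. \<eta> u *\<^sub>R f u) = integral {s..t} (\<lambda>u. of_real (\<eta> u) * f u)"
      unfolding scaleR_conv_of_real
      by (rule LU) (auto intro!: absolutely_integrable_continuous_real continuous_intros fc etac simp: eta(2))
    have 2: "(LINT u|lebesgue_on U. \<phi> u *\<^sub>R g u) = integral {s..t} (\<lambda>u. of_real (\<phi> u) * g u)"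
      unfolding scaleR_conv_of_real
      using absint_mult_continuous[OF gs phic] phi(1) by (intro LU) (auto simp: mult.commute)
    have t0: "0 \<le> t" using s0 st by simp
    have phi_eq: "complex_of_real (\<phi> u) = of_real (\<phi> 0) + integral {0..u} (\<lambda>u. of_real (\<eta> u))" if "0 \<le> u" for u
    proof -
      have "((\<lambda>u. complex_of_real (\<phi> u)) has_vector_derivative of_real (\<eta> v)) (at v within {0..u})" for v
        using phi(2)[of v] by (intro has_vector_derivative_of_real)
          (auto intro: has_vector_derivative_at_within simp: has_real_derivative_iff_has_vector_derivative)
      then have "((\<lambda>u. complex_of_real (\<eta> u)) has_integral (of_real (\<phi> u) - of_real (\<phi> 0))) {0..u}"
        using that by (intro fundamental_theorem_of_calculus) auto
      then show ?thesis by (simp add: integral_unique)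
    qed
    have parts: "integral {0..t} (\<lambda>u. g u * of_real (\<phi> u)) + integral {0..t} (\<lambda>u. G u * of_real (\<eta> u))
       = G t * of_real (\<phi> t) - G 0 * of_real (\<phi> 0)"
      by (rule integration_by_parts_AC[OF t0 g _ _ phi_eq]) (auto simp: G_def intro!: absolutely_integrable_continuous_real etac)
    have "isCont \<phi> t" using phi(2) by (rule DERIV_isCont)
    have "\<phi> t = 0"
    proof -
      have "(\<phi> \<longlongrightarrow> \<phi> t) (at_right t)" using \<open>isCont \<phi> t\<close> by (simp add: isCont_def filterlim_at_split)
      moreover have "eventually (\<lambda>u. \<phi> u = 0) (at_right t)"
        using phi(1) by (auto simp: eventually_at_filter)
      then have "(\<phi> \<longlongrightarrow> 0) (at_right t)" by (rule tendsto_eventually)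
      ultimately show ?thesis by (rule tendsto_unique[rotated]) simp
    qed
    moreover have "\<phi> 0 = 0" using s0 phi(1) by auto
    moreover have "integral {0..t} h = integral {s..t} h" if "\<And>u. u \<notin> {s..t} \<Longrightarrow> h u = 0" for h :: "real \<Rightarrow> complex"
    proof -
      have e: "{u \<in> {s..t} - {0..t}. h u \<noteq> 0} = {}" "{u \<in> {0..t} - {s..t}. h u \<noteq> 0} = {}"
        using that s0 by auto
      show ?thesis by (rule integral_spike_set) (simp_all only: e negligible_empty)
    qed
    ultimately have 3: "integral {s..t} (\<lambda>u. of_real (\<phi> u) * g u) + integral {s..t} (\<lambda>u. of_real (\<eta> u) * G u) = 0"
      using parts phi(1) eta(2) by (simp add: mult.commute)
    have "integral {s..t} (\<lambda>u. of_real (\<eta> u) * (f u - G u)) =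
       integral {s..t} (\<lambda>u. of_real (\<eta> u) * f u) - integral {s..t} (\<lambda>u. of_real (\<eta> u) * G u)"
      unfolding right_diff_distrib
      by (intro Henstock_Kurzweil_Integration.integral_diff integrable_continuous_real continuous_intros etac fc Gc)
    then show ?thesis using * 1 2 3 by (simp add: add_eq_0_iff)
  qed
  have int: "(\<lambda>u. of_real (\<eta> u) * (f u - G u)) integrable_on {s..t}" if "continuous_on UNIV \<eta>" for \<eta> :: "real \<Rightarrow> real"
    by (intro integrable_continuous_real continuous_intros fc Gc continuous_on_subset[OF that]) auto
  obtain a where a: "\<And>u. u \<in> {s<..<t} \<Longrightarrow> Re (f u - G u) = a"
  proof (rule du_Bois_Reymond_real[OF st(1), of "\<lambda>u. Re (f u - G u)"])
    fix \<eta> \<phi> :: "real \<Rightarrow> real" assume *: "continuous_on UNIV \<eta>" "\<And>u. u \<notin> {s..t} \<Longrightarrow> \<eta> u = 0"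
      "\<And>u. u \<notin> {s..t} \<Longrightarrow> \<phi> u = 0" "\<And>u. (\<phi> has_real_derivative \<eta> u) (at u)"
    have "integral {s..t} (\<lambda>u. \<eta> u * Re (f u - G u)) = Re (integral {s..t} (\<lambda>u. of_real (\<eta> u) * (f u - G u)))"
      using integral_linear[OF int[OF *(1)] bounded_linear_Re] by (simp add: o_def)
    then show "integral {s..t} (\<lambda>u. \<eta> u * Re (f u - G u)) = 0" using main[OF *] by simp
  qed (intro continuous_intros fc Gc, rule that)
  obtain b where b: "\<And>u. u \<in> {s<..<t} \<Longrightarrow> Im (f u - G u) = b"
  proof (rule du_Bois_Reymond_real[OF st(1), of "\<lambda>u. Im (f u - G u)"])
    fix \<eta> \<phi> :: "real \<Rightarrow> real" assume *: "continuous_on UNIV \<eta>" "\<And>u. u \<notin> {s..t} \<Longrightarrow> \<eta> u = 0"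
      "\<And>u. u \<notin> {s..t} \<Longrightarrow> \<phi> u = 0" "\<And>u. (\<phi> has_real_derivative \<eta> u) (at u)"
    have "integral {s..t} (\<lambda>u. \<eta> u * Im (f u - G u)) = Im (integral {s..t} (\<lambda>u. of_real (\<eta> u) * (f u - G u)))"
      using integral_linear[OF int[OF *(1)] bounded_linear_Im] by (simp add: o_def)
    then show "integral {s..t} (\<lambda>u. \<eta> u * Im (f u - G u)) = 0" using main[OF *] by simp
  qed (intro continuous_intros fc Gc, rule that)
  have "f u - integral {0..u} g = Complex a b" if "u \<in> {s<..<t}" for u
    using a[OF that] b[OF that] by (simp add: complex_eq_iff G_def)
  then show thesis by (rule that)
qed

section \<open>Solutions with bounded support lie in the pre-Hamiltonian\<close>

lemma sq_integrable_on_bounded_support: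
  assumes f: "f absolutely_integrable_on {0..T}" and b: "bounded (f ` {0..T})"
    and z: "\<And>t. t > T \<Longrightarrow> f t = 0"
  shows "f sq_integrable_on {0<..}"
proof -
  obtain B where B: "\<And>t. t \<in> {0..T} \<Longrightarrow> cmod (f t) \<le> B"
    using b unfolding bounded_iff by blast
  have m: "f \<in> borel_measurable (lebesgue_on {0..T})"
    using f by (rule absolutely_integrable_imp_borel_measurable) simp
  have e: "{t \<in> {0..T} - {0<..}. f t \<noteq> 0} \<subseteq> {0}" "{t \<in> {0<..} - {0..T}. f t \<noteq> 0} \<subseteq> {}"
    by (auto, metis z not_le)
  have "f absolutely_integrable_on {0<..}"
    by (rule absolutely_integrable_spike_set[OF f negligible_subset[OF _ e(1)] negligible_subset[OF _ e(2)]]) simp_all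
  then have m0: "f \<in> borel_measurable (lebesgue_on {0<..})"
    by (rule absolutely_integrable_imp_borel_measurable) simp
  have "(\<lambda>t. (cmod (f t))\<^sup>2) absolutely_integrable_on {0..T}"
  proof (rule measurable_bounded_by_integrable_imp_absolutely_integrable)
    show "(\<lambda>t. (cmod (f t))\<^sup>2) \<in> borel_measurable (lebesgue_on {0..T})"
      using m by measurable
    show "(\<lambda>t. B\<^sup>2) integrable_on {0..T}" by (rule integrable_const_ivl)
    show "norm ((cmod (f t))\<^sup>2) \<le> B\<^sup>2" if "t \<in> {0..T}" for t
      using B[OF that] by (simp add: power_mono)
  qed simp
  then have "(\<lambda>t. (cmod (f t))\<^sup>2) absolutely_integrable_on {0<..}"
    by (rule absolutely_integrable_spike_set)
       (use e negligible_subset[OF _ e(1)] negligible_subset[OF _ e(2)] in simp_all)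
  then show ?thesis using m0 by (simp add: sq_integrable_on_iff absint_imp_integrable)
qed

context nodes
begin

abbreviation "U \<equiv> {0<..} - range x"

lemma U_eq: "U = (\<Union>n. {x n<..<x (Suc n)})"
proof (intro equalityI subsetI)
  fix t assume t: "t \<in> U"
  then obtain n where n: "x n < t" "t \<le> x (Suc n)" using locate[of t] by auto
  then have "t < x (Suc n)" using t by (cases "t = x (Suc n)") auto
  then show "t \<in> (\<Union>n. {x n<..<x (Suc n)})" using n by auto
next
  fix t assume "t \<in> (\<Union>n. {x n<..<x (Suc n)})"
  then obtain n where n: "x n < t" "t < x (Suc n)" by auto
  have "t \<noteq> x m" for m
  proof
    assume "t = x m"
    with n have "n < m" "m < Suc n" by auto
    then show False by simp
  qed
  moreover have "0 < t" using n(1) x_ge0[of n] by linarith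
  ultimately show "t \<in> U" by auto
qed

lemma piece_subset_U: "{x n<..<x (Suc n)} \<subseteq> U" unfolding U_eq by blast

lemma open_U: "open U" unfolding U_eq by auto

lemma negligible_nodes: "negligible (range x)"
  by (metis countable_imp_null_set_lborel countableI_type countable_image null_sets_completionI negligible_iff_null_sets)

lemma negligible_compl_U: "negligible ({0<..} - U)"
  by (rule negligible_subset[OF negligible_nodes]) auto

lemma sets_U [simp]: "U \<in> sets lebesgue" using open_U by simp

lemma sq_integrable_U: "f sq_integrable_on U \<longleftrightarrow> f sq_integrable_on {0<..}"
  by (rule sq_integrable_on_minus_negligible[OF negligible_nodes]) simp

lemma LINT_U:
  fixes h :: "real \<Rightarrow> complex"
  assumes h: "h absolutely_integrable_on {0..T}" and z: "\<And>t. t > T \<Longrightarrow> h t = 0"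
  shows "(LINT t|lebesgue_on U. h t) = integral {0..T} h"
proof -
  have n: "negligible {u \<in> {0..T} - U. h u \<noteq> 0}" "negligible {u \<in> U - {0..T}. h u \<noteq> 0}"
    by (rule negligible_subset[of "{0} \<union> range x"]; use z negligible_nodes in \<open>auto simp: not_le\<close>)+
  have "h absolutely_integrable_on U"
    by (rule absolutely_integrable_spike_set[OF h n])
  then have "integrable (lebesgue_on U) h" by (intro absolutely_integrable_imp_integrable) auto
  then have "(LINT t|lebesgue_on U. h t) = integral U h" by (intro lebesgue_integral_eq_integral) auto
  also have "\<dots> = integral {0..T} h" by (rule integral_spike_set[OF n(2,1)])
  finally show ?thesis .
qed

text \<open>
  The right-hand limit of the derivative at the node. At the origin, which carries no
  coupling, it is the derivative itself.
\<close>

definition right_deriv :: "(real \<Rightarrow> complex) \<Rightarrow> (real \<Rightarrow> complex) \<Rightarrow> nat \<Rightarrow> complex" where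
  "right_deriv f f1 n = f1 (x n) + (if n = 0 then 0 else of_real (\<alpha> n) * f (x n))"

lemma nodes_below_piece: "x n < t \<Longrightarrow> t \<le> x (Suc n) \<Longrightarrow> nodes_below t = {1..n}"
proof -
  assume t: "x n < t" "t \<le> x (Suc n)"
  have "x m < t \<longleftrightarrow> m \<le> n" for m
  proof
    assume "x m < t"
    then have "x m < x (Suc n)" using t by linarith
    then show "m \<le> n" by simp
  next
    assume "m \<le> n"
    then have "x m \<le> x n" by simp
    then show "x m < t" using t by linarith
  qed
  then have "nodes_below t = {m. 1 \<le> m \<and> m \<le> n}" unfolding nodes_below_def by (simp only:)
  then show "nodes_below t = {1..n}" by (simp add: atLeastAtMost_def atLeast_def atMost_def Collect_conj_eq)
qed

lemma sol_deriv_on_piece: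
  assumes f: "sol f f1 f2" and t: "x n < t" "t \<le> x (Suc n)"
  shows "f1 t = right_deriv f f1 n + integral {x n..t} f2"
proof -
  have "nodes_below t - nodes_below (x n) = (if n = 0 then {} else {n})"
    using nodes_below_piece[OF t] by auto
  then show ?thesis
    using sol_integral(2)[OF f x_ge0, of n t] t by (auto simp: right_deriv_def algebra_simps)
qed

lemma sol_deriv_continuous:
  assumes f: "sol f f1 f2"
  shows "continuous_on {x n<..x (Suc n)} f1"
proof (rule continuous_on_eq)
  have i: "f2 integrable_on {x n..x (Suc n)}"
    by (rule absint_imp_integrable[OF absint_subinterval[OF solD(1)[OF f, of "x (Suc n)"]]]) auto
  show "continuous_on {x n<..x (Suc n)} (\<lambda>t. right_deriv f f1 n + integral {x n..t} f2)"
    by (intro continuous_intros continuous_on_subset[OF indefinite_integral_continuous_1[OF i]]) auto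
  show "right_deriv f f1 n + integral {x n..t} f2 = f1 t" if "t \<in> {x n<..x (Suc n)}" for t
    using sol_deriv_on_piece[OF f, of n t] that by simp
qed

lemma sol_deriv_right:
  assumes f: "sol f f1 f2"
  shows "(f1 \<longlongrightarrow> right_deriv f f1 n) (at_right (x n))"
proof -
  let ?g = "\<lambda>t. right_deriv f f1 n + integral {x n..t} f2"
  have i: "f2 integrable_on {x n..x (Suc n)}"
    by (rule absint_imp_integrable[OF absint_subinterval[OF solD(1)[OF f, of "x (Suc n)"]]]) auto
  have "continuous_on {x n..x (Suc n)} ?g"
    by (intro continuous_intros indefinite_integral_continuous_1[OF i])
  then have "(?g \<longlongrightarrow> ?g (x n)) (at (x n) within {x n..x (Suc n)})"
    unfolding continuous_on by (rule bspec) simp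
  moreover have "at (x n) within {x n..x (Suc n)} = at_right (x n)"
    by (rule at_within_Icc_at_right) simp
  moreover have "eventually (\<lambda>t. ?g t = f1 t) (at_right (x n))"
    using sol_deriv_on_piece[OF f, of n] by (auto simp: eventually_at_right[OF x_less[of n "Suc n", THEN iffD2, OF lessI]] intro!: exI[of _ "x (Suc n)"])
  ultimately show ?thesis by (simp add: tendsto_cong)
qed

lemma sol_deriv_left:
  assumes f: "sol f f1 f2"
  shows "(f1 \<longlongrightarrow> f1 (x (Suc n))) (at_left (x (Suc n)))"
proof -
  have "(f1 \<longlongrightarrow> f1 (x (Suc n))) (at (x (Suc n)) within {x n<..x (Suc n)})"
    using sol_deriv_continuous[OF f, of n] by (auto simp: continuous_on)
  moreover have "at (x (Suc n)) within {x n<..x (Suc n)} = at_left (x (Suc n))"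
    by (rule at_within_nhd[of _ "{x n<..}"]) auto
  ultimately show ?thesis by simp
qed

lemma sol_tendsto:
  assumes f: "sol f f1 f2"
  shows "(f \<longlongrightarrow> f (x n)) (at_right (x n))" "n \<noteq> 0 \<Longrightarrow> (f \<longlongrightarrow> f (x n)) (at_left (x n))"
proof -
  have "(f \<longlongrightarrow> f (x n)) (at (x n) within {0..})"
    using solD(5)[OF f] by (auto simp: continuous_on)
  then show "(f \<longlongrightarrow> f (x n)) (at_right (x n))"
    by (rule tendsto_within_subset) (use x_ge0[of n] in \<open>auto simp del: x_ge0\<close>)
  show "(f \<longlongrightarrow> f (x n)) (at_left (x n))" if "n \<noteq> 0"
  proof -
    have "(f \<longlongrightarrow> f (x n)) (at (x n) within {0<..<x n})"
      by (rule tendsto_within_subset[OF \<open>(f \<longlongrightarrow> f (x n)) (at (x n) within {0..})\<close>]) auto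
    moreover have "at (x n) within {0<..<x n} = at_left (x n)"
      by (rule at_within_nhd[of _ "{0<..}"]) (use that in auto)
    ultimately show ?thesis by simp
  qed
qed

lemma sol_continuous_U:
  assumes f: "sol f f1 f2"
  shows "continuous_on U f" "continuous_on U f1"
proof -
  show "continuous_on U f" by (rule continuous_on_subset[OF solD(5)[OF f]]) auto
  show "continuous_on U f1"
    unfolding U_eq
  proof (rule continuous_on_open_UN)
    show "continuous_on {x n<..<x (Suc n)} f1" for n
      by (rule continuous_on_subset[OF sol_deriv_continuous[OF f]]) auto
  qed auto
qed

lemma sol_deriv_bounded:
  assumes f: "sol f f1 f2"
  shows "bounded (f1 ` {0..T})"
proof -
  have "bounded ((\<lambda>t. integral {0..t} f2) ` {0..T})"
    by (intro compact_imp_bounded compact_continuous_image absint_primitive solD(1)[OF f]) auto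
  then obtain B where B: "\<And>t. t \<in> {0..T} \<Longrightarrow> cmod (integral {0..t} f2) \<le> B"
    unfolding bounded_iff by blast
  have "cmod (f1 t) \<le> (\<Sum>n\<in>nodes_below T. cmod (of_real (\<alpha> n) * f (x n))) + B" if t: "t \<in> {0..T}" for t
  proof -
    have "cmod (jumps f t) \<le> (\<Sum>n\<in>nodes_below t. cmod (of_real (\<alpha> n) * f (x n)))"
      unfolding jumps_def by (rule norm_sum)
    also have "\<dots> \<le> (\<Sum>n\<in>nodes_below T. cmod (of_real (\<alpha> n) * f (x n)))"
      using t by (intro sum_mono2 nodes_below_mono) auto
    finally show ?thesis
      using solD(2)[OF f, of t] B[OF t] t norm_triangle_ineq[of "jumps f t" "integral {0..t} f2"] by auto
  qed
  then show ?thesis unfolding bounded_iff by blast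
qed

lemma sol_sq_integrable_bounded_support:
  assumes f: "sol f f1 f2" and z: "\<And>t. t \<ge> T \<Longrightarrow> f t = 0" "\<And>t. t \<ge> T \<Longrightarrow> f1 t = 0"
  shows "f sq_integrable_on {0<..}" "f1 sq_integrable_on {0<..}"
proof -
  show "f1 sq_integrable_on {0<..}"
    by (rule sq_integrable_on_bounded_support[OF solD(4)[OF f] sol_deriv_bounded[OF f], of T]) (use z in auto)
  show "f sq_integrable_on {0<..}"
  proof (rule sq_integrable_on_bounded_support)
    show "f absolutely_integrable_on {0..T}"
      by (rule absolutely_integrable_continuous_real[OF sol_continuous[OF f]])
    show "bounded (f ` {0..T})"
      by (intro compact_imp_bounded compact_continuous_image sol_continuous[OF f]) auto
  qed (use z in auto)
qed

lemma test_functionE: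
  assumes \<phi>: "test_function U \<phi>"
  obtains T where "T \<ge> 0" "\<And>t. t \<ge> T \<Longrightarrow> \<phi> t = 0" "\<And>t. t \<ge> T \<Longrightarrow> deriv \<phi> t = 0" "\<And>n. \<phi> (x n) = 0"
    "\<And>u. u \<ge> 0 \<Longrightarrow> complex_of_real (\<phi> u) = integral {0..u} (\<lambda>u. of_real (deriv \<phi> u))"
    "\<And>a b. continuous_on {a..b} (\<lambda>t. complex_of_real (\<phi> t))" 
    "\<And>a b. continuous_on {a..b} (\<lambda>t. complex_of_real (deriv \<phi> t))"
proof -
  let ?S = "closure {u. \<phi> u \<noteq> 0}"
  have S: "compact ?S" "?S \<subseteq> U" and dphi: "continuous_on UNIV (deriv \<phi>)" "\<And>u. \<phi> differentiable (at u)"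
    using \<phi> by (auto simp: test_function_def)
  have der: "(\<phi> has_real_derivative deriv \<phi> u) (at u)" for u
    using dphi(2)[of u] by (simp add: DERIV_deriv_iff_real_differentiable)
  obtain B where B: "\<And>u. u \<in> ?S \<Longrightarrow> \<bar>u\<bar> \<le> B"
    using compact_imp_bounded[OF S(1)] unfolding bounded_iff real_norm_def by blast
  define T where "T = max B 0 + 1"
  have z: "\<phi> u = 0" if "u > max B 0" for u
  proof (rule ccontr)
    assume "\<phi> u \<noteq> 0"
    then have "u \<in> ?S" using closure_subset[of "{u. \<phi> u \<noteq> 0}"] by auto
    then show False using B[of u] that by auto
  qed
  have "deriv \<phi> t = 0" if "t \<ge> T" for t
  proof -
    have "((\<lambda>_. 0) has_real_derivative 0) (at t)" by simp
    moreover have "eventually (\<lambda>v. v \<in> {max B 0<..}) (nhds t)"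
      using that by (intro eventually_nhds_in_open) (auto simp: T_def)
    then have "eventually (\<lambda>v. 0 = \<phi> v) (nhds t)"
      by eventually_elim (use z in auto)
    ultimately have "(\<phi> has_real_derivative 0) (at t)"
      using DERIV_cong_ev[OF refl _ refl, of "\<lambda>_. 0" \<phi> t 0] by simp
    then show ?thesis by (rule DERIV_imp_deriv)
  qed
  moreover have phix: "\<phi> (x n) = 0" for n
  proof (rule ccontr)
    assume "\<phi> (x n) \<noteq> 0"
    then have "x n \<in> ?S" using closure_subset[of "{u. \<phi> u \<noteq> 0}"] by auto
    then show False using S(2) by auto
  qed
  moreover have "complex_of_real (\<phi> u) = integral {0..u} (\<lambda>u. of_real (deriv \<phi> u))" if "0 \<le> u" for u
  proof -
    have "((\<lambda>u. complex_of_real (\<phi> u)) has_vector_derivative of_real (deriv \<phi> v)) (at v within {0..u})" for v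
      using der[of v] by (intro has_vector_derivative_of_real)
        (auto intro: has_vector_derivative_at_within simp: has_real_derivative_iff_has_vector_derivative)
    then have "((\<lambda>u. complex_of_real (deriv \<phi> u)) has_integral (of_real (\<phi> u) - of_real (\<phi> 0))) {0..u}"
      using that by (intro fundamental_theorem_of_calculus) auto
    then show ?thesis using phix[of 0] by (simp add: integral_unique)
  qed
  moreover have "continuous_on {a..b} (\<lambda>t. complex_of_real (\<phi> t))" for a b
    by (intro continuous_intros continuous_at_imp_continuous_on ballI DERIV_isCont[OF der])
  moreover have "continuous_on {a..b} (\<lambda>t. complex_of_real (deriv \<phi> t))" for a b
    by (intro continuous_intros continuous_on_subset[OF dphi(1)]) auto
  moreover have "T \<ge> 0" "\<And>t. t \<ge> T \<Longrightarrow> \<phi> t = 0" by (auto simp: T_def intro!: z)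
  ultimately show thesis by (intro that[of T])
qed

text \<open>
  A test function vanishes near the nodes, so the sum over the nodes in \<open>green_test\<close>
  disappears.
\<close>

lemma sol_weak_derivative:
  assumes f: "sol f f1 f2"
  shows "weak_derivative U f f1" "weak_derivative U f1 f2"
proof -
  have "(LINT t|lebesgue_on U. deriv \<phi> t *\<^sub>R f t) = - (LINT t|lebesgue_on U. \<phi> t *\<^sub>R f1 t) \<and>
      (LINT t|lebesgue_on U. deriv \<phi> t *\<^sub>R f1 t) = - (LINT t|lebesgue_on U. \<phi> t *\<^sub>R f2 t)"
    if phi: "test_function U \<phi>" for \<phi>
  proof -
    from phi obtain T where T: "T \<ge> 0" "\<And>t. t \<ge> T \<Longrightarrow> \<phi> t = 0" "\<And>t. t \<ge> T \<Longrightarrow> deriv \<phi> t = 0" "\<And>n. \<phi> (x n) = 0"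
      and eq0: "\<And>u. u \<ge> 0 \<Longrightarrow> complex_of_real (\<phi> u) = integral {0..u} (\<lambda>u. of_real (deriv \<phi> u))"
      and c: "\<And>a b. continuous_on {a..b} (\<lambda>t. complex_of_real (\<phi> t))" 
        "\<And>a b. continuous_on {a..b} (\<lambda>t. complex_of_real (deriv \<phi> t))"
      by (rule test_functionE) (rule that, assumption+)
    have eq: "complex_of_real (\<phi> u) = of_real (\<phi> 0) + integral {0..u} (\<lambda>u. of_real (deriv \<phi> u))" if "u \<ge> 0" for u
      using eq0[OF that] T(4)[of 0] by simp
    have da: "(\<lambda>u. complex_of_real (deriv \<phi> u)) absolutely_integrable_on {0..T}"
      by (rule absolutely_integrable_continuous_real[OF c(2)])
    have a: "(\<lambda>t. f1 t * of_real (\<phi> t)) absolutely_integrable_on {0..T}"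
       "(\<lambda>t. f2 t * of_real (\<phi> t)) absolutely_integrable_on {0..T}"
       "(\<lambda>t. f1 t * of_real (deriv \<phi> t)) absolutely_integrable_on {0..T}"
       "(\<lambda>t. f t * of_real (deriv \<phi> t)) absolutely_integrable_on {0..T}"
      by (intro absint_mult_continuous c solD(1,4)[OF f]
         absolutely_integrable_continuous_real[OF sol_continuous[OF f]])+
    have L: "(LINT t|lebesgue_on U. deriv \<phi> t *\<^sub>R f t) = integral {0..T} (\<lambda>t. f t * of_real (deriv \<phi> t))"
      "(LINT t|lebesgue_on U. \<phi> t *\<^sub>R f1 t) = integral {0..T} (\<lambda>t. f1 t * of_real (\<phi> t))"
      "(LINT t|lebesgue_on U. deriv \<phi> t *\<^sub>R f1 t) = integral {0..T} (\<lambda>t. f1 t * of_real (deriv \<phi> t))"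
      "(LINT t|lebesgue_on U. \<phi> t *\<^sub>R f2 t) = integral {0..T} (\<lambda>t. f2 t * of_real (\<phi> t))"
      unfolding scaleR_conv_of_real mult.commute[of "of_real _"]
      by (rule LINT_U; (rule a)?; use T in simp)+
    have "integral {0..T} (\<lambda>t. f1 t * of_real (\<phi> t)) + integral {0..T} (\<lambda>t. f t * of_real (deriv \<phi> t))
       = f T * of_real (\<phi> T) - f 0 * of_real (\<phi> 0)"
      by (rule integration_by_parts_AC[OF T(1) solD(4)[OF f] da]) (rule solD(3)[OF f] eq; assumption)+
    moreover have "integral {0..T} (\<lambda>t. f2 t * of_real (\<phi> t)) + integral {0..T} (\<lambda>t. f1 t * of_real (deriv \<phi> t))
      = f1 T * of_real (\<phi> T) - (\<Sum>n\<in>nodes_below T. of_real (\<alpha> n) * f (x n) * of_real (\<phi> (x n)))"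
      by (rule green_test(1)[OF f T(1) da]) (rule eq)
    ultimately show ?thesis
      using T(2)[of T] T(4) T(4)[of 0] unfolding L by (simp add: eq_neg_iff_add_eq_0 add.commute)
  qed
  then show "weak_derivative U f f1" "weak_derivative U f1 f2" by (auto simp: weak_derivative_def)
qed

lemma pre_hamiltonianI:
  assumes f: "sol f f1 f2" and f2: "f2 sq_integrable_on {0<..}" and
    z: "\<And>t. t \<ge> T \<Longrightarrow> f t = 0" "\<And>t. t \<ge> T \<Longrightarrow> f1 t = 0"
  shows "(abs_L2 f, abs_L2 (\<lambda>t. - f2 t)) \<in> pre_hamiltonian x \<alpha>"
proof -
  have W: "W22 U f f1 f2"
    unfolding W22_def sq_integrable_U
    using sol_sq_integrable_bounded_support[OF f z] f2 sol_weak_derivative[OF f] by simp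
  have "{t \<in> U. f t \<noteq> 0} \<subseteq> {0..T}" using z by (force simp: not_le[symmetric])
  then have "bounded {t \<in> U. f t \<noteq> 0}" by (rule bounded_subset[rotated]) simp
  then have cpt: "compact (closure {t \<in> U. f t \<noteq> 0})" by (simp add: compact_closure)
  have "(f1 \<longlongrightarrow> 0) (at_right 0)"
    using sol_deriv_right[OF f, of 0] solD(6)[OF f] by (simp add: right_deriv_def)
  moreover have "\<exists>c l r.
           (f \<longlongrightarrow> c) (at_left (x n)) \<and> (f \<longlongrightarrow> c) (at_right (x n)) \<and>
           (f1 \<longlongrightarrow> l) (at_left (x n)) \<and> (f1 \<longlongrightarrow> r) (at_right (x n)) \<and>
           r - l = of_real (\<alpha> n) * c" if "n \<ge> 1" for n
  proof -
    from that have "n \<noteq> 0" by simp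
    then obtain m where m: "n = Suc m" using not0_implies_Suc by blast
    show ?thesis
      using sol_tendsto[OF f, of n] sol_deriv_left[OF f, of m] sol_deriv_right[OF f, of n] m
      by (intro exI[of _ "f (x n)"] exI[of _ "f1 (x n)"] exI[of _ "right_deriv f f1 n"])
         (auto simp: right_deriv_def)
  qed
  ultimately show ?thesis
    unfolding pre_hamiltonian_def Let_def using W sol_continuous_U[OF f] cpt by blast
qed

end

section \<open>Elements of the pre-Hamiltonian are solutions\<close>

lemma AE_half_lineI:
  fixes P :: "real \<Rightarrow> bool"
  assumes "negligible N" "\<And>t. t > 0 \<Longrightarrow> t \<notin> N \<Longrightarrow> P t"
  shows "AE t in lebesgue_on {0<..}. P t"
proof -
  have "AE t in lebesgue. t \<notin> N"
    using assms(1) by (intro AE_not_in) (simp add: negligible_iff_null_sets)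
  then have "AE t in lebesgue. t \<in> {0<..} \<longrightarrow> P t"
    by eventually_elim (use assms(2) in auto)
  then show ?thesis by (subst AE_restrict_space_iff) auto
qed

lemma AE_half_lineE:
  fixes P :: "real \<Rightarrow> bool"
  assumes "AE t in lebesgue_on {0<..}. P t"
  obtains N where "negligible N" "\<And>t. t > 0 \<Longrightarrow> t \<notin> N \<Longrightarrow> P t"
proof -
  have "AE t in lebesgue. t \<in> {0<..} \<longrightarrow> P t"
    using assms by (subst (asm) AE_restrict_space_iff) auto
  then obtain N where N: "N \<in> null_sets lebesgue" "{t \<in> space lebesgue. \<not> (t \<in> {0<..} \<longrightarrow> P t)} \<subseteq> N"
    by (auto simp: eventually_ae_filter)
  show thesis
    by (rule that[of N]) (use N in \<open>auto simp: negligible_iff_null_sets\<close>)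
qed

lemma sq_integrable_on_cong:
  assumes "\<And>t. t \<in> S \<Longrightarrow> f t = g t" "f sq_integrable_on S"
  shows "g sq_integrable_on S"
proof -
  have "f \<in> borel_measurable (lebesgue_on S) \<longleftrightarrow> g \<in> borel_measurable (lebesgue_on S)"
    by (rule measurable_cong) (use assms(1) in auto)
  moreover have "integrable (lebesgue_on S) (\<lambda>x. (cmod (f x))\<^sup>2) \<longleftrightarrow> integrable (lebesgue_on S) (\<lambda>x. (cmod (g x))\<^sup>2)"
    by (rule Bochner_Integration.integrable_cong) (use assms(1) in auto)
  ultimately show ?thesis using assms(2) by (simp add: sq_integrable_on_def)
qed

lemma sq_integrable_spike:
  assumes f: "f sq_integrable_on {0<..}" and N: "negligible N" and g: "\<And>t. t > 0 \<Longrightarrow> t \<notin> N \<Longrightarrow> f t = g t"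
  shows "g sq_integrable_on {0<..}" "abs_L2 f = abs_L2 g"
proof -
  have "f sq_integrable_on ({0<..} - N)"
    using f sq_integrable_on_minus_negligible[OF N, of "{0<..}"] by simp
  then have "g sq_integrable_on ({0<..} - N)"
    by (rule sq_integrable_on_cong[rotated]) (use g in auto)
  then show g': "g sq_integrable_on {0<..}"
    using sq_integrable_on_minus_negligible[OF N, of "{0<..}"] by simp
  show "abs_L2 f = abs_L2 g"
    unfolding abs_L2_eq_iff[OF f g'] using N g by (rule AE_half_lineI)
qed

lemma sq_integrable_cnj: "f sq_integrable_on S \<Longrightarrow> (\<lambda>t. cnj (f t)) sq_integrable_on S"
  using borel_measurable_mult_cnj[of "\<lambda>_. 1" "lebesgue_on S" f] by (simp add: sq_integrable_on_def)

lemma sq_integrable_truncate: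
  assumes f: "f sq_integrable_on {0<..}"
  shows "(\<lambda>t. if t \<in> {0..T} then f t else 0) sq_integrable_on {0<..}"
  unfolding sq_integrable_on_def
proof
  have m: "f \<in> borel_measurable (lebesgue_on {0<..})" using f by (simp add: sq_integrable_on_def)
  show m': "(\<lambda>t. if t \<in> {0..T} then f t else 0) \<in> borel_measurable (lebesgue_on {0<..})"
  proof (rule measurable_If_set[OF m measurable_const])
    have "{0..T} \<inter> {0<..} \<in> sets lebesgue" by (intro sets.Int) auto
    then show "{0..T} \<inter> space (lebesgue_on {0<..}) \<in> sets (lebesgue_on {0<..})"
      by (simp add: sets_restrict_space_iff)
  qed simp
  show "integrable (lebesgue_on {0<..}) (\<lambda>t. (cmod (if t \<in> {0..T} then f t else 0))\<^sup>2)"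
  proof (rule Bochner_Integration.integrable_bound)
    show "integrable (lebesgue_on {0<..}) (\<lambda>t. (cmod (f t))\<^sup>2)" using f by (simp add: sq_integrable_on_def)
    show "(\<lambda>t. (cmod (if t \<in> {0..T} then f t else 0))\<^sup>2) \<in> borel_measurable (lebesgue_on {0<..})"
      using m' by measurable
  qed auto
qed

lemma zero_if_square_integral_zero:
  fixes v :: "real \<Rightarrow> complex"
  assumes v: "v sq_integrable_on {0<..}" and 0: "integral {0..T} (\<lambda>t. (cmod (v t))\<^sup>2) = 0"
  obtains N where "negligible N" "\<And>t. t \<in> {0..T} \<Longrightarrow> t \<notin> N \<Longrightarrow> v t = 0"
proof -
  have "(\<lambda>t. (cmod (v t))\<^sup>2) absolutely_integrable_on {0..T}"
    by (rule nonnegative_absolutely_integrable_1[OF sq_integrable_imp_absint(2)[OF v]]) auto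
  then have i: "integrable (lebesgue_on {0..T}) (\<lambda>t. (cmod (v t))\<^sup>2)"
    by (rule absolutely_integrable_imp_integrable) simp
  then have "(LINT t|lebesgue_on {0..T}. (cmod (v t))\<^sup>2) = 0"
    using lebesgue_integral_eq_integral[OF i] 0 by simp
  then have "AE t in lebesgue_on {0..T}. (cmod (v t))\<^sup>2 = 0"
    using integral_nonneg_eq_0_iff_AE[OF i] by simp
  then have "AE t in lebesgue. t \<in> {0..T} \<longrightarrow> v t = 0"
    by (subst (asm) AE_restrict_space_iff) auto
  then obtain N where N: "N \<in> null_sets lebesgue" "{t \<in> space lebesgue. \<not> (t \<in> {0..T} \<longrightarrow> v t = 0)} \<subseteq> N"
    by (auto simp: eventually_ae_filter)
  show thesis
    by (rule that[of N]) (use N in \<open>auto simp: negligible_iff_null_sets\<close>)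
qed

lemma not_negligible_interval: "a < b \<Longrightarrow> \<not> negligible {a<..<b::real}"
  using open_not_negligible[of "{a<..<b}"] by auto

context nodes
begin

text \<open>
  The derivative is left-continuous, so it is determined by the values of \<open>f\<close> to the left
  of the given point.
\<close>

lemma sol_deriv_zero_if_zero_beyond:
  assumes f: "sol f f1 f2" and T: "0 \<le> T" and z: "\<And>t. t \<ge> T \<Longrightarrow> f t = 0" and t: "t > T"
  shows "f1 t = 0"
proof -
  obtain n where n: "x n < t" "t \<le> x (Suc n)" using locate[of t] T t by auto
  define a where "a = (max (x n) T + t) / 2"
  have a: "x n < a" "T < a" "a < t" using n t by (auto simp: a_def max_def field_simps)
  have "continuous_on {a..t} f1"
    by (rule continuous_on_subset[OF sol_deriv_continuous[OF f, of n]]) (use a n in auto)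
  then have "((\<lambda>u. integral {a..u} f1) has_vector_derivative f1 t) (at t within {a..t})"
    using a by (intro integral_has_vector_derivative) auto
  moreover have "integral {a..u} f1 = 0" if "u \<in> {a..t}" for u
    using sol_integral(1)[OF f, of a u] that a T z[of a] z[of u] by auto
  ultimately have "((\<lambda>u. 0) has_vector_derivative f1 t) (at t within {a..t})"
    using a by (rule_tac has_vector_derivative_transform[of t "{a..t}" _ "\<lambda>u. integral {a..u} f1"]) auto
  moreover have "((\<lambda>u. 0) has_vector_derivative 0) (at t within {a..t})" by simp
  moreover have "at t within {a..t} \<noteq> bot" using a by (simp add: trivial_limit_within)
  ultimately show ?thesis by (metis vector_derivative_unique_within)
qed

lemma weak_derivative_on_piece:
  assumes wd: "weak_derivative U f g" and f: "continuous_on U f" and g: "\<And>T. g absolutely_integrable_on {0..T}"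
  obtains c where "\<And>u. u \<in> {x n<..<x (Suc n)} \<Longrightarrow> f u - integral {0..u} g = c"
proof -
  define m where "m = (x n + x (Suc n)) / 2"
  have m: "x n < m" "m < x (Suc n)" unfolding m_def using x_less[of n "Suc n"] by (auto simp del: x_less)
  have "f u - integral {0..u} g = f m - integral {0..m} g" if u: "u \<in> {x n<..<x (Suc n)}" for u
  proof -
    define s where "s = (x n + min u m) / 2"
    define t where "t = (x (Suc n) + max u m) / 2"
    have st: "x n < s" "s < min u m" "max u m < t" "t < x (Suc n)"
      using u m by (auto simp: s_def t_def)
    then have "{s..t} \<subseteq> {x n<..<x (Suc n)}" by auto
    then have "{s..t} \<subseteq> U" using piece_subset_U[of n] by blast
    moreover have "s < t" using st by auto
    ultimately obtain c where "\<And>u. u \<in> {s<..<t} \<Longrightarrow> f u - integral {0..u} g = c"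
      using weak_derivative_primitive[OF _ open_U negligible_compl_U wd f g] by (metis Diff_subset)
    then show ?thesis using st by auto
  qed
  then show thesis by (rule that)
qed

text \<open>
  Between the nodes, \<open>f\<close> and \<open>f1\<close> differ from the primitives of \<open>f1\<close> and \<open>f2\<close> by constants.
  The one-sided limits at the nodes say that the constant for \<open>f\<close> is the same on all gaps and that
  the constant for \<open>f1\<close> grows by \<open>\<alpha>\<^sub>n f(x\<^sub>n)\<close> at each node, starting from \<open>0\<close>. Redefining \<open>f\<close> at the
  nodes gives the solution.
\<close>

lemma pre_hamiltonianE:
  assumes "(F, K) \<in> pre_hamiltonian x \<alpha>"
  obtains f f1 f2 T where "sol f f1 f2" "f sq_integrable_on {0<..}" "f2 sq_integrable_on {0<..}"
    "F = abs_L2 f" "K = abs_L2 (\<lambda>t. - f2 t)" "T \<ge> 0" "\<And>t. t > T \<Longrightarrow> f t = 0" "\<And>t. t > T \<Longrightarrow> f1 t = 0"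
proof -
  obtain f f1 f2 where FK: "F = abs_L2 f" "K = abs_L2 (\<lambda>t. - f2 t)" and
    W: "W22 U f f1 f2" and c: "continuous_on U f" "continuous_on U f1" and
    cpt: "compact (closure {t \<in> U. f t \<noteq> 0})" and r0: "(f1 \<longlongrightarrow> 0) (at_right 0)" and
    J: "\<And>n. n \<ge> 1 \<Longrightarrow> \<exists>c l r. (f \<longlongrightarrow> c) (at_left (x n)) \<and> (f \<longlongrightarrow> c) (at_right (x n)) \<and>
           (f1 \<longlongrightarrow> l) (at_left (x n)) \<and> (f1 \<longlongrightarrow> r) (at_right (x n)) \<and> r - l = of_real (\<alpha> n) * c"
    using assms unfolding pre_hamiltonian_def Let_def by blast
  have sq: "f sq_integrable_on {0<..}" "f1 sq_integrable_on {0<..}" "f2 sq_integrable_on {0<..}"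
    and wd: "weak_derivative U f f1" "weak_derivative U f1 f2"
    using W by (auto simp: W22_def sq_integrable_U)
  have a1: "f1 absolutely_integrable_on {0..T}" and a2: "f2 absolutely_integrable_on {0..T}" for T
    using sq_integrable_imp_absint(1)[OF sq(2)] sq_integrable_imp_absint(1)[OF sq(3)] by auto
  \<comment> \<open>\<open>c0 n\<close> and \<open>c1 n\<close> are the constants of integration on the \<open>n\<close>-th gap.\<close>
  define G where "G = (\<lambda>u. integral {0..u} f1)"
  define G1 where "G1 = (\<lambda>u. integral {0..u} f2)"
  have "\<exists>c. \<forall>u. u \<in> {x n<..<x (Suc n)} \<longrightarrow> f u - G u = c" for n
    using weak_derivative_on_piece[OF wd(1) c(1) a1, of n] unfolding G_def by metis
  then obtain c0 where c0: "\<And>n u. u \<in> {x n<..<x (Suc n)} \<Longrightarrow> f u - G u = c0 n" by metis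
  have "\<exists>c. \<forall>u. u \<in> {x n<..<x (Suc n)} \<longrightarrow> f1 u - G1 u = c" for n
    using weak_derivative_on_piece[OF wd(2) c(2) a2, of n] unfolding G1_def by metis
  then obtain c1 where c1: "\<And>n u. u \<in> {x n<..<x (Suc n)} \<Longrightarrow> f1 u - G1 u = c1 n" by metis
  have lims: "(h \<longlongrightarrow> h (x n)) (at_right (x n))" "(h \<longlongrightarrow> h (x (Suc n))) (at_left (x (Suc n)))"
    if "h = G \<or> h = G1" for h n
  proof -
    have hc: "continuous_on {0..x (Suc n)} h"
      using that absint_primitive(1)[OF a1] absint_primitive(1)[OF a2] by (auto simp: G_def G1_def)
    then have "continuous_on {x n..x (Suc n)} h" by (rule continuous_on_subset) auto
    then have "(h \<longlongrightarrow> h (x n)) (at (x n) within {x n..x (Suc n)})"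
      "(h \<longlongrightarrow> h (x (Suc n))) (at (x (Suc n)) within {x n..x (Suc n)})"
      unfolding continuous_on by (rule bspec; simp)+
    then show "(h \<longlongrightarrow> h (x n)) (at_right (x n))" "(h \<longlongrightarrow> h (x (Suc n))) (at_left (x (Suc n)))"
      by (simp_all add: at_within_Icc_at_right at_within_Icc_at_left)
  qed
  have ev: "eventually (\<lambda>u. u \<in> {x n<..<x (Suc n)}) (at_right (x n))"
    "eventually (\<lambda>u. u \<in> {x n<..<x (Suc n)}) (at_left (x (Suc n)))" for n
    using eventually_at_right_real[OF x_less[of n "Suc n", THEN iffD2, OF lessI]]
      eventually_at_left_real[OF x_less[of n "Suc n", THEN iffD2, OF lessI]] by auto
  have const: "a = b" if h: "h = G \<or> h = G1" and l: "(k \<longlongrightarrow> c) (at_right (x n))" 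
     and e: "\<And>u. u \<in> {x n<..<x (Suc n)} \<Longrightarrow> k u - h u = a" and b: "b = c - h (x n)"
    for h k :: "real \<Rightarrow> complex" and n a b c
  proof -
    have "((\<lambda>u. k u - h u) \<longlongrightarrow> b) (at_right (x n))"
      unfolding b by (intro tendsto_diff l lims h)
    moreover have "((\<lambda>u. k u - h u) \<longlongrightarrow> a) (at_right (x n))"
      by (rule tendsto_eventually) (use ev(1)[of n] e in \<open>auto elim: eventually_mono\<close>)
    ultimately show ?thesis by (metis tendsto_unique trivial_limit_at_right_real)
  qed
  have const': "a = b" if h: "h = G \<or> h = G1" and l: "(k \<longlongrightarrow> c) (at_left (x (Suc n)))" 
     and e: "\<And>u. u \<in> {x n<..<x (Suc n)} \<Longrightarrow> k u - h u = a" and b: "b = c - h (x (Suc n))"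
    for h k :: "real \<Rightarrow> complex" and n a b c
  proof -
    have "((\<lambda>u. k u - h u) \<longlongrightarrow> b) (at_left (x (Suc n)))"
      unfolding b by (intro tendsto_diff l lims h)
    moreover have "((\<lambda>u. k u - h u) \<longlongrightarrow> a) (at_left (x (Suc n)))"
      by (rule tendsto_eventually) (use ev(2)[of n] e in \<open>auto elim: eventually_mono\<close>)
    ultimately show ?thesis by (metis tendsto_unique trivial_limit_at_left_real)
  qed
  define v where "v = c0 0"
  define g where "g = (\<lambda>t. v + G t)"
  have step: "c0 (Suc n) = c0 n \<and> c1 (Suc n) = c1 n + of_real (\<alpha> (Suc n)) * (c0 n + G (x (Suc n)))" for n
  proof -
    obtain d l r where J': "(f \<longlongrightarrow> d) (at_left (x (Suc n)))" "(f \<longlongrightarrow> d) (at_right (x (Suc n)))"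
           "(f1 \<longlongrightarrow> l) (at_left (x (Suc n)))" "(f1 \<longlongrightarrow> r) (at_right (x (Suc n)))" 
           "r - l = of_real (\<alpha> (Suc n)) * d"
      using J[of "Suc n"] by auto
    have "c0 (Suc n) = d - G (x (Suc n))" by (rule const[OF _ J'(2) c0]) auto
    moreover have e: "c0 n = d - G (x (Suc n))" by (rule const'[OF _ J'(1) c0]) auto
    moreover have A: "c1 (Suc n) = r - G1 (x (Suc n))" by (rule const[OF _ J'(4) c1]) auto
    have B: "c1 n = l - G1 (x (Suc n))" by (rule const'[OF _ J'(3) c1]) auto
    have "of_real (\<alpha> (Suc n)) * (c0 n + G (x (Suc n))) = r - l"
      unfolding e J'(5) by simp
    then have "c1 (Suc n) = c1 n + of_real (\<alpha> (Suc n)) * (c0 n + G (x (Suc n)))"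
      unfolding A B by simp
    ultimately show ?thesis by simp
  qed
  have c0v: "c0 n = v" for n
    by (induction n) (use step in \<open>auto simp: v_def\<close>)
  have G0: "G 0 = 0" "G1 0 = 0" by (simp_all add: G_def G1_def)
  have c1v: "c1 n = (\<Sum>m\<in>{1..n}. of_real (\<alpha> m) * g (x m))" for n
  proof (induction n)
    case 0
    have "c1 0 = 0 - G1 (x 0)" by (rule const[OF _ _ c1]) (use r0 in auto)
    then show ?case using G0 by simp
  next
    case (Suc n)
    then show ?case using step[of n] c0v by (simp add: g_def)
  qed
  define g1 where "g1 = (\<lambda>t. jumps g t + integral {0..t} f2)"
  have g1_eq: "g1 t = f1 t" and g_eq: "g t = f t" if t: "t \<in> U" for t
  proof -
    obtain n where n: "t \<in> {x n<..<x (Suc n)}" using t unfolding U_eq by blast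
    then have "nodes_below t = {1..n}" by (intro nodes_below_piece) auto
    then have "jumps g t = c1 n" by (simp add: jumps_def c1v)
    then show "g1 t = f1 t" using c1[OF n] by (simp add: g1_def G1_def algebra_simps)
    show "g t = f t" using c0[OF n] c0v by (simp add: g_def algebra_simps)
  qed
  have "sol g g1 f2"
  proof (rule solI[OF a2])
    show "g t = g 0 + integral {0..t} g1" if "t \<ge> 0" for t
    proof -
      have "integral {0..t} g1 = integral {0..t} f1"
      proof (rule integral_spike[of "insert 0 (range x)"])
        show "negligible (insert 0 (range x))" using negligible_nodes by simp
      qed (use g1_eq in auto)
      then show ?thesis using G0 by (simp add: g_def G_def)
    qed
  qed (simp add: g1_def)
  note S = this
  have neg: "negligible (range x)" by (rule negligible_nodes)
  have fg: "f t = g t" if "t > 0" "t \<notin> range x" for t using g_eq[of t] that by simp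
  note sp = sq_integrable_spike[OF sq(1) neg fg]
  obtain B where B: "\<And>u. u \<in> closure {t \<in> U. f t \<noteq> 0} \<Longrightarrow> \<bar>u\<bar> \<le> B"
    using compact_imp_bounded[OF cpt] unfolding bounded_iff real_norm_def by blast
  define T where "T = max B 0"
  have zU: "g t = 0" if "t > T" "t \<in> U" for t
  proof (rule ccontr)
    assume "g t \<noteq> 0"
    then have "t \<in> {t \<in> U. f t \<noteq> 0}" using that g_eq by auto
    then have "t \<in> closure {t \<in> U. f t \<noteq> 0}" using closure_subset[of "{t \<in> U. f t \<noteq> 0}"] by auto
    then show False using B[of t] that by (auto simp: T_def)
  qed
  have z: "g t = 0" if t: "t > T" for t
  proof (cases "t \<in> U")
    case False
    then obtain n where n: "t = x n" using t by (auto simp: T_def)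
    have "(g \<longlongrightarrow> g (x n)) (at_right (x n))" by (rule sol_tendsto[OF S])
    moreover have "eventually (\<lambda>u. g u = 0) (at_right (x n))"
      using ev(1)[of n] by eventually_elim (use zU piece_subset_U[of n] t n in auto)
    then have "(g \<longlongrightarrow> 0) (at_right (x n))" by (rule tendsto_eventually)
    ultimately show ?thesis using n by (metis tendsto_unique trivial_limit_at_right_real)
  qed (use zU t in auto)
  have z1: "g1 t = 0" if "t > T" for t
  proof (rule sol_deriv_zero_if_zero_beyond[OF S, of "(T + t)/2"])
    show "0 \<le> (T + t)/2" using that by (simp add: T_def)
    show "g u = 0" if "(T + t)/2 \<le> u" for u
      by (rule z) (use that \<open>t > T\<close> in \<open>simp add: field_simps\<close>)
    show "(T + t)/2 < t" using that by (simp add: field_simps)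
  qed
  show thesis
    by (rule that[of g g1 f2 T]) (use S sp sq FK z z1 in \<open>auto simp: T_def\<close>)
qed

end

section \<open>The adjoint\<close>

lemma mult_cnj_self: "a * cnj a = complex_of_real ((cmod a)\<^sup>2)"
  by (rule complex_norm_square[symmetric, unfolded of_real_power[symmetric]])

context nodes
begin

text \<open>
  The Green formula for a solution and a solution of bounded support. The second
  derivative of the latter vanishes only almost everywhere far out, so the integrals are
  taken as limits.
\<close>

lemma adjointI:
  assumes g: "sol g g1 g2" and sq: "g sq_integrable_on {0<..}" "g2 sq_integrable_on {0<..}"
  shows "(abs_L2 g, abs_L2 (\<lambda>t. - g2 t)) \<in> adjoint (pre_hamiltonian x \<alpha>)"
proof -
  have "cinner K (abs_L2 g) = cinner F (abs_L2 (\<lambda>t. - g2 t))" if FK: "(F, K) \<in> pre_hamiltonian x \<alpha>" for F K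
  proof -
    obtain f f1 f2 T where f: "sol f f1 f2" "f sq_integrable_on {0<..}" "f2 sq_integrable_on {0<..}"
    "F = abs_L2 f" "K = abs_L2 (\<lambda>t. - f2 t)" "T \<ge> 0" "\<And>t. t > T \<Longrightarrow> f t = 0" "\<And>t. t > T \<Longrightarrow> f1 t = 0"
      by (rule pre_hamiltonianE[OF FK]) (rule that, assumption+)
    have m: "(\<lambda>t. - h t) sq_integrable_on {0<..}" if "h sq_integrable_on {0<..}" for h
      using that by (rule sq_integrable_uminus)
    have i: "integrable (lebesgue_on {0<..}) (\<lambda>t. f2 t * cnj (g t))"
      "integrable (lebesgue_on {0<..}) (\<lambda>t. f t * cnj (g2 t))"
      by (intro sq_integrable_mult_cnj f sq)+
    have l: "(\<lambda>n. integral {0..x n} (\<lambda>t. f2 t * cnj (g t))) \<longlonglongrightarrow> (LINT t|lebesgue_on {0<..}. f2 t * cnj (g t))"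
      "(\<lambda>n. integral {0..x n} (\<lambda>t. f t * cnj (g2 t))) \<longlonglongrightarrow> (LINT t|lebesgue_on {0<..}. f t * cnj (g2 t))"
      by (intro half_line_integral_limit i lim)+
    have "eventually (\<lambda>n. T < x n) sequentially" using lim by (simp add: filterlim_at_top_dense)
    then have "eventually (\<lambda>n. integral {0..x n} (\<lambda>t. f t * cnj (g2 t)) = integral {0..x n} (\<lambda>t. f2 t * cnj (g t))) sequentially"
    proof eventually_elim
      case (elim n)
      then show ?case using green[OF f(1) sol_cnj[OF g] x_ge0, of n] f(7,8) by simp
    qed
    then have "(\<lambda>n. integral {0..x n} (\<lambda>t. f2 t * cnj (g t))) \<longlonglongrightarrow> (LINT t|lebesgue_on {0<..}. f t * cnj (g2 t))"
      using l(2) by (rule Lim_transform_eventually[rotated])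
    then have "(LINT t|lebesgue_on {0<..}. f2 t * cnj (g t)) = (LINT t|lebesgue_on {0<..}. f t * cnj (g2 t))"
      using l(1) by (rule LIMSEQ_unique[rotated])
    then show ?thesis using f(2,3) sq m by (simp add: f(4,5) cinner_abs_L2)
  qed
  then show ?thesis by (auto simp: adjoint_def)
qed

lemma ex_zero_energy_sol:
  obtains \<psi> \<psi>1 where "sol \<psi> \<psi>1 (\<lambda>_. 0)" "\<psi> 0 = 1"
  by (rule sol_exists_0[of "\<lambda>_. 0" 1]) (auto intro: absint_const)

lemma zero_energy_norm_pos:
  assumes \<psi>: "sol \<psi> \<psi>1 (\<lambda>_. 0)" "\<psi> 0 = 1" and T: "T > 0"
  shows "integral {0..T} (\<lambda>t. \<psi> t * cnj (\<psi> t)) \<noteq> 0"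
proof
  assume 0: "integral {0..T} (\<lambda>t. \<psi> t * cnj (\<psi> t)) = 0"
  have c: "continuous_on {0..T} (\<lambda>t. (cmod (\<psi> t))\<^sup>2)"
    by (intro continuous_intros sol_continuous[OF \<psi>(1)])
  have "integral {0..T} (\<lambda>t. \<psi> t * cnj (\<psi> t)) = of_real (integral {0..T} (\<lambda>t. (cmod (\<psi> t))\<^sup>2))"
    unfolding mult_cnj_self
    using integral_linear[OF integrable_continuous_real[OF c] bounded_linear_of_real] by (simp add: o_def)
  then have "((\<lambda>t. (cmod (\<psi> t))\<^sup>2) has_integral 0) (cbox 0 T)"
    using 0 integrable_integral[OF integrable_continuous_real[OF c]] by simp
  then have "(cmod (\<psi> 0))\<^sup>2 = 0"
    using c T by (intro has_integral_0_cbox_imp_0[where f="\<lambda>t. (cmod (\<psi> t))\<^sup>2" and a=0 and b=T]) auto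
  then show False using \<psi>(2) by simp
qed

text \<open>
  The solution of \<open>f'' = k\<close> that starts from \<open>0\<close> at the origin is, by the Green
  formula, at \<open>T\<close> proportional to the zero-energy solution \<open>\<psi>\<close> together with its derivative. Subtracting the right
  multiple of \<open>\<psi>\<close> makes it vanish beyond \<open>T\<close>. For this, \<open>\<psi>\<close> and its derivative must not both
  vanish at \<open>T\<close>: otherwise the Green formula with right-hand side \<open>cnj \<psi>\<close> would give
  \<open>\<integral>|\<psi>|\<^sup>2 = 0\<close>.
\<close>

lemma sol_with_source:
  assumes \<psi>: "sol \<psi> \<psi>1 (\<lambda>_. 0)" "\<psi> 0 = 1" and T: "T > 0"
    and k: "\<And>R. k absolutely_integrable_on {0..R}" "\<And>t. t > T \<Longrightarrow> k t = 0"
    and orth: "integral {0..T} (\<lambda>t. k t * \<psi> t) = 0"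
  obtains f f1 where "sol f f1 k" "\<And>t. t \<ge> T \<Longrightarrow> f t = 0" "\<And>t. t \<ge> T \<Longrightarrow> f1 t = 0"
proof -
  obtain h h1 where h: "sol h h1 k" "h 0 = 0" using sol_exists_0[OF k(1)] by blast
  have W: "h1 T * \<psi> T = h T * \<psi>1 T"
    using green[OF h(1) \<psi>(1), of T] T orth by simp
  have nz: "\<psi> T \<noteq> 0 \<or> \<psi>1 T \<noteq> 0"
  proof (rule ccontr)
    assume "\<not> ?thesis"
    moreover have "(\<lambda>t. cnj (\<psi> t)) absolutely_integrable_on {0..R}" for R
      by (intro absolutely_integrable_continuous_real continuous_intros sol_continuous[OF \<psi>(1)])
    then obtain v v1 where v: "sol v v1 (\<lambda>t. cnj (\<psi> t))" "v 0 = 0" using sol_exists_0 by blast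
    ultimately have "integral {0..T} (\<lambda>t. cnj (\<psi> t) * \<psi> t) = 0"
      using green[OF v(1) \<psi>(1), of T] T by simp
    then show False using zero_energy_norm_pos[OF \<psi> T] by (simp add: mult.commute)
  qed
  obtain e where e: "h T = e * \<psi> T" "h1 T = e * \<psi>1 T"
  proof (cases "\<psi> T = 0")
    case True
    then have "h T = 0" using W nz by simp
    then show ?thesis using that[of "h1 T / \<psi>1 T"] True nz by simp
  next
    case False
    then show ?thesis using that[of "h T / \<psi> T"] W by (simp add: field_simps)
  qed
  have f: "sol (\<lambda>t. h t + (- e) * \<psi> t) (\<lambda>t. h1 t + (- e) * \<psi>1 t) (\<lambda>t. k t + (- e) * 0)"
    by (rule sol_add[OF h(1) sol_mult[OF \<psi>(1)]])
  have "h t + (- e) * \<psi> t = 0" "h1 t + (- e) * \<psi>1 t = 0" if "t \<ge> T" for t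
    using sol_unique[OF f, of T 0 t] T e k(2) that by auto
  with f show thesis by (intro that[of "\<lambda>t. h t + (- e) * \<psi> t" "\<lambda>t. h1 t + (- e) * \<psi>1 t"]) auto
qed

text \<open>
  Regularity for the adjoint. With \<open>y\<close> a solution for the right-hand side prescribed by
  \<open>h\<close>, the function \<open>u = cnj (g - y)\<close> is orthogonal to every second derivative of an element of
  bounded support, hence by the previous lemma to every \<open>k\<close> on \<open>[0, T]\<close> that is orthogonal to
  \<open>\<psi>\<close>. Taking for \<open>k\<close> the conjugate of the component of \<open>u\<close> orthogonal to \<open>\<psi>\<close> shows that
  this component vanishes.
\<close>

lemma adjoint_up_to_zero_energy_sol:
  assumes adj: "(abs_L2 g, abs_L2 h) \<in> adjoint (pre_hamiltonian x \<alpha>)"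
    and g: "g sq_integrable_on {0<..}" and h: "h sq_integrable_on {0<..}"
    and y: "sol y y1 (\<lambda>t. - h t)" and \<psi>: "sol \<psi> \<psi>1 (\<lambda>_. 0)" "\<psi> 0 = 1" and T: "T > 0"
  obtains c N where "negligible N" "\<And>t. 0 < t \<Longrightarrow> t \<le> T \<Longrightarrow> t \<notin> N \<Longrightarrow> cnj (g t - y t) = c * \<psi> t"
proof -
  define D where "D = integral {0..T} (\<lambda>t. \<psi> t * cnj (\<psi> t))"
  have D: "D \<noteq> 0" unfolding D_def by (rule zero_energy_norm_pos[OF \<psi> T])
  define u where "u = (\<lambda>t. cnj (g t - y t))"
  have psic: "continuous_on {0..R} \<psi>" and yc: "continuous_on {0..R} y" for R
    by (rule sol_continuous[OF \<psi>(1)], rule sol_continuous[OF y])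
  have ua: "u absolutely_integrable_on {0..R}" for R
  proof -
    have "(\<lambda>t. cnj (g t)) absolutely_integrable_on {0..R}"
      by (rule sq_integrable_imp_absint(1)[OF sq_integrable_cnj[OF g]]) simp
    moreover have "(\<lambda>t. cnj (y t)) absolutely_integrable_on {0..R}"
      by (intro absolutely_integrable_continuous_real continuous_intros yc)
    ultimately show ?thesis unfolding u_def complex_cnj_diff by (rule set_integral_diff)
  qed
  have up: "(\<lambda>t. u t * cnj (\<psi> t)) absolutely_integrable_on {0..R}" for R
    by (intro absint_mult_continuous ua continuous_intros psic)
  have pp: "(\<lambda>t. \<psi> t * cnj (\<psi> t)) absolutely_integrable_on {0..R}" for R
    by (intro absolutely_integrable_continuous_real continuous_intros psic)
  define c where "c = integral {0..T} (\<lambda>t. u t * cnj (\<psi> t)) / D"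
  define w where "w = (\<lambda>t. if t \<in> {0..T} then u t - c * \<psi> t else 0)"
  define k where "k = (\<lambda>t. cnj (w t))"
  have wsq: "w sq_integrable_on {0<..}"
  proof -
    have "(\<lambda>t. if t \<in> {0..T} then cnj (y t) + c * \<psi> t else 0) sq_integrable_on {0<..}"
    proof (rule sq_integrable_on_bounded_support[where T=T])
      have c: "continuous_on {0..T} (\<lambda>t. if t \<in> {0..T} then cnj (y t) + c * \<psi> t else 0)"
        by (rule continuous_on_eq[of _ "\<lambda>t. cnj (y t) + c * \<psi> t"]) (auto intro!: continuous_intros yc psic)
      then show "(\<lambda>t. if t \<in> {0..T} then cnj (y t) + c * \<psi> t else 0) absolutely_integrable_on {0..T}"
        by (rule absolutely_integrable_continuous_real)
      show "bounded ((\<lambda>t. if t \<in> {0..T} then cnj (y t) + c * \<psi> t else 0) ` {0..T})"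
        using c by (intro compact_imp_bounded compact_continuous_image) auto
    qed auto
    then have "(\<lambda>t. (if t \<in> {0..T} then cnj (g t) else 0) - (if t \<in> {0..T} then cnj (y t) + c * \<psi> t else 0)) sq_integrable_on {0<..}"
      by (intro sq_integrable_diff[OF sq_integrable_truncate[OF sq_integrable_cnj[OF g]]])
    then show ?thesis by (rule sq_integrable_on_cong[rotated]) (auto simp: w_def u_def)
  qed
  then have ksq: "k sq_integrable_on {0<..}" unfolding k_def by (rule sq_integrable_cnj)
  have ka: "k absolutely_integrable_on {0..R}" for R
    by (rule sq_integrable_imp_absint(1)[OF ksq]) simp
  have kz: "k t = 0" if "t > T" for t using that by (simp add: k_def w_def)
  have orth: "integral {0..T} (\<lambda>t. k t * \<psi> t) = 0"
  proof -
    have "integral {0..T} (\<lambda>t. w t * cnj (\<psi> t)) = integral {0..T} (\<lambda>t. u t * cnj (\<psi> t) - c * (\<psi> t * cnj (\<psi> t)))"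
      by (rule integral_cong) (simp add: w_def algebra_simps)
    also have "\<dots> = integral {0..T} (\<lambda>t. u t * cnj (\<psi> t)) - c * D"
      unfolding D_def
      by (intro integral_unique has_integral_diff has_integral_mult_right integrable_integral absint_imp_integrable up pp)
    also have "\<dots> = 0" using D by (simp add: c_def)
    finally have 0: "integral {0..T} (\<lambda>t. w t * cnj (\<psi> t)) = 0" .
    have "integral {0..T} (\<lambda>t. k t * \<psi> t) = integral {0..T} (\<lambda>t. cnj (w t * cnj (\<psi> t)))"
      by (simp add: k_def)
    also have "\<dots> = cnj (integral {0..T} (\<lambda>t. w t * cnj (\<psi> t)))"
      by (rule integral_cnj[symmetric])
    finally show ?thesis using 0 by simp
  qed
  obtain f f1 where f: "sol f f1 k" "\<And>t. t \<ge> T \<Longrightarrow> f t = 0" "\<And>t. t \<ge> T \<Longrightarrow> f1 t = 0"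
    using sol_with_source[OF \<psi> T ka kz orth] by metis
  have "(abs_L2 f, abs_L2 (\<lambda>t. - k t)) \<in> pre_hamiltonian x \<alpha>"
    using pre_hamiltonianI[OF f(1) ksq f(2,3)] by simp
  then have "cinner (abs_L2 (\<lambda>t. - k t)) (abs_L2 g) = cinner (abs_L2 f) (abs_L2 h)"
    using adj unfolding adjoint_def by auto
  moreover have fsq: "f sq_integrable_on {0<..}"
    using sol_sq_integrable_bounded_support(1)[OF f(1)] f(2,3) by blast
  ultimately have "(LINT t|lebesgue_on {0<..}. - k t * cnj (g t)) = (LINT t|lebesgue_on {0<..}. f t * cnj (h t))"
    using g h sq_integrable_uminus[OF ksq] by (simp only: cinner_abs_L2)
  also have "(LINT t|lebesgue_on {0<..}. - k t * cnj (g t)) = integral {0..T} (\<lambda>t. - k t * cnj (g t))"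
    by (rule half_line_integral_vanishing[OF sq_integrable_mult_cnj[OF sq_integrable_uminus[OF ksq] g]]) (simp add: kz)
  also have "(LINT t|lebesgue_on {0<..}. f t * cnj (h t)) = integral {0..T} (\<lambda>t. f t * cnj (h t))"
    by (rule half_line_integral_vanishing[OF sq_integrable_mult_cnj[OF fsq h]]) (simp add: f(2))
  finally have 1: "- integral {0..T} (\<lambda>t. k t * cnj (g t)) = integral {0..T} (\<lambda>t. f t * cnj (h t))" by simp
  have "integral {0..T} (\<lambda>t. k t * cnj (y t)) - integral {0..T} (\<lambda>t. f t * cnj (- h t)) = 0"
    using green[OF f(1) sol_cnj[OF y], of T] T f(2)[of T] f(3)[of T] by simp
  then have 2: "integral {0..T} (\<lambda>t. k t * cnj (y t)) + integral {0..T} (\<lambda>t. f t * cnj (h t)) = 0" by simp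
  have eq: "integral {0..T} (\<lambda>t. k t * cnj (y t)) = integral {0..T} (\<lambda>t. k t * cnj (g t))"
    using 2 unfolding 1[symmetric] by simp
  have kg: "(\<lambda>t. k t * cnj (g t)) integrable_on {0..T}"
    using half_line_integral(2)[OF sq_integrable_mult_cnj[OF ksq g]]
    by (intro absint_imp_integrable) (rule set_integrable_subset, auto)
  have ky: "(\<lambda>t. k t * cnj (y t)) integrable_on {0..T}" and kp: "(\<lambda>t. k t * \<psi> t) integrable_on {0..T}"
    by (intro absint_imp_integrable absint_mult_continuous ka continuous_intros yc psic)+
  have "integral {0..T} (\<lambda>t. k t * w t) = integral {0..T} (\<lambda>t. (k t * cnj (g t) - k t * cnj (y t)) - c * (k t * \<psi> t))"
    by (rule integral_cong) (simp add: w_def u_def algebra_simps)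
  also have "\<dots> = (integral {0..T} (\<lambda>t. k t * cnj (g t)) - integral {0..T} (\<lambda>t. k t * cnj (y t))) - c * integral {0..T} (\<lambda>t. k t * \<psi> t)"
    by (intro integral_unique has_integral_diff has_integral_mult_right integrable_integral kg ky kp)
  also have "\<dots> = 0" using eq orth by simp
  finally have "integral {0..T} (\<lambda>t. complex_of_real ((cmod (w t))\<^sup>2)) = 0"
    by (simp only: k_def mult.commute[of "cnj _"] mult_cnj_self)
  moreover have "integral {0..T} (\<lambda>t. complex_of_real ((cmod (w t))\<^sup>2)) = of_real (integral {0..T} (\<lambda>t. (cmod (w t))\<^sup>2))"
    using integral_linear[OF sq_integrable_imp_absint(2)[OF wsq order_refl] bounded_linear_of_real] by (simp add: o_def)
  ultimately have "integral {0..T} (\<lambda>t. (cmod (w t))\<^sup>2) = 0" by simp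
  then obtain N where N: "negligible N" "\<And>t. t \<in> {0..T} \<Longrightarrow> t \<notin> N \<Longrightarrow> w t = 0"
    using zero_if_square_integral_zero[OF wsq] by metis
  show thesis
    by (rule that[OF N(1), of c]) (use N(2) in \<open>auto simp: w_def u_def\<close>)
qed

text \<open>
  The proportionality factors found on the intervals \<open>[0, x\<^sub>n]\<close> agree, because on the
  first gap the zero-energy solution is constantly \<open>1\<close>.
\<close>

lemma adjointE:
  assumes "(G, H) \<in> adjoint (pre_hamiltonian x \<alpha>)"
  obtains g g1 g2 where "sol g g1 g2" "g sq_integrable_on {0<..}" "g2 sq_integrable_on {0<..}"
    "G = abs_L2 g" "H = abs_L2 (\<lambda>t. - g2 t)"
proof -
  obtain q where q: "q sq_integrable_on {0<..}" "G = abs_L2 q" by (rule L2_cases)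
  obtain h where h: "h sq_integrable_on {0<..}" "H = abs_L2 h" by (rule L2_cases)
  have "(\<lambda>t. - h t) absolutely_integrable_on {0..R}" for R
    by (rule sq_integrable_imp_absint(1)[OF sq_integrable_uminus[OF h(1)]]) simp
  then obtain y y1 where y: "sol y y1 (\<lambda>t. - h t)" "y 0 = 0" using sol_exists_0 by blast
  obtain \<psi> \<psi>1 where psi: "sol \<psi> \<psi>1 (\<lambda>_. 0)" "\<psi> 0 = 1" by (rule ex_zero_energy_sol)
  have "\<exists>c N. negligible N \<and> (\<forall>t. 0 < t \<longrightarrow> t \<le> x (Suc n) \<longrightarrow> t \<notin> N \<longrightarrow> cnj (q t - y t) = c * \<psi> t)" for n
    using adjoint_up_to_zero_energy_sol[OF assms[unfolded q(2) h(2)] q(1) h(1) y(1) psi, of "x (Suc n)"] by (metis x_pos zero_less_Suc)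
  then obtain c N where cN: "\<And>n. negligible (N n)"
    "\<And>n t. 0 < t \<Longrightarrow> t \<le> x (Suc n) \<Longrightarrow> t \<notin> N n \<Longrightarrow> cnj (q t - y t) = c n * \<psi> t" by metis
  have c0: "c n = c 0" for n
  proof -
    have "\<not> {0<..<x 1} \<subseteq> N n \<union> N 0"
      using not_negligible_interval[of 0 "x 1"] cN(1) by (metis negligible_Un negligible_subset x_pos zero_less_one)
    then obtain t where "t \<in> {0<..<x 1}" "t \<notin> N n \<union> N 0" by blast
    then have t: "0 < t" "t < x 1" "t \<notin> N n" "t \<notin> N 0" by auto
    have "nodes_below s = {}" if "s \<le> x 1" for s using nodes_below_mono[OF that] by simp
    then have p0: "\<psi>1 s = 0" if "s \<in> {0..t}" for s using solD(2)[OF psi(1), of s] that t by (simp add: jumps_def)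
    have "integral {0..t} \<psi>1 = integral {0..t} (\<lambda>_. 0)" by (rule integral_cong) (rule p0)
    then have "\<psi> t = 1" using solD(3)[OF psi(1), of t] t psi(2) by simp
    moreover have "t \<le> x (Suc n)" using order_less_le_trans[OF t(2), of "x (Suc n)"] by simp
    moreover have "t \<le> x (Suc 0)" using t(2) by simp
    ultimately show ?thesis using cN(2)[of t n] cN(2)[of t 0] t by simp
  qed
  define g where "g = (\<lambda>t. y t + cnj (c 0) * cnj (\<psi> t))"
  have S: "sol g (\<lambda>t. y1 t + cnj (c 0) * cnj (\<psi>1 t)) (\<lambda>t. - h t + cnj (c 0) * cnj 0)"
    unfolding g_def by (intro sol_add y sol_mult sol_cnj psi(1))
  have NN: "negligible (\<Union>n. N n)" using cN(1) by (rule negligible_Union_nat)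
  have qg: "q t = g t" if t: "t > 0" "t \<notin> (\<Union>n. N n)" for t
  proof -
    obtain n where "t \<le> x (Suc n)" using locate[OF t(1)] by blast
    then have "cnj (q t - y t) = c 0 * \<psi> t" using cN(2)[of t n] c0[of n] t by auto
    then have "q t - y t = cnj (c 0 * \<psi> t)" by (metis complex_cnj_cnj)
    then show ?thesis by (simp add: g_def algebra_simps)
  qed
  note sp = sq_integrable_spike[OF q(1) NN qg]
  show thesis
    by (rule that[OF S]) (use sp q h sq_integrable_uminus[OF h(1)] in simp_all)
qed

end

section \<open>Self-adjointness and deficiency spaces in terms of solutions\<close>

lemma cinner_scaleC_right: "cinner f (c *\<^sub>C g) = cnj c * cinner f g"
proof -
  obtain p where p: "p sq_integrable_on {0<..}" "f = abs_L2 p" by (rule L2_cases)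
  obtain q where q: "q sq_integrable_on {0<..}" "g = abs_L2 q" by (rule L2_cases)
  have "(\<lambda>t. p t * cnj (c * q t)) = (\<lambda>t. cnj c * (p t * cnj (q t)))" by (simp add: mult_ac)
  then show ?thesis using p q by (simp add: scaleC_abs_L2 cinner_abs_L2 sq_integrable_mult)
qed

lemma cinner_scaleC_left: "cinner (c *\<^sub>C f) g = c * cinner f g"
proof -
  obtain p where p: "p sq_integrable_on {0<..}" "f = abs_L2 p" by (rule L2_cases)
  obtain q where q: "q sq_integrable_on {0<..}" "g = abs_L2 q" by (rule L2_cases)
  have "(\<lambda>t. c * p t * cnj (q t)) = (\<lambda>t. c * (p t * cnj (q t)))" by (simp add: mult_ac)
  then show ?thesis using p q by (simp add: scaleC_abs_L2 cinner_abs_L2 sq_integrable_mult)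
qed

lemma cinner_eq_Complex: "cinner f g = Complex (f \<bullet> g) (f \<bullet> (\<i> *\<^sub>C g))"
  by (simp add: complex_eq_iff inner_L2_def cinner_scaleC_right)

lemma scaleC_minus1: "(-1) *\<^sub>C f = - f" for f :: L2
  using L2.scale_minus_left[of 1 f] by simp

lemma cinner_minus_right: "cinner f (- g) = - cinner f g"
  using cinner_scaleC_right[of f "-1" g] by (simp add: scaleC_minus1)

lemma cinner_zero_right [simp]: "cinner f 0 = 0"
  using cinner_scaleC_right[of f 0 0] by simp

lemma continuous_on_cinner:
  assumes "continuous_on S f" "continuous_on S g"
    "continuous_on S (\<lambda>p. \<i> *\<^sub>C g p)"
  shows "continuous_on S (\<lambda>p. cinner (f p) (g p))"
  unfolding cinner_eq_Complex using assms
  by (intro continuous_on_Complex continuous_on_inner)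

lemma continuous_on_scaleC: "continuous_on S f \<Longrightarrow> continuous_on S (\<lambda>p. c *\<^sub>C f p)" for f :: "'a::topological_space \<Rightarrow> L2"
proof -
  have "norm (c *\<^sub>C h) = cmod c * norm h" for h :: L2
  proof -
    have "(norm (c *\<^sub>C h))\<^sup>2 = (cmod c)\<^sup>2 * (norm h)\<^sup>2"
    proof -
      have "(norm (c *\<^sub>C h))\<^sup>2 = Re (c * cnj c * cinner h h)"
        by (simp add: power2_norm_eq_inner[of "c *\<^sub>C h"] inner_L2_def cinner_scaleC_left cinner_scaleC_right algebra_simps)
      also have "\<dots> = (cmod c)\<^sup>2 * Re (cinner h h)"
        unfolding mult_cnj_self by (simp del: of_real_power)
      finally show ?thesis by (simp add: power2_norm_eq_inner[of h] inner_L2_def)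
    qed
    then show ?thesis by (metis norm_ge_zero mult_nonneg_nonneg power2_eq_imp_eq power_mult_distrib)
  qed
  then have "bounded_linear (\<lambda>h::L2. c *\<^sub>C h)"
    by (intro bounded_linear_intro[of _ "cmod c"])
       (auto simp: L2.scale_right_distrib scaleR_L2_def mult.commute)
  then show "continuous_on S f \<Longrightarrow> continuous_on S (\<lambda>p. c *\<^sub>C f p)"
    by (rule bounded_linear.continuous_on)
qed

lemma closed_adjoint: "closed (adjoint H)"
proof -
  have "adjoint H = (\<Inter>(f, k)\<in>H. {p. cinner k (fst p) = cinner f (snd p)})"
    by (auto simp: adjoint_def)
  also have "closed \<dots>"
    by (auto intro!: closed_INT closed_Collect_eq continuous_on_cinner continuous_on_scaleC continuous_intros)
  finally show ?thesis .
qed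

lemma adjoint_closure: "adjoint (closure H) = adjoint H"
proof
  show "adjoint (closure H) \<subseteq> adjoint H" using closure_subset[of H] by (auto simp: adjoint_def)
  show "adjoint H \<subseteq> adjoint (closure H)"
  proof
    fix p assume p: "p \<in> adjoint H"
    have "closed {q. cinner (snd q) (fst p) = cinner (fst q) (snd p)}"
      by (auto intro!: closed_Collect_eq continuous_on_cinner continuous_intros)
    moreover have "H \<subseteq> {q. cinner (snd q) (fst p) = cinner (fst q) (snd p)}"
      using p by (auto simp: adjoint_def)
    ultimately have "closure H \<subseteq> {q. cinner (snd q) (fst p) = cinner (fst q) (snd p)}"
      by (rule closure_minimal[rotated])
    then show "p \<in> adjoint (closure H)" by (auto simp: adjoint_def split: prod.splits)
  qed
qed

lemma real_orthogonal_imp_complex: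
  assumes "\<And>f k. (f, k) \<in> M \<Longrightarrow> (\<i> *\<^sub>C f, \<i> *\<^sub>C k) \<in> M"
    and "\<And>m. m \<in> M \<Longrightarrow> m \<bullet> (u, v) = 0" and "(f, k) \<in> M"
  shows "cinner f u + cinner k v = 0"
proof -
  have "Re (cinner f u + cinner k v) = 0"
    using assms(2)[OF assms(3)] by (simp add: inner_L2_def)
  moreover have "Re (\<i> * (cinner f u + cinner k v)) = 0"
    using assms(2)[OF assms(1)[OF assms(3)]] by (simp add: inner_L2_def cinner_scaleC_left)
  ultimately show ?thesis by (simp add: complex_eq_iff)
qed

context nodes
begin

text \<open>
  A solution is continuous, so it vanishes identically; its second derivative is then
  recovered from the integral equation.
\<close>

lemma sol_eq_0_AE:
  assumes f: "sol f f1 f2" and N: "negligible N" and z: "\<And>t. t > 0 \<Longrightarrow> t \<notin> N \<Longrightarrow> f t = 0"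
  shows "\<And>t. t \<ge> 0 \<Longrightarrow> f t = 0" "\<And>t. t > 0 \<Longrightarrow> f1 t = 0"
    "\<exists>N. negligible N \<and> (\<forall>t\<ge>0. t \<notin> N \<longrightarrow> f2 t = 0)"
proof -
  show f0: "f t = 0" if t: "t \<ge> 0" for t
  proof -
    have "(f \<longlongrightarrow> f t) (at t within {0..})"
      using solD(5)[OF f] t by (auto simp: continuous_on)
    then have l: "(f \<longlongrightarrow> f t) (at t within ({t<..} - N))"
      by (rule tendsto_within_subset) (use t in auto)
    have "t islimpt ({t<..} - N)"
      unfolding islimpt_approachable
    proof (intro allI impI)
      fix e :: real assume e: "e > 0"
      have "\<not> {t<..<t+e} \<subseteq> N"
        using not_negligible_interval[of t "t+e"] e N by (metis negligible_subset less_add_same_cancel1)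
      then obtain s where "s \<in> {t<..<t+e}" "s \<notin> N" by blast
      then show "\<exists>s\<in>{t<..} - N. s \<noteq> t \<and> dist s t < e" by (intro bexI[of _ s]) (auto simp: dist_real_def)
    qed
    then have "at t within ({t<..} - N) \<noteq> bot" by (simp add: trivial_limit_within)
    moreover have "eventually (\<lambda>s. f s = 0) (at t within ({t<..} - N))"
      unfolding eventually_at_filter by (rule always_eventually) (use z t in auto)
    then have "(f \<longlongrightarrow> 0) (at t within ({t<..} - N))" by (rule tendsto_eventually)
    ultimately show ?thesis using l by (metis tendsto_unique)
  qed
  show f1: "f1 t = 0" if "t > 0" for t
    by (rule sol_deriv_zero_if_zero_beyond[OF f order_refl f0 that])
  have "integral {0..t} f2 = 0" if "t \<ge> 0" for t
  proof (cases "t = 0")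
    case False
    have "jumps f t = 0" unfolding jumps_def by (rule sum.neutral) (simp add: f0)
    then show ?thesis using solD(2)[OF f that] f1[of t] False that by simp
  qed simp
  then show "\<exists>N. negligible N \<and> (\<forall>t\<ge>0. t \<notin> N \<longrightarrow> f2 t = 0)"
    using zero_if_primitive_zero[OF solD(1)[OF f]] by metis
qed

lemma pre_hamiltonian_add:
  assumes "(F, K) \<in> pre_hamiltonian x \<alpha>" "(F', K') \<in> pre_hamiltonian x \<alpha>"
  shows "(F + F', K + K') \<in> pre_hamiltonian x \<alpha>"
proof -
  obtain f f1 f2 T where f: "sol f f1 f2" "f sq_integrable_on {0<..}" "f2 sq_integrable_on {0<..}"
    "F = abs_L2 f" "K = abs_L2 (\<lambda>t. - f2 t)" "T \<ge> 0" "\<And>t. t > T \<Longrightarrow> f t = 0" "\<And>t. t > T \<Longrightarrow> f1 t = 0"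
    by (rule pre_hamiltonianE[OF assms(1)]) (rule that, assumption+)
  obtain g g1 g2 R where g: "sol g g1 g2" "g sq_integrable_on {0<..}" "g2 sq_integrable_on {0<..}"
    "F' = abs_L2 g" "K' = abs_L2 (\<lambda>t. - g2 t)" "R \<ge> 0" "\<And>t. t > R \<Longrightarrow> g t = 0" "\<And>t. t > R \<Longrightarrow> g1 t = 0"
    by (rule pre_hamiltonianE[OF assms(2)]) (rule that, assumption+)
  have "(abs_L2 (\<lambda>t. f t + g t), abs_L2 (\<lambda>t. - (f2 t + g2 t))) \<in> pre_hamiltonian x \<alpha>"
    by (rule pre_hamiltonianI[OF sol_add[OF f(1) g(1)] sq_integrable_add[OF f(3) g(3)], of "max T R + 1"])
       (use f(7,8) g(7,8) in auto)
  then show ?thesis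
    using f(2-5) g(2-5) by (simp add: plus_abs_L2 sq_integrable_uminus)
qed

lemma pre_hamiltonian_scaleC:
  assumes "(F, K) \<in> pre_hamiltonian x \<alpha>"
  shows "(c *\<^sub>C F, c *\<^sub>C K) \<in> pre_hamiltonian x \<alpha>"
proof -
  obtain f f1 f2 T where f: "sol f f1 f2" "f sq_integrable_on {0<..}" "f2 sq_integrable_on {0<..}"
    "F = abs_L2 f" "K = abs_L2 (\<lambda>t. - f2 t)" "T \<ge> 0" "\<And>t. t > T \<Longrightarrow> f t = 0" "\<And>t. t > T \<Longrightarrow> f1 t = 0"
    by (rule pre_hamiltonianE[OF assms(1)]) (rule that, assumption+)
  have "(abs_L2 (\<lambda>t. c * f t), abs_L2 (\<lambda>t. - (c * f2 t))) \<in> pre_hamiltonian x \<alpha>"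
    by (rule pre_hamiltonianI[OF sol_mult[OF f(1)] sq_integrable_mult[OF f(3)], of "T + 1"])
       (use f(7,8) in auto)
  then show ?thesis
    using f(2-5) by (simp add: scaleC_abs_L2 sq_integrable_uminus)
qed

lemma zero_in_pre_hamiltonian: "(0, 0) \<in> pre_hamiltonian x \<alpha>"
proof -
  have "sol (\<lambda>_. 0) (\<lambda>_. 0) (\<lambda>_. 0)"
    by (rule solI) (auto simp: jumps_def intro: absint_const)
  from pre_hamiltonianI[OF this sq_integrable_zero, of 0] show ?thesis
    by (simp add: zero_L2_def)
qed

lemma subspace_pre_hamiltonian: "subspace (pre_hamiltonian x \<alpha>)"
  unfolding subspace_def
  by (auto simp: zero_in_pre_hamiltonian pre_hamiltonian_add pre_hamiltonian_scaleC scaleR_L2_def zero_prod_def)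

lemma subspace_Domain: "subspace (Domain (pre_hamiltonian x \<alpha>))"
  unfolding subspace_def
  by (auto simp: scaleR_L2_def intro: zero_in_pre_hamiltonian pre_hamiltonian_add pre_hamiltonian_scaleC)

text \<open>
  If \<open>u\<close> is orthogonal to the domain, then \<open>(0, u)\<close> lies in the adjoint; so \<open>u\<close> is minus the
  second derivative of a solution that vanishes almost everywhere.
\<close>

lemma densely_defined_hamiltonian: "densely_defined (hamiltonian x \<alpha>)"
proof -
  have "z \<in> closure (Domain (pre_hamiltonian x \<alpha>))" for z
  proof (rule closure_subspace_if_orthogonal[OF subspace_Domain])
    fix u assume u: "\<And>m. m \<in> Domain (pre_hamiltonian x \<alpha>) \<Longrightarrow> m \<bullet> u = 0"
    have "cinner f u = 0" if fk: "(f, k) \<in> pre_hamiltonian x \<alpha>" for f k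
    proof -
      have "m \<bullet> (u, 0) = 0" if "m \<in> pre_hamiltonian x \<alpha>" for m
        using u[of "fst m"] that by (cases m) auto
      from real_orthogonal_imp_complex[OF pre_hamiltonian_scaleC this fk]
      show ?thesis by simp
    qed
    then have "(0, u) \<in> adjoint (pre_hamiltonian x \<alpha>)" by (auto simp: adjoint_def)
    then obtain g g1 g2 where g: "sol g g1 g2" "g sq_integrable_on {0<..}" "g2 sq_integrable_on {0<..}"
      "0 = abs_L2 g" "u = abs_L2 (\<lambda>t. - g2 t)" by (rule adjointE)
    have "AE t in lebesgue_on {0<..}. g t = 0"
      using g(4) abs_L2_eq_iff[OF g(2) sq_integrable_zero] by (simp add: zero_L2_def)
    then obtain N where "negligible N" "\<And>t. t > 0 \<Longrightarrow> t \<notin> N \<Longrightarrow> g t = 0" by (rule AE_half_lineE) (rule that, assumption+)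
    from sol_eq_0_AE(3)[OF g(1) this] obtain N where N: "negligible N" "\<forall>t\<ge>0. t \<notin> N \<longrightarrow> g2 t = 0" by blast
    have "u = 0"
      unfolding g(5) zero_L2_def
      by (rule sq_integrable_spike(2)[OF sq_integrable_uminus[OF g(3)] N(1)]) (use N(2) in auto)
    then show "z \<bullet> u = 0" by simp
  qed
  moreover have "closure (Domain (pre_hamiltonian x \<alpha>)) \<subseteq> closure (Domain (hamiltonian x \<alpha>))"
    unfolding hamiltonian_def by (intro closure_mono Domain_mono closure_subset)
  ultimately show ?thesis by (auto simp: densely_defined_def)
qed

lemma adjoint_hamiltonian: "adjoint (hamiltonian x \<alpha>) = adjoint (pre_hamiltonian x \<alpha>)"
  unfolding hamiltonian_def by (rule adjoint_closure)

lemma hamiltonian_subset_adjoint: "hamiltonian x \<alpha> \<subseteq> adjoint (pre_hamiltonian x \<alpha>)"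
  unfolding hamiltonian_def
proof (rule closure_minimal[OF _ closed_adjoint])
  show "pre_hamiltonian x \<alpha> \<subseteq> adjoint (pre_hamiltonian x \<alpha>)"
  proof (clarify)
    fix F K assume "(F, K) \<in> pre_hamiltonian x \<alpha>"
    then obtain f f1 f2 T where f: "sol f f1 f2" "f sq_integrable_on {0<..}" "f2 sq_integrable_on {0<..}"
      "F = abs_L2 f" "K = abs_L2 (\<lambda>t. - f2 t)" "T \<ge> 0" "\<And>t. t > T \<Longrightarrow> f t = 0" "\<And>t. t > T \<Longrightarrow> f1 t = 0"
      by (rule pre_hamiltonianE) (rule that, assumption+)
    then show "(F, K) \<in> adjoint (pre_hamiltonian x \<alpha>)" using adjointI[OF f(1-3)] by simp
  qed
qed

text \<open>
  An element \<open>(u, w)\<close> orthogonal to the graph of the pre-Hamiltonian is the same as an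
  element \<open>(w, - u)\<close> of the adjoint. Hence elements of the adjoint that annihilate the adjoint in
  the boundary form lie in the closure of that graph.
\<close>

lemma self_adjoint_if_boundary_form_vanishes:
  assumes "\<And>g g1 g2 v v1 v2. sol g g1 g2 \<Longrightarrow> g sq_integrable_on {0<..} \<Longrightarrow> g2 sq_integrable_on {0<..} \<Longrightarrow>
      sol v v1 v2 \<Longrightarrow> v sq_integrable_on {0<..} \<Longrightarrow> v2 sq_integrable_on {0<..} \<Longrightarrow>
      (LINT t|lebesgue_on {0<..}. g2 t * cnj (v t)) = (LINT t|lebesgue_on {0<..}. g t * cnj (v2 t))"
  shows "self_adjoint (hamiltonian x \<alpha>)"
proof -
  have "adjoint (pre_hamiltonian x \<alpha>) \<subseteq> hamiltonian x \<alpha>"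
  proof (clarify)
    fix G H assume GH: "(G, H) \<in> adjoint (pre_hamiltonian x \<alpha>)"
    obtain g g1 g2 where g: "sol g g1 g2" "g sq_integrable_on {0<..}" "g2 sq_integrable_on {0<..}"
      "G = abs_L2 g" "H = abs_L2 (\<lambda>t. - g2 t)" by (rule adjointE[OF GH])
    show "(G, H) \<in> hamiltonian x \<alpha>"
      unfolding hamiltonian_def
    proof (rule closure_subspace_if_orthogonal[OF subspace_pre_hamiltonian])
      fix p :: "L2 \<times> L2" assume *: "\<And>m. m \<in> pre_hamiltonian x \<alpha> \<Longrightarrow> m \<bullet> p = 0"
      obtain u w where p: "p = (u, w)" by (cases p)
      from * have orth: "\<And>m. m \<in> pre_hamiltonian x \<alpha> \<Longrightarrow> m \<bullet> (u, w) = 0" by (simp add: p)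
      have "cinner f u + cinner k w = 0" if "(f, k) \<in> pre_hamiltonian x \<alpha>" for f k
        by (rule real_orthogonal_imp_complex[OF pre_hamiltonian_scaleC orth that])
      then have "cinner k w = cinner f (- u)" if "(f, k) \<in> pre_hamiltonian x \<alpha>" for f k
        using that by (metis add_eq_0_iff cinner_minus_right)
      then have "(w, - u) \<in> adjoint (pre_hamiltonian x \<alpha>)" by (auto simp: adjoint_def)
      then obtain v v1 v2 where v: "sol v v1 v2" "v sq_integrable_on {0<..}" "v2 sq_integrable_on {0<..}"
        "w = abs_L2 v" "- u = abs_L2 (\<lambda>t. - v2 t)" by (rule adjointE)
      have "cinner H w = cinner G (- u)"
        using assms[OF g(1-3) v(1-3)] g v by (simp add: cinner_abs_L2 sq_integrable_uminus)
      then have "cinner G u + cinner H w = 0" by (simp add: cinner_minus_right)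
      then show "(G, H) \<bullet> p = 0" unfolding p by (simp add: inner_L2_def flip: plus_complex.sel(1))
    qed
  qed
  then show ?thesis
    using densely_defined_hamiltonian hamiltonian_subset_adjoint adjoint_hamiltonian
    by (auto simp: self_adjoint_def)
qed

lemma ex_eigen_sol:
  assumes z: "z \<noteq> 0"
  obtains \<phi> \<phi>1 where "sol \<phi> \<phi>1 (\<lambda>t. - z * \<phi> t)" "\<phi> 0 = 1"
proof -
  define k where "k = csqrt z"
  have k: "k * k = z" "k \<noteq> 0" using z by (auto simp: k_def simp flip: power2_eq_square)
  define C where "C = (\<lambda>t::real. cos (k * of_real t))"
  define S where "S = (\<lambda>t::real. sin (k * of_real t) / k)"
  have dS: "(S has_vector_derivative C t) (at t within A)" for t A
    unfolding S_def C_def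
    by (rule has_vector_derivative_real_field[of "\<lambda>w. sin (k * w) / k"])
      (use k in \<open>auto intro!: derivative_eq_intros\<close>)
  have dC: "(C has_vector_derivative (- z * S t)) (at t within A)" for t A
    unfolding S_def C_def
    by (rule has_vector_derivative_real_field[of "\<lambda>w. cos (k * w)"])
      (use k in \<open>auto intro!: derivative_eq_intros simp: field_simps\<close>)
  have iC: "(C has_integral (S t - S 0)) {0..t}" and iS: "((\<lambda>u. - z * S u) has_integral (C t - C 0)) {0..t}"
    if "t \<ge> 0" for t
    using that by (intro fundamental_theorem_of_calculus dS dC; simp)+
  have 0: "S 0 = 0" "C 0 = 1" by (auto simp: S_def C_def)
  have cont: "continuous_on A C" "continuous_on A S" for A
    using k by (auto simp: C_def S_def intro!: continuous_intros)
  have S_eq: "S t = integral {0..t} C" if "t \<ge> 0" for t using iC[OF that] 0 by (simp add: integral_unique)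
  have C_eq: "C t = 1 - z * integral {0..t} S" if "t \<ge> 0" for t
  proof -
    have "- (z * integral {0..t} S) = C t - 1" using iS[OF that] 0 by (simp add: has_integral_iff)
    then show ?thesis by (metis diff_add_cancel add.commute uminus_add_conv_diff)
  qed
  have F1: "- z * S t = integral {0..t} (\<lambda>t. - z * C t)" if "t \<ge> 0" for t
    using S_eq[OF that] by simp
  have F: "C t = C 0 + integral {0..t} (\<lambda>t. - z * S t)" if "t \<ge> 0" for t
    using C_eq[OF that] 0 by simp
  obtain f f1 where f: "sol f f1 (\<lambda>t. - z * C t - z * (f t - C t))" "f 0 = C 0"
    by (rule sol_exists[OF S_eq C_eq cont F F1])
       (auto intro!: absolutely_integrable_continuous_real continuous_intros cont)
  have "(\<lambda>t. - z * C t - z * (f t - C t)) = (\<lambda>t. - z * f t)" by (simp add: algebra_simps)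
  then show thesis using f 0 by (intro that[of f f1]) auto
qed

text \<open>
  By uniqueness, a solution of the eigenvalue equation is its value at the origin times \<open>\<phi>\<close>.
\<close>

lemma dim_ker_shift:
  assumes phi: "sol \<phi> \<phi>1 (\<lambda>t. - z * \<phi> t)" "\<phi> 0 = 1" and sq: "\<phi> sq_integrable_on {0<..}"
  shows "L2.dim (ker_shift (adjoint (hamiltonian x \<alpha>)) z) = 1"
proof -
  let ?P = "abs_L2 \<phi>"
  have sq2: "(\<lambda>t. - z * \<phi> t) sq_integrable_on {0<..}" by (rule sq_integrable_mult[OF sq])
  have "(c *\<^sub>C ?P, z *\<^sub>C c *\<^sub>C ?P) \<in> adjoint (pre_hamiltonian x \<alpha>)" for c
    using adjointI[OF sol_mult[OF phi(1)] sq_integrable_mult[OF sq] sq_integrable_mult[OF sq2], of c] 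
    by (simp add: scaleC_abs_L2 sq sq_integrable_mult mult_ac)
  moreover have "\<exists>c. F = c *\<^sub>C ?P" if F: "(F, z *\<^sub>C F) \<in> adjoint (pre_hamiltonian x \<alpha>)" for F
  proof -
    obtain g g1 g2 where g: "sol g g1 g2" "g sq_integrable_on {0<..}" "g2 sq_integrable_on {0<..}"
      "F = abs_L2 g" "z *\<^sub>C F = abs_L2 (\<lambda>t. - g2 t)" by (rule adjointE[OF F])
    have "abs_L2 (\<lambda>t. z * g t) = abs_L2 (\<lambda>t. - g2 t)" using g by (simp add: scaleC_abs_L2)
    then have "AE t in lebesgue_on {0<..}. z * g t = - g2 t"
      using abs_L2_eq_iff[OF sq_integrable_mult[OF g(2)] sq_integrable_uminus[OF g(3)]] by simp
    then obtain N where N: "negligible N" "\<And>t. t > 0 \<Longrightarrow> t \<notin> N \<Longrightarrow> z * g t = - g2 t"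
      by (rule AE_half_lineE) (rule that, assumption+)
    have g': "sol g g1 (\<lambda>t. - z * g t)"
    proof (rule sol_cong_negligible[OF g(1), of "insert 0 N"])
      show "negligible (insert 0 N)" using N(1) by simp
      fix t :: real assume "t \<ge> 0" "t \<notin> insert 0 N"
      then show "g2 t = - z * g t" using N(2)[of t] by simp
    qed
    let ?w = "\<lambda>t. g t + (- g 0) * \<phi> t"
    have w: "sol ?w (\<lambda>t. g1 t + (- g 0) * \<phi>1 t) (\<lambda>t. - z * g t + (- g 0) * (- z * \<phi> t))"
      by (rule sol_add[OF g' sol_mult[OF phi(1)]])
    have w0: "?w t = 0" if "t \<ge> 0" for t
      by (rule sol_unique(1)[OF w order_refl, of z])
         (use phi(2) solD(6)[OF g'] solD(6)[OF phi(1)] that in \<open>auto simp: algebra_simps\<close>)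
    have geq: "g t = g 0 * \<phi> t" if "t \<ge> 0" for t
      using w0[OF that] by (metis add.right_inverse add_left_imp_eq add.commute mult_minus_left)
    have "abs_L2 g = abs_L2 (\<lambda>t. g 0 * \<phi> t)"
      by (rule sq_integrable_spike(2)[OF g(2) negligible_empty geq]) (rule less_imp_le)
    then show ?thesis using g(4) sq by (auto simp: scaleC_abs_L2)
  qed
  ultimately have "ker_shift (adjoint (hamiltonian x \<alpha>)) z = range (\<lambda>c. c *\<^sub>C ?P)"
    unfolding ker_shift_def adjoint_hamiltonian image_def by blast
  also have "\<dots> = L2.span {?P}" by (simp add: L2.span_singleton)
  finally have ker: "ker_shift (adjoint (hamiltonian x \<alpha>)) z = L2.span {?P}" .
  have "?P \<noteq> 0"
  proof
    assume "?P = 0"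
    then have "AE t in lebesgue_on {0<..}. \<phi> t = 0"
      using abs_L2_eq_iff[OF sq sq_integrable_zero] by (simp add: zero_L2_def)
    then obtain N where "negligible N" "\<And>t. t > 0 \<Longrightarrow> t \<notin> N \<Longrightarrow> \<phi> t = 0" by (rule AE_half_lineE) (rule that, assumption+)
    from sol_eq_0_AE(1)[OF phi(1) this, of 0] show False using phi(2) by simp
  qed
  then have "L2.independent {?P}" by simp
  then show ?thesis unfolding ker by (simp add: L2.dim_span L2.dim_eq_card_independent)
qed

end

section \<open>Two lemmas on sequences, and solutions sampled at the nodes\<close>

text \<open>
  Summation by parts gives \<open>\<Sum>\<^sub>n\<^sub><\<^sub>N (y\<^sub>n\<^sub>+\<^sub>1 - y\<^sub>n)\<^sup>2/w\<^sub>n \<le> y\<^sub>N (y\<^sub>N\<^sub>+\<^sub>1 - y\<^sub>N)/w\<^sub>N + K\<close>. If the left-hand side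
  diverged, then \<open>y\<^sub>N (y\<^sub>N\<^sub>+\<^sub>1 - y\<^sub>N)\<close> would eventually be positive and \<open>|y\<^sub>N|\<close> increasing from a
  nonzero value, which contradicts \<open>\<Sum>w\<^sub>n y\<^sub>n\<^sup>2 < \<infinity>\<close> because \<open>\<Sum>w\<^sub>n = \<infinity>\<close>. The boundary term must
  carry \<open>y\<^sub>N\<close> and not \<open>y\<^sub>N\<^sub>+\<^sub>1\<close>: positivity of the latter product would not exclude sign changes.
\<close>

lemma Dirichlet_sum_finite:
  fixes y w r \<beta> :: "nat \<Rightarrow> real"
  defines "D \<equiv> \<lambda>n. (y (Suc n) - y n) / w n"
  assumes w: "\<And>n. w n > 0" "\<not> summable w"
    and y: "summable (\<lambda>n. w n * (y n)\<^sup>2)" and r: "summable (\<lambda>n. (r n)\<^sup>2 / w n)"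
    and \<beta>: "C \<ge> 0" "\<And>n. \<beta> n \<ge> - C * w n"
    and eq0: "r 0 = - D 0 + \<beta> 0 * y 0"
    and eq: "\<And>n. r (Suc n) = - (D (Suc n) - D n) + \<beta> (Suc n) * y (Suc n)"
  shows "summable (\<lambda>n. (y (Suc n) - y n)\<^sup>2 / w n)"
proof (rule ccontr)
  define E where "E = (\<lambda>N. \<Sum>n<N. (y (Suc n) - y n)\<^sup>2 / w n)"
  assume "\<not> ?thesis"
  then have nb: "\<not> (\<exists>K. \<forall>N. E N \<le> K)"
    unfolding E_def using w(1) by (metis (no_types, lifting) summableI_nonneg_bounded divide_nonneg_pos zero_le_power2)
  have mono: "E M \<le> E N" if "M \<le> N" for M N
    unfolding E_def using that w(1) by (intro sum_mono2) (auto intro!: divide_nonneg_pos)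
  have E_eq: "E N = D N * y N + (\<Sum>n\<le>N. y n * (r n - \<beta> n * y n))" for N
  proof (induction N)
    case 0
    then show ?case by (simp add: E_def eq0)
  next
    case (Suc N)
    have 1: "E (Suc N) = E N + D N * (y (Suc N) - y N)" by (simp add: E_def D_def power2_eq_square)
    have 2: "r (Suc N) - \<beta> (Suc N) * y (Suc N) = D N - D (Suc N)" using eq[of N] by simp
    show ?case unfolding 1 sum.atMost_Suc 2 unfolding Suc by (simp add: algebra_simps)
  qed
  \<comment> \<open>A summable majorant of the terms in \<open>E_eq\<close>.\<close>
  define s where "s = (\<lambda>n. (C + 1) * (w n * (y n)\<^sup>2) + (r n)\<^sup>2 / w n)"
  have s: "summable s" unfolding s_def by (intro summable_add summable_mult y r)
  have s0: "s n \<ge> 0" for n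
    unfolding s_def using w(1)[of n] \<beta>(1) by (intro add_nonneg_nonneg mult_nonneg_nonneg divide_nonneg_pos) auto
  have "y n * (r n - \<beta> n * y n) \<le> s n" for n
  proof -
    have "0 \<le> (w n * y n - r n)\<^sup>2 / w n" using w(1)[of n] by simp
    also have "\<dots> = w n * (y n)\<^sup>2 + (r n)\<^sup>2 / w n - 2 * (y n * r n)"
      using w(1)[of n] by (simp add: divide_simps) (simp add: algebra_simps power2_eq_square)
    finally have "2 * (y n * r n) \<le> w n * (y n)\<^sup>2 + (r n)\<^sup>2 / w n" by simp
    moreover have "0 \<le> w n * (y n)\<^sup>2" "0 \<le> (r n)\<^sup>2 / w n" using w(1)[of n] by auto
    moreover have "- \<beta> n * (y n)\<^sup>2 \<le> C * w n * (y n)\<^sup>2"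
      using \<beta>(2)[of n] by (intro mult_right_mono) auto
    ultimately show ?thesis by (simp add: s_def algebra_simps power2_eq_square)
  qed
  then have bound: "E N \<le> D N * y N + suminf s" for N
    unfolding E_eq using s s0 by (intro add_left_mono order_trans[OF sum_mono sum_le_suminf]) auto
  obtain N0 where "E N0 > suminf s" using nb by (meson not_le)
  then have pos: "D n * y n > 0" if "n \<ge> N0" for n
    using bound[of n] mono[OF that] by linarith
  have inc: "(y n)\<^sup>2 \<le> (y (Suc n))\<^sup>2" if "n \<ge> N0" for n
  proof -
    have "0 < (y (Suc n) - y n) * y n" using pos[OF that] w(1)[of n] by (simp add: D_def zero_less_divide_iff)
    then have "(y n)\<^sup>2 + 0 \<le> (y n)\<^sup>2 + (2 * ((y (Suc n) - y n) * y n) + (y (Suc n) - y n)\<^sup>2)"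
      by (intro add_left_mono) auto
    also have "\<dots> = (y (Suc n))\<^sup>2" by (simp add: power2_eq_square algebra_simps)
    finally show ?thesis by simp
  qed
  have ge: "(y N0)\<^sup>2 \<le> (y n)\<^sup>2" if "n \<ge> N0" for n
    using that by (induction rule: dec_induct) (auto intro: order_trans inc)
  have y0: "(y N0)\<^sup>2 > 0" using pos[of N0] by auto
  have "summable w"
  proof (rule summable_comparison_test'[of "\<lambda>n. w n * (y n)\<^sup>2 / (y N0)\<^sup>2" N0])
    show "summable (\<lambda>n. w n * (y n)\<^sup>2 / (y N0)\<^sup>2)" by (intro summable_divide y)
    show "norm (w n) \<le> w n * (y n)\<^sup>2 / (y N0)\<^sup>2" if "n \<ge> N0" for n
      using ge[OF that] y0 w(1)[of n] by (simp add: pos_le_divide_eq mult_left_mono)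
  qed
  with w(2) show False by contradiction
qed

text \<open>
  The form \<open>R\<^sub>n\<^sup>2 = |u\<^sub>n\<^sub>+\<^sub>1|\<^sup>2 + |u\<^sub>n|\<^sup>2 - 2\<kappa> Re (u\<^sub>n\<^sub>+\<^sub>1 cnj u\<^sub>n)\<close> is invariant under the
  unperturbed recurrence and positive definite for \<open>|\<kappa>| < 1\<close>. Written as the squared norm of a
  pair, it is changed by the perturbation in a controlled way: \<open>R\<close> grows by at most the error, so \<open>R\<^sub>n\<^sub>+\<^sub>1 \<le> (1 + O(e\<^sub>n)) R\<^sub>n\<close>.
\<close>

lemma bounded_if_almost_elliptic_recurrence:
  fixes u :: "nat \<Rightarrow> complex" and \<kappa> :: real
  assumes \<kappa>: "\<kappa>\<^sup>2 < 1" and e: "summable e" "\<And>n. e n \<ge> 0"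
    and rec: "\<And>n. n \<ge> N \<Longrightarrow> cmod (u (Suc (Suc n)) + u n - 2 * \<kappa> * u (Suc n))
        \<le> e n * (cmod (u n) + cmod (u (Suc n)) + cmod (u (Suc (Suc n))))"
  obtains B where "\<And>n. cmod (u n) \<le> B"
proof -
  define m where "m = sqrt (1 - \<kappa>\<^sup>2)"
  have m: "m > 0" "m\<^sup>2 = 1 - \<kappa>\<^sup>2" using \<kappa> by (auto simp: m_def)
  define R where "R = (\<lambda>n. norm (u n - \<kappa> * u (Suc n), m * u (Suc n)))"
  have R': "R n = norm (u (Suc n) - \<kappa> * u n, m * u n)" for n
  proof -
    have *: "(cmod (a - \<kappa> * b))\<^sup>2 + (cmod (m * b))\<^sup>2 = (cmod a)\<^sup>2 + (cmod b)\<^sup>2 - 2 * \<kappa> * Re (a * cnj b)" for a b :: complex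
    proof -
      have "(cmod (m * b))\<^sup>2 = (1 - \<kappa>\<^sup>2) * (cmod b)\<^sup>2"
        by (simp add: norm_mult power_mult_distrib m(2))
      moreover have "(cmod (a - \<kappa> * b))\<^sup>2 = (cmod a)\<^sup>2 + \<kappa>\<^sup>2 * (cmod b)\<^sup>2 - 2 * \<kappa> * Re (a * cnj b)"
        unfolding cmod_power2 by (simp add: power2_eq_square algebra_simps)
      ultimately show ?thesis by (simp add: algebra_simps)
    qed
    have "Re (u n * cnj (u (Suc n))) = Re (u (Suc n) * cnj (u n))" by simp
    then show ?thesis
      unfolding R_def norm_Pair * by (simp add: add.commute)
  qed
  have ge: "cmod (u n) \<le> R n / m" "cmod (u (Suc n)) \<le> R n / m" for n
  proof -
    have "m * cmod (u (Suc n)) \<le> R n" "m * cmod (u n) \<le> R n"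
      using norm_snd_le[of "m * u (Suc n)" "u n - \<kappa> * u (Suc n)"]
        norm_snd_le[of "m * u n" "u (Suc n) - \<kappa> * u n"] m(1) 
      unfolding R'[of n, symmetric] by (simp_all add: norm_mult R_def)
    then show "cmod (u n) \<le> R n / m" "cmod (u (Suc n)) \<le> R n / m"
      using m(1) by (simp_all add: field_simps)
  qed
  have "(\<lambda>n. e n / m) \<longlonglongrightarrow> 0"
    using summable_LIMSEQ_zero[OF summable_divide[OF e(1)]] .
  then have "eventually (\<lambda>n. e n / m < 1/2) sequentially" by (rule order_tendstoD) simp
  then obtain N1 where N1: "\<And>n. n \<ge> N1 \<Longrightarrow> e n / m < 1/2" by (auto simp: eventually_sequentially)
  define K where "K = max N N1"
  have R_step: "R (Suc n) \<le> exp (6 * (e n / m)) * R n" if n: "n \<ge> K" for n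
  proof -
    define \<epsilon> where "\<epsilon> = u (Suc (Suc n)) + u n - 2 * \<kappa> * u (Suc n)"
    define c where "c = e n / m"
    have c: "0 \<le> c" "c < 1/2" using e(2)[of n] m(1) N1[of n] n by (auto simp: c_def K_def)
    have "(u (Suc (Suc n)) - \<kappa> * u (Suc n), m * u (Suc n))
      = (- (u n - \<kappa> * u (Suc n)), m * u (Suc n)) + (\<epsilon>, 0)"
      by (simp add: \<epsilon>_def algebra_simps)
    then have "R (Suc n) \<le> norm (- (u n - \<kappa> * u (Suc n)), m * u (Suc n)) + norm (\<epsilon>, 0::complex)"
      unfolding R'[of "Suc n"] by (metis norm_triangle_ineq)
    also have "\<dots> = R n + cmod \<epsilon>" unfolding R_def norm_Pair by (simp only: norm_minus_cancel) simp
    also have "cmod \<epsilon> \<le> e n * (R n / m + R n / m + R (Suc n) / m)"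
      unfolding \<epsilon>_def using n e(2)[of n]
      by (intro order_trans[OF rec] mult_left_mono add_mono ge) (auto simp: K_def)
    also have "\<dots> = 2 * c * R n + c * R (Suc n)" by (simp add: c_def algebra_simps)
    finally have 1: "(1 - c) * R (Suc n) \<le> (1 + 2 * c) * R n" by (simp add: algebra_simps)
    \<comment> \<open>For \<open>c \<le> 1/2\<close> the factor \<open>(1 + 2 c) / (1 - c)\<close> is at most \<open>1 + 6 c\<close>.\<close>
    have "c * c \<le> c * (1/2)" using c by (intro mult_left_mono) auto
    then have "1 + 2 * c \<le> (1 - c) * (1 + 6 * c)" by (simp add: algebra_simps)
    then have "(1 + 2 * c) * R n \<le> (1 - c) * (1 + 6 * c) * R n"
      by (rule mult_right_mono) (simp add: R_def)
    with 1 have "(1 - c) * R (Suc n) \<le> (1 - c) * ((1 + 6 * c) * R n)" by (simp add: mult.assoc)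
    then have "R (Suc n) \<le> (1 + 6 * c) * R n" by (rule mult_left_le_imp_le) (use c in simp)
    also have "\<dots> \<le> exp (6 * c) * R n"
      by (intro mult_right_mono exp_ge_add_one_self) (simp add: R_def)
    finally show ?thesis by (simp add: c_def)
  qed
  have R_bound: "R n \<le> exp (6 * (\<Sum>i=K..<n. e i / m)) * R K" if "n \<ge> K" for n
    using that
  proof (induction rule: dec_induct)
    case (step n)
    have "R (Suc n) \<le> exp (6 * (e n / m)) * R n" by (rule R_step) (use step in simp)
    also have "\<dots> \<le> exp (6 * (e n / m)) * (exp (6 * (\<Sum>i=K..<n. e i / m)) * R K)"
      using step by (intro mult_left_mono) auto
    also have "\<dots> = exp (6 * (\<Sum>i=K..<Suc n. e i / m)) * R K"
      using step by (simp add: exp_add[symmetric] algebra_simps flip: mult.assoc)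
    finally show ?case .
  qed simp
  define S where "S = exp (6 * (\<Sum>i. e i / m)) * R K"
  have "cmod (u n) \<le> S / m" if "n \<ge> K" for n
  proof -
    have "(\<Sum>i=K..<n. e i / m) \<le> (\<Sum>i. e i / m)"
      using e m(1) by (intro sum_le_suminf summable_divide) auto
    then have "R n \<le> S"
      unfolding S_def using R_bound[OF that] by (intro order_trans[OF R_bound[OF that]] mult_right_mono) (auto simp: R_def)
    then have "R n / m \<le> S / m" using m(1) by (simp add: divide_right_mono)
    then show ?thesis using ge(1)[of n] by linarith
  qed
  then have "cmod (u n) \<le> S / m + (\<Sum>i<K. cmod (u i))" for n
  proof (cases "n \<ge> K")
    case True
    have "0 \<le> (\<Sum>i<K. cmod (u i))" by (simp add: sum_nonneg)
    then show ?thesis using \<open>\<And>n. n \<ge> K \<Longrightarrow> cmod (u n) \<le> S / m\<close>[OF True] by linarith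
  next
    case False
    then have "cmod (u n) \<le> (\<Sum>i<K. cmod (u i))" by (intro member_le_sum) auto
    moreover have "0 \<le> S / m" using m(1) by (simp add: S_def R_def)
    ultimately show ?thesis by linarith
  qed
  then show thesis by (rule that)
qed

text \<open>
  The gaps may shrink to zero, but neighbouring gaps stay comparable, so that weights may be
  shifted by one index.
\<close>

locale graded_nodes = nodes +
  assumes gap_le_1: "x (Suc n) - x n \<le> 1"
    and gap_ratio: "x (Suc n) - x n \<le> 2 * (x (Suc (Suc n)) - x (Suc n))"
begin

definition gap :: "nat \<Rightarrow> real" where "gap n = x (Suc n) - x n"

lemma gap_pos [simp]: "gap n > 0" by (simp add: gap_def)
lemma gap_neq_0 [simp]: "gap n \<noteq> 0" using less_imp_neq[OF gap_pos] by metis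
lemma gap_ge_0 [simp]: "0 \<le> gap n" by (rule less_imp_le[OF gap_pos])
lemma gap_le [simp]: "gap n \<le> 1" using gap_le_1 by (simp add: gap_def)

lemma not_summable_gap: "\<not> summable gap"
proof
  assume "summable gap"
  then have "(\<lambda>n. \<Sum>i<n. gap i) \<longlonglongrightarrow> suminf gap" by (rule summable_LIMSEQ)
  moreover have "(\<Sum>i<n. gap i) = x n" for n
    unfolding gap_def by (simp add: sum_lessThan_telescope)
  ultimately have "x \<longlonglongrightarrow> suminf gap" by simp
  then show False using lim not_tendsto_and_filterlim_at_infinity[of sequentially x]
    by (auto simp: filterlim_at_top_imp_at_infinity)
qed

definition slope :: "(real \<Rightarrow> complex) \<Rightarrow> nat \<Rightarrow> complex" where
  "slope g n = (g (x (Suc n)) - g (x n)) / gap n"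

definition variation :: "(real \<Rightarrow> complex) \<Rightarrow> nat \<Rightarrow> real" where
  "variation g2 n = integral {x n..x (Suc n)} (\<lambda>t. cmod (g2 t))"

definition mass :: "(real \<Rightarrow> complex) \<Rightarrow> nat \<Rightarrow> real" where
  "mass g n = integral {x n..x (Suc n)} (\<lambda>t. (cmod (g t))\<^sup>2)"

lemma sum_mass:
  assumes "\<And>n. (\<lambda>t. (cmod (g t))\<^sup>2) integrable_on {0..x n}"
  shows "(\<Sum>i<n. mass g i) = integral {0..x n} (\<lambda>t. (cmod (g t))\<^sup>2)"
proof (induction n)
  case (Suc n)
  then show ?case
    using Henstock_Kurzweil_Integration.integral_combine[OF x_ge0 _ assms[of "Suc n"], of n] by (simp add: mass_def)
qed simp

lemma mass_bounds:
  assumes g: "g sq_integrable_on {0<..}"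
  shows "mass g n \<ge> 0" "summable (mass g)" "(variation g n)\<^sup>2 \<le> gap n * mass g n"
proof -
  note i = sq_integrable_imp_absint(2)[OF g x_ge0] sq_integrable_imp_absint(2)[OF g order_refl]
  show nn: "mass g n \<ge> 0" for n
    unfolding mass_def by (rule Henstock_Kurzweil_Integration.integral_nonneg[OF i(1)]) simp
  have I: "(\<lambda>t. (cmod (g t))\<^sup>2) integrable_on {0..}"
    using g unfolding sq_integrable_on_half_closed[symmetric] by (simp add: sq_integrable_on_iff)
  show "summable (mass g)"
  proof (rule summableI_nonneg_bounded[OF nn])
    show "(\<Sum>i<n. mass g i) \<le> integral {0..} (\<lambda>t. (cmod (g t))\<^sup>2)" for n
      unfolding sum_mass[OF i(2)] by (rule integral_subset_le) (use i(2) I in auto)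
  qed
  show "(variation g n)\<^sup>2 \<le> gap n * mass g n"
    unfolding variation_def gap_def mass_def
    by (rule Cauchy_Schwarz_interval) (use sq_integrable_imp_absint[OF g x_ge0] in auto)
qed

lemma sol_taylor:
  assumes g: "sol g g1 g2" and t: "x n \<le> t" "t \<le> x (Suc n)"
  shows "cmod (g t - g (x n) - of_real (t - x n) * right_deriv g g1 n) \<le> (t - x n) * variation g2 n"
    "x n < t \<Longrightarrow> cmod (g1 t - right_deriv g g1 n) \<le> variation g2 n"
proof -
  note D = solD[OF g]
  have a2: "g2 absolutely_integrable_on {x n..x (Suc n)}" by (rule absint_subinterval[OF D(1)[of "x (Suc n)"]]) auto
  have d: "cmod (g1 u - right_deriv g g1 n) \<le> variation g2 n" if u: "x n < u" "u \<le> x (Suc n)" for u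
  proof -
    have a: "g2 absolutely_integrable_on {x n..u}" by (rule absint_subinterval[OF a2]) (use u in auto)
    have "cmod (g1 u - right_deriv g g1 n) = cmod (integral {x n..u} g2)"
      using sol_deriv_on_piece[OF g u] by simp
    also have "\<dots> \<le> integral {x n..u} (\<lambda>t. cmod (g2 t))" by (rule norm_integral_le[OF a])
    also have "\<dots> \<le> variation g2 n"
      unfolding variation_def using u
      by (intro integral_subset_le absint_norm a a2) auto
    finally show ?thesis .
  qed
  then show "x n < t \<Longrightarrow> cmod (g1 t - right_deriv g g1 n) \<le> variation g2 n" using t by blast
  have a1: "g1 integrable_on {x n..t}" by (rule absint_imp_integrable[OF absint_subinterval[OF D(4)[of t]]]) auto
  define k where "k = (\<lambda>u. if u = x n then 0 else g1 u - right_deriv g g1 n)"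
  have "((\<lambda>u. g1 u - right_deriv g g1 n) has_integral (integral {x n..t} g1 - (t - x n) *\<^sub>R right_deriv g g1 n)) {x n..t}"
    using has_integral_const_real[of "right_deriv g g1 n" "x n" t] t
    by (intro has_integral_diff integrable_integral a1) simp
  then have k: "(k has_integral (integral {x n..t} g1 - (t - x n) *\<^sub>R right_deriv g g1 n)) {x n..t}"
    by (rule has_integral_spike_finite[of "{x n}", rotated 2]) (auto simp: k_def)
  have vn: "0 \<le> variation g2 n"
    unfolding variation_def by (rule Henstock_Kurzweil_Integration.integral_nonneg[OF absint_norm[OF a2]]) simp
  have "cmod (integral {x n..t} g1 - (t - x n) *\<^sub>R right_deriv g g1 n) \<le> variation g2 n * measure lborel {x n..t}"
    by (rule has_integral_bound_real[OF vn _ k, of "{}"]) (use d t vn in \<open>auto simp: k_def\<close>)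
  then show "cmod (g t - g (x n) - of_real (t - x n) * right_deriv g g1 n) \<le> (t - x n) * variation g2 n"
    using sol_integral(1)[OF g x_ge0 t(1)] t by (simp add: scaleR_conv_of_real mult.commute)
qed

lemma variation_nonneg: "g2 absolutely_integrable_on {0..x (Suc n)} \<Longrightarrow> variation g2 n \<ge> 0"
  unfolding variation_def
  by (rule Henstock_Kurzweil_Integration.integral_nonneg[OF absint_norm[OF absint_subinterval]]) auto

lemma slope_bound:
  assumes g: "sol g g1 g2"
  shows "cmod (slope g n - right_deriv g g1 n) \<le> variation g2 n"
    "cmod (slope g n - g1 (x (Suc n))) \<le> 2 * variation g2 n"
proof -
  have "slope g n - right_deriv g g1 n = (g (x (Suc n)) - g (x n) - of_real (gap n) * right_deriv g g1 n) / gap n"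
    using gap_pos[of n] by (simp add: slope_def field_simps del: gap_pos)
  then have "cmod (slope g n - right_deriv g g1 n) = cmod (g (x (Suc n)) - g (x n) - of_real (gap n) * right_deriv g g1 n) / gap n"
    using gap_pos[of n] by (simp add: norm_divide del: gap_pos)
  also have "\<dots> \<le> gap n * variation g2 n / gap n"
    using sol_taylor(1)[OF g, of n "x (Suc n)"] unfolding gap_def[symmetric]
    by (intro divide_right_mono) (auto intro: less_imp_le)
  also have "\<dots> = variation g2 n" using gap_pos[of n] by (simp del: gap_pos)
  finally show 1: "cmod (slope g n - right_deriv g g1 n) \<le> variation g2 n" .
  have "cmod (g1 (x (Suc n)) - right_deriv g g1 n) \<le> variation g2 n"
    by (rule sol_taylor(2)[OF g]) auto
  then show "cmod (slope g n - g1 (x (Suc n))) \<le> 2 * variation g2 n"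
    using 1 norm_triangle_ineq4[of "slope g n - right_deriv g g1 n" "g1 (x (Suc n)) - right_deriv g g1 n"] by simp
qed

text \<open>
  The defect of the sampled values in the discrete equation: the piecewise affine interpolant
  of \<open>g\<close> has this defect in its jump conditions.
\<close>

definition jacobi :: "(real \<Rightarrow> complex) \<Rightarrow> nat \<Rightarrow> complex" where
  "jacobi g n = (if n = 0 then - slope g 0
     else - (slope g n - slope g (n - 1)) + of_real (\<alpha> n) * g (x n))"

text \<open>
  The jump condition holds exactly for \<open>g\<close>, and replacing its one-sided derivatives by
  slopes of chords costs at most the variation of the derivative on the adjacent gaps.
\<close>

lemma jacobi_bound:
  assumes g: "sol g g1 g2"
  shows "cmod (jacobi g 0) \<le> variation g2 0"
    "cmod (jacobi g (Suc n)) \<le> variation g2 (Suc n) + 2 * variation g2 n"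
proof -
  have "right_deriv g g1 0 = 0" using solD(6)[OF g] by (simp add: right_deriv_def)
  then show "cmod (jacobi g 0) \<le> variation g2 0"
    using slope_bound(1)[OF g, of 0] by (simp add: jacobi_def)
  have "jacobi g (Suc n) = - (slope g (Suc n) - right_deriv g g1 (Suc n)) + (slope g n - g1 (x (Suc n)))"
    by (simp add: jacobi_def right_deriv_def)
  then have "cmod (jacobi g (Suc n)) \<le> cmod (slope g (Suc n) - right_deriv g g1 (Suc n)) + cmod (slope g n - g1 (x (Suc n)))"
    by (metis norm_triangle_ineq norm_minus_cancel)
  then show "cmod (jacobi g (Suc n)) \<le> variation g2 (Suc n) + 2 * variation g2 n"
    using slope_bound(1)[OF g, of "Suc n"] slope_bound(2)[OF g, of n] by linarith
qed

text \<open>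
  The kernel \<open>\<kappa>\<close> of degree one reproduces the left end value of affine functions on the
  gap. Applied to \<open>g\<close>, which is affine up to \<open>d\<close> times the variation of its derivative, it bounds
  the node value by integrals.
\<close>

lemma node_value_bound:
  assumes g: "sol g g1 g2" and sq: "g sq_integrable_on {0<..}" "g2 sq_integrable_on {0<..}"
  shows "gap n * (cmod (g (x n)))\<^sup>2 \<le> 32 * mass g n + 32 * mass g2 n"
proof -
  define d where "d = gap n"
  have d: "0 < d" "d \<le> 1" by (simp_all add: d_def)
  have xS: "x (Suc n) = x n + d" by (simp add: d_def gap_def)
  define \<kappa> where "\<kappa> = (\<lambda>t. (4 - 6 * (t - x n) / d) / d)"
  define E where "E = (\<lambda>t. g t - g (x n) - of_real (t - x n) * right_deriv g g1 n)"
  let ?I = "{x n..x n + d}"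
  have k1: "(\<kappa> has_integral 1) ?I"
  proof -
    have "((\<lambda>t. (4 * (t - x n) - 3 * (t - x n)\<^sup>2 / d) / d) has_real_derivative \<kappa> t) (at t within ?I)" for t
      unfolding \<kappa>_def using d by (auto intro!: derivative_eq_intros simp: field_simps)
    then have "(\<kappa> has_integral ((4 * (x n + d - x n) - 3 * (x n + d - x n)\<^sup>2 / d) / d
        - (4 * (x n - x n) - 3 * (x n - x n)\<^sup>2 / d) / d)) ?I"
      using d by (intro fundamental_theorem_of_calculus) (auto simp: has_real_derivative_iff_has_vector_derivative)
    then show ?thesis using d by (simp add: power2_eq_square)
  qed
  have k2: "((\<lambda>t. \<kappa> t * (t - x n)) has_integral 0) ?I"
  proof -
    have "((\<lambda>t. (2 * (t - x n)\<^sup>2 - 2 * (t - x n)^3 / d) / d) has_real_derivative \<kappa> t * (t - x n)) (at t within ?I)" for t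
      unfolding \<kappa>_def using d by (auto intro!: derivative_eq_intros simp: field_simps power2_eq_square)
    then have "((\<lambda>t. \<kappa> t * (t - x n)) has_integral ((2 * (x n + d - x n)\<^sup>2 - 2 * (x n + d - x n)^3 / d) / d
        - (2 * (x n - x n)\<^sup>2 - 2 * (x n - x n)^3 / d) / d)) ?I"
      using d by (intro fundamental_theorem_of_calculus) (auto simp: has_real_derivative_iff_has_vector_derivative)
    then show ?thesis using d by (simp add: power2_eq_square power3_eq_cube)
  qed
  have kc: "\<bar>\<kappa> t\<bar> \<le> 4 / d" if "t \<in> ?I" for t
  proof -
    have "0 \<le> (t - x n) / d" "(t - x n) / d \<le> 1" using that d by auto
    then have "\<bar>4 - 6 * ((t - x n) / d)\<bar> \<le> 4" by linarith
    then have "\<bar>4 - 6 * (t - x n) / d\<bar> \<le> 4" by (simp only: times_divide_eq_right)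
    then show ?thesis using d by (simp add: \<kappa>_def abs_divide divide_right_mono)
  qed
  have h1: "((\<lambda>t. complex_of_real (\<kappa> t) * g (x n) + complex_of_real (\<kappa> t * (t - x n)) * right_deriv g g1 n)
     has_integral (of_real 1 * g (x n) + of_real 0 * right_deriv g g1 n)) ?I"
    by (intro has_integral_add has_integral_mult_left has_integral_of_real k1 k2)
  have gi: "g absolutely_integrable_on ?I" "(\<lambda>t. (cmod (g t))\<^sup>2) integrable_on ?I"
    using sq_integrable_imp_absint[OF sq(1) x_ge0] by auto
  define v where "v = variation g2 n"
  have v0: "v \<ge> 0" unfolding v_def by (rule variation_nonneg[OF solD(1)[OF g]])
  have Eb: "cmod (E t) \<le> d * v" if "t \<in> ?I" for t
  proof -
    have "cmod (E t) \<le> (t - x n) * v" unfolding E_def v_def using that xS by (intro sol_taylor(1)[OF g]) auto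
    also have "\<dots> \<le> d * v" using that v0 by (intro mult_right_mono) auto
    finally show ?thesis .
  qed
  have I: "((\<lambda>t. (4/d) * cmod (g t) + (4/d) * (d * v)) has_integral ((4/d) * variation g n + 4 * d * v)) ?I"
  proof (rule has_integral_add)
    show "((\<lambda>t. (4/d) * cmod (g t)) has_integral (4/d) * variation g n) ?I"
      unfolding variation_def xS by (rule has_integral_mult_right[OF integrable_integral[OF absint_norm[OF gi(1)]]])
    show "((\<lambda>t. (4/d) * (d * v)) has_integral 4 * d * v) ?I"
      using has_integral_const_real[of "(4/d) * (d * v)" "x n" "x n + d"] d(1) by (simp add: mult.assoc mult.left_commute[of d])
  qed
  have "cmod (g (x n)) \<le> integral ?I (\<lambda>t. (4/d) * cmod (g t) + (4/d) * (d * v))"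
  proof -
    have eq: "integral ?I (\<lambda>t. complex_of_real (\<kappa> t) * g (x n) + complex_of_real (\<kappa> t * (t - x n)) * right_deriv g g1 n) = g (x n)"
      using h1 by (simp add: integral_unique)
    have "cmod (integral ?I (\<lambda>t. complex_of_real (\<kappa> t) * g (x n) + complex_of_real (\<kappa> t * (t - x n)) * right_deriv g g1 n))
       \<le> integral ?I (\<lambda>t. (4/d) * cmod (g t) + (4/d) * (d * v))"
    proof (rule integral_norm_bound_integral)
      show "(\<lambda>t. 4 / d * cmod (g t) + 4 / d * (d * v)) integrable_on ?I"
        by (intro integrable_add integrable_on_mult_right absint_norm gi integrable_const_ivl)
      fix t assume t: "t \<in> ?I"
      have "complex_of_real (\<kappa> t) * g (x n) + complex_of_real (\<kappa> t * (t - x n)) * right_deriv g g1 n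
        = of_real (\<kappa> t) * (g t - E t)" by (simp add: E_def algebra_simps)
      then have "cmod (complex_of_real (\<kappa> t) * g (x n) + complex_of_real (\<kappa> t * (t - x n)) * right_deriv g g1 n)
        = \<bar>\<kappa> t\<bar> * cmod (g t - E t)" by (simp add: norm_mult)
      also have "\<dots> \<le> (4/d) * (cmod (g t) + d * v)"
        using Eb[OF t] norm_triangle_ineq4[of "g t" "E t"] d by (intro mult_mono kc[OF t]) auto
      finally show "cmod (complex_of_real (\<kappa> t) * g (x n) + complex_of_real (\<kappa> t * (t - x n)) * right_deriv g g1 n)
        \<le> 4 / d * cmod (g t) + 4 / d * (d * v)" by (simp only: distrib_left)
    qed (use h1 in auto)
    then show ?thesis by (simp only: eq)
  qed
  then have le: "cmod (g (x n)) \<le> (4/d) * variation g n + 4 * d * v"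
    by (simp only: integral_unique[OF I])
  have "d * (cmod (g (x n)))\<^sup>2 \<le> d * (2 * ((4/d) * variation g n)\<^sup>2 + 2 * (4 * d * v)\<^sup>2)"
  proof (rule mult_left_mono)
    have "(cmod (g (x n)))\<^sup>2 \<le> ((4/d) * variation g n + 4 * d * v)\<^sup>2" using le by (intro power_mono) auto
    also have "\<dots> \<le> 2 * ((4/d) * variation g n)\<^sup>2 + 2 * (4 * d * v)\<^sup>2"
      using zero_le_power2[of "(4/d) * variation g n - 4 * d * v"] by (simp add: power2_diff power2_sum)
    finally show "(cmod (g (x n)))\<^sup>2 \<le> 2 * ((4/d) * variation g n)\<^sup>2 + 2 * (4 * d * v)\<^sup>2" .
  qed (use d in simp)
  also have "\<dots> = 32 * ((variation g n)\<^sup>2 / d) + 32 * (d ^ 3 * v\<^sup>2)"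
    using d by (simp add: power2_eq_square power3_eq_cube field_simps)
  also have "\<dots> \<le> 32 * mass g n + 32 * mass g2 n"
  proof (intro add_mono mult_left_mono)
    show "(variation g n)\<^sup>2 / d \<le> mass g n"
      using mass_bounds(3)[OF sq(1), of n] d by (simp add: d_def[symmetric] pos_divide_le_eq mult.commute)
    have "v\<^sup>2 \<le> 1 * mass g2 n"
      using mass_bounds(3)[OF sq(2), of n] mult_right_mono[of d 1 "mass g2 n"] d mass_bounds(1)[OF sq(2), of n]
      unfolding v_def d_def[symmetric] by linarith
    moreover have "d ^ 3 * v\<^sup>2 \<le> 1 * v\<^sup>2" using d by (intro mult_right_mono power_le_one) auto
    ultimately show "d ^ 3 * v\<^sup>2 \<le> mass g2 n" by simp
  qed auto
  finally show ?thesis by (simp add: d_def)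
qed

end

section \<open>The boundary form at infinity\<close>

context graded_nodes
begin

lemma gap_Suc: "gap n \<le> 2 * gap (Suc n)" using gap_ratio[of n] by (simp add: gap_def)

lemma summable_jacobi:
  assumes g: "sol g g1 g2" and sq: "g2 sq_integrable_on {0<..}"
  shows "summable (\<lambda>n. (cmod (jacobi g n))\<^sup>2 / gap n)"
proof -
  have "summable (\<lambda>n. (cmod (jacobi g (Suc n)))\<^sup>2 / gap (Suc n))"
  proof (rule summable_comparison_test')
    show "summable (\<lambda>n. 2 * mass g2 (Suc n) + 16 * mass g2 n)"
      by (intro summable_add summable_mult mass_bounds(2)[OF sq] summable_ignore_initial_segment[of _ 1, simplified])
    fix n
    let ?a = "variation g2 (Suc n)" and ?b = "variation g2 n"
    have "(cmod (jacobi g (Suc n)))\<^sup>2 \<le> (?a + 2 * ?b)\<^sup>2"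
      by (rule power_mono[OF jacobi_bound(2)[OF g]]) simp
    also have "\<dots> \<le> 2 * ?a\<^sup>2 + 8 * ?b\<^sup>2"
      using zero_le_power2[of "?a - 2 * ?b"] by (simp add: power2_diff power2_sum)
    also have "\<dots> \<le> 2 * (gap (Suc n) * mass g2 (Suc n)) + 8 * (gap n * mass g2 n)"
      using mass_bounds(3)[OF sq, of n] mass_bounds(3)[OF sq, of "Suc n"] by linarith
    also have "8 * (gap n * mass g2 n) \<le> 8 * ((2 * gap (Suc n)) * mass g2 n)"
      using gap_Suc mass_bounds(1)[OF sq] by (intro mult_left_mono mult_right_mono) auto
    finally have "(cmod (jacobi g (Suc n)))\<^sup>2 \<le> (2 * mass g2 (Suc n) + 16 * mass g2 n) * gap (Suc n)"
      by (simp add: algebra_simps)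
    then show "norm ((cmod (jacobi g (Suc n)))\<^sup>2 / gap (Suc n)) \<le> 2 * mass g2 (Suc n) + 16 * mass g2 n"
      using gap_pos[of "Suc n"] by (simp add: pos_divide_le_eq less_imp_le)
  qed
  then show ?thesis by (simp only: summable_Suc_iff[of "\<lambda>n. (cmod (jacobi g n))\<^sup>2 / gap n"])
qed

lemma summable_node_values:
  assumes g: "sol g g1 g2" and sq: "g sq_integrable_on {0<..}" "g2 sq_integrable_on {0<..}"
  shows "summable (\<lambda>n. gap n * (cmod (g (x n)))\<^sup>2)"
proof (rule summable_comparison_test')
  show "summable (\<lambda>n. 32 * mass g n + 32 * mass g2 n)"
    by (intro summable_add summable_mult mass_bounds(2) sq)
  show "norm (gap n * (cmod (g (x n)))\<^sup>2) \<le> 32 * mass g n + 32 * mass g2 n" for n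
    using node_value_bound[OF g sq, of n] by (simp add: abs_mult less_imp_le)
qed

lemma summable_square_part:
  assumes "summable (\<lambda>n. (cmod (h n))\<^sup>2 * c n)" "\<And>n. c n \<ge> 0" "\<And>z. \<bar>p z\<bar> \<le> cmod z"
  shows "summable (\<lambda>n. (p (h n))\<^sup>2 * c n)"
proof (rule summable_comparison_test'[OF assms(1)])
  fix n
  have "(p (h n))\<^sup>2 \<le> (cmod (h n))\<^sup>2" using assms(3)[of "h n"] by (simp add: abs_le_square_iff[symmetric])
  then show "norm ((p (h n))\<^sup>2 * c n) \<le> (cmod (h n))\<^sup>2 * c n"
    using assms(2)[of n] by (simp add: mult_right_mono)
qed

text \<open>
  Both hypotheses are covered at once by passing to \<open>\<sigma>\<^sup>n y\<^sub>n\<close>. For \<open>\<sigma> = -1\<close> the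
  potential \<open>\<beta>\<close> at the origin is \<open>- 2/gap 0\<close>, which the constant \<open>C + 2/(gap 0)\<^sup>2\<close> accounts for.
  Real and imaginary part of a solution satisfy the same Jacobi equation, since it has real
  coefficients.
\<close>

lemma summable_differences_part:
  fixes p :: "complex \<Rightarrow> real"
  assumes g: "sol g g1 g2" and sq: "g sq_integrable_on {0<..}" "g2 sq_integrable_on {0<..}"
    and p: "p = Re \<or> p = Im"
    and alt: "(\<sigma> = 1 \<and> (\<forall>n. \<alpha> (Suc n) \<ge> - C * gap (Suc n))) \<or>
      (\<sigma> = -1 \<and> (\<forall>n. \<alpha> (Suc n) \<le> - 2 * (1 / gap (Suc n) + 1 / gap n) + C * gap (Suc n)))" and C: "C \<ge> 0"
  shows "summable (\<lambda>n. (p (g (x (Suc n))) - \<sigma> * p (g (x n)))\<^sup>2 / gap n)"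
proof -
  have pa: "p (a + b) = p a + p b" "p (a - b) = p a - p b" "p (- a) = - p a" "p (of_real s * a) = s * p a" "p (a / of_real s) = p a / s"
    "\<bar>p a\<bar> \<le> cmod a" for a b s
    using p by (auto simp: abs_Re_le_cmod abs_Im_le_cmod)
  have s1: "\<sigma> * \<sigma> = 1" "\<bar>\<sigma>\<bar> = 1" using alt by auto
  then have sp: "\<sigma> ^ n * \<sigma> ^ n = 1" for n by (simp flip: power_mult_distrib)
  define y where "y = (\<lambda>n. \<sigma> ^ n * p (g (x n)))"
  define r where "r = (\<lambda>n. \<sigma> * \<sigma> ^ n * p (jacobi g n))"
  define \<beta> where "\<beta> = (\<lambda>n. if \<sigma> = 1 then (if n = 0 then 0 else \<alpha> n) else
     (if n = 0 then - 2 / gap 0 else - \<alpha> n - 2 * (1 / gap n + 1 / gap (n - 1))))"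
  have y2: "(y n)\<^sup>2 = (p (g (x n)))\<^sup>2" and r2: "(r n)\<^sup>2 = (p (jacobi g n))\<^sup>2" for n
    using sp[of n] s1(1) by (simp_all add: y_def r_def power_mult_distrib power2_eq_square[of "\<sigma> ^ n"] power2_eq_square[of \<sigma>])
  have "summable (\<lambda>n. (y (Suc n) - y n)\<^sup>2 / gap n)"
  proof (rule Dirichlet_sum_finite[where r = r and \<beta> = \<beta> and C = "C + 2 / (gap 0)\<^sup>2"])
    show "summable (\<lambda>n. gap n * (y n)\<^sup>2)"
      using summable_square_part[of "\<lambda>n. g (x n)" gap p] summable_node_values[OF g sq] pa(6)
      unfolding y2 by (simp add: mult.commute less_imp_le)
    show "summable (\<lambda>n. (r n)\<^sup>2 / gap n)"
      using summable_square_part[of "jacobi g" "\<lambda>n. 1 / gap n" p] summable_jacobi[OF g sq(2)] pa(6)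
      unfolding r2 by (simp add: less_imp_le)
    show "0 \<le> C + 2 / (gap 0)\<^sup>2" using C by simp
    have cg: "0 \<le> C * gap n" "0 \<le> 2 / (gap 0)\<^sup>2 * gap n" for n
      using C gap_pos[of n] by (auto simp del: gap_pos)
    show "- (C + 2 / (gap 0)\<^sup>2) * gap n \<le> \<beta> n" for n
    proof (cases n)
      case 0
      have "- (2 / (gap 0)\<^sup>2) * gap 0 = - 2 / gap 0" by (simp add: power2_eq_square)
      moreover have "0 \<le> 2 / gap 0" using gap_pos[of 0] by (simp del: gap_pos)
      ultimately have "- (C + 2 / (gap 0)\<^sup>2) * gap 0 \<le> - 2 / gap 0" "- (C + 2 / (gap 0)\<^sup>2) * gap 0 \<le> 0"
        using cg(1)[of 0] by (simp_all only: minus_add_distrib distrib_right)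
      then show ?thesis using 0 by (simp add: \<beta>_def)
    next
      case (Suc m)
      have "- C * gap n \<le> \<beta> n" using alt Suc by (auto simp: \<beta>_def algebra_simps)
      moreover have "- (C + 2 / (gap 0)\<^sup>2) * gap n = - C * gap n - 2 / (gap 0)\<^sup>2 * gap n"
        by (simp only: left_diff_distrib[symmetric] minus_add_distrib add_uminus_conv_diff)
      ultimately show ?thesis using cg(2)[of n] by linarith
    qed
    show "r 0 = - ((y (Suc 0) - y 0) / gap 0) + \<beta> 0 * y 0"
    proof -
      have j: "p (jacobi g 0) = - ((p (g (x (Suc 0))) - p (g (x 0))) / gap 0)"
        by (simp add: jacobi_def slope_def pa)
      have "\<sigma> = 1 \<or> \<sigma> = -1" using alt by blast
      then show ?thesis
        by (elim disjE) (simp_all add: r_def y_def \<beta>_def j diff_divide_distrib add_divide_distrib)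
    qed
    show "r (Suc n) = - ((y (Suc (Suc n)) - y (Suc n)) / gap (Suc n) - (y (Suc n) - y n) / gap n) + \<beta> (Suc n) * y (Suc n)" for n
    proof -
      have j: "p (jacobi g (Suc n)) = - ((p (g (x (Suc (Suc n)))) - p (g (x (Suc n)))) / gap (Suc n)
          - (p (g (x (Suc n))) - p (g (x n))) / gap n) + \<alpha> (Suc n) * p (g (x (Suc n)))"
        by (simp add: jacobi_def slope_def pa)
      from alt show ?thesis
      proof
        assume "\<sigma> = 1 \<and> (\<forall>n. \<alpha> (Suc n) \<ge> - C * gap (Suc n))"
        then show ?thesis by (simp add: r_def y_def \<beta>_def j)
      next
        assume "\<sigma> = -1 \<and> (\<forall>n. \<alpha> (Suc n) \<le> - 2 * (1 / gap (Suc n) + 1 / gap n) + C * gap (Suc n))"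
        then have "\<sigma> = -1" by simp
        then show ?thesis
          by (simp add: r_def y_def \<beta>_def j diff_divide_distrib add_divide_distrib algebra_simps)
      qed
    qed
  qed (use not_summable_gap in auto)
  moreover have "(y (Suc n) - y n)\<^sup>2 = (p (g (x (Suc n))) - \<sigma> * p (g (x n)))\<^sup>2" for n
  proof -
    have "y (Suc n) - y n = \<sigma> * \<sigma> ^ n * (p (g (x (Suc n))) - \<sigma> * p (g (x n)))"
    proof -
      have "\<sigma> * \<sigma> ^ n * (p (g (x (Suc n))) - \<sigma> * p (g (x n))) = \<sigma> * \<sigma> ^ n * p (g (x (Suc n))) - (\<sigma> * \<sigma>) * (\<sigma> ^ n * p (g (x n)))"
        by (simp add: algebra_simps)
      then show ?thesis unfolding s1(1) by (simp add: y_def)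
    qed
    then show ?thesis using sp[of n] s1(1)
      by (simp add: power_mult_distrib power2_eq_square[of "\<sigma> ^ n"] power2_eq_square[of \<sigma>])
  qed
  ultimately show ?thesis by simp
qed

lemma summable_differences:
  assumes g: "sol g g1 g2" and sq: "g sq_integrable_on {0<..}" "g2 sq_integrable_on {0<..}"
    and alt: "(\<sigma> = 1 \<and> (\<forall>n. \<alpha> (Suc n) \<ge> - C * gap (Suc n))) \<or>
      (\<sigma> = -1 \<and> (\<forall>n. \<alpha> (Suc n) \<le> - 2 * (1 / gap (Suc n) + 1 / gap n) + C * gap (Suc n)))" and C: "C \<ge> 0"
  shows "summable (\<lambda>n. (cmod (g (x (Suc n)) - of_real \<sigma> * g (x n)))\<^sup>2 / gap n)"
proof -
  have "summable (\<lambda>n. (Re (g (x (Suc n))) - \<sigma> * Re (g (x n)))\<^sup>2 / gap n + (Im (g (x (Suc n))) - \<sigma> * Im (g (x n)))\<^sup>2 / gap n)"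
    by (intro summable_add summable_differences_part[OF g sq _ alt C]) auto
  then show ?thesis by (simp add: cmod_power2 add_divide_distrib)
qed

lemma boundary_form_eq:
  assumes g: "sol g g1 g2" and v: "sol v v1 v2"
  shows "integral {0..x n} (\<lambda>t. g2 t * v t) - integral {0..x n} (\<lambda>t. g t * v2 t)
    = right_deriv g g1 n * v (x n) - g (x n) * right_deriv v v1 n"
  using green[OF g v x_ge0[of n]] solD(6)[OF g] solD(6)[OF v] by (simp add: right_deriv_def algebra_simps)

text \<open>
  In \<open>y\<^sub>n\<^sub>+\<^sub>1 v\<^sub>n - y\<^sub>n v\<^sub>n\<^sub>+\<^sub>1 = (y\<^sub>n\<^sub>+\<^sub>1 - \<sigma> y\<^sub>n) v\<^sub>n - y\<^sub>n (v\<^sub>n\<^sub>+\<^sub>1 - \<sigma> v\<^sub>n)\<close> each product is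
  a small difference times a weighted square-summable value. Up to similar terms the left-hand
  side is \<open>gap n\<close> times the Wronskian, whose sum therefore converges, although the sum of the gaps
  does not.
\<close>

lemma self_adjoint_if_summable_differences:
  fixes \<sigma> :: real
  assumes diff: "\<And>g g1 g2. sol g g1 g2 \<Longrightarrow> g sq_integrable_on {0<..} \<Longrightarrow> g2 sq_integrable_on {0<..} \<Longrightarrow>
     summable (\<lambda>n. (cmod (g (x (Suc n)) - of_real \<sigma> * g (x n)))\<^sup>2 / gap n)"
  shows "self_adjoint (hamiltonian x \<alpha>)"
proof (rule self_adjoint_if_boundary_form_vanishes)
  fix g g1 g2 v' v1' v2'
  assume g: "sol g g1 g2" "g sq_integrable_on {0<..}" "g2 sq_integrable_on {0<..}"
    and v': "sol v' v1' v2'" "v' sq_integrable_on {0<..}" "v2' sq_integrable_on {0<..}"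
  define v where "v = (\<lambda>t. cnj (v' t))"
  define v1 where "v1 = (\<lambda>t. cnj (v1' t))"
  define v2 where "v2 = (\<lambda>t. cnj (v2' t))"
  have v: "sol v v1 v2" "v sq_integrable_on {0<..}" "v2 sq_integrable_on {0<..}"
    unfolding v_def v1_def v2_def by (rule sol_cnj[OF v'(1)], rule sq_integrable_cnj[OF v'(2)], rule sq_integrable_cnj[OF v'(3)])
  define W where "W = (\<lambda>n. right_deriv g g1 n * v (x n) - g (x n) * right_deriv v v1 n)"
  define L where "L = (LINT t|lebesgue_on {0<..}. g2 t * cnj (v' t)) - (LINT t|lebesgue_on {0<..}. g t * cnj (v2' t))"
  have "(\<lambda>n. integral {0..x n} (\<lambda>t. g2 t * v t) - integral {0..x n} (\<lambda>t. g t * v2 t)) \<longlonglongrightarrow> L"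
    unfolding L_def v_def v2_def
    by (intro tendsto_diff half_line_integral_limit sq_integrable_mult_cnj g v' lim)
  then have WL: "W \<longlonglongrightarrow> L" unfolding boundary_form_eq[OF g(1) v(1)] W_def .
  define s where "s = (\<lambda>h n. (cmod (h (x (Suc n)) - of_real \<sigma> * h (x n)))\<^sup>2 / gap n)"
  define b where "b = (\<lambda>h n. gap n * (cmod (h (x n)))\<^sup>2)"
  have bound: "gap n * cmod (W n) \<le> (s g n + s v n) + (mass g2 n + mass v2 n) + (b g n + b v n)" for n
  proof -
    have d: "0 < gap n" "gap n \<le> 1" by simp_all
    have eq: "gap n * W n = ((g (x (Suc n)) - of_real \<sigma> * g (x n)) * v (x n) - g (x n) * (v (x (Suc n)) - of_real \<sigma> * v (x n)))
       - gap n * ((slope g n - right_deriv g g1 n) * v (x n) - g (x n) * (slope v n - right_deriv v v1 n))"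
    proof -
      have gs: "of_real (gap n) * slope h n = h (x (Suc n)) - h (x n)" for h
        using d by (simp add: slope_def)
      have "gap n * ((slope g n - right_deriv g g1 n) * v (x n) - g (x n) * (slope v n - right_deriv v v1 n))
        = (gap n * slope g n) * v (x n) - g (x n) * (gap n * slope v n) - gap n * W n"
        by (simp add: W_def algebra_simps)
      then show ?thesis unfolding gs by (simp add: algebra_simps)
    qed
    have ab: "p * q \<le> p\<^sup>2 / gap n / 2 + gap n * q\<^sup>2 / 2" for p q
    proof -
      have "0 \<le> (p - gap n * q)\<^sup>2 / gap n" using d by simp
      also have "\<dots> = p\<^sup>2 / gap n + gap n * q\<^sup>2 - 2 * (p * q)"
        using d by (simp add: divide_simps) (simp add: algebra_simps power2_eq_square)
      finally show ?thesis by simp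
    qed
    have e1: "cmod ((h (x (Suc n)) - of_real \<sigma> * h (x n)) * k (x n)) \<le> s h n / 2 + b k n / 2" for h k
      unfolding norm_mult s_def b_def by (rule ab)
    have e2: "gap n * cmod ((slope h n - right_deriv h h1 n) * k (x n)) \<le> mass h2 n / 2 + b k n / 2"
      if h: "sol h h1 h2" "h2 sq_integrable_on {0<..}" for h h1 h2 k
    proof -
      have "cmod ((slope h n - right_deriv h h1 n) * k (x n)) \<le> variation h2 n * cmod (k (x n))"
        unfolding norm_mult by (intro mult_right_mono slope_bound(1)[OF h(1)]) simp
      then have "gap n * cmod ((slope h n - right_deriv h h1 n) * k (x n)) \<le> gap n * (variation h2 n * cmod (k (x n)))"
        using d by (intro mult_left_mono) auto
      also have "\<dots> = (gap n * variation h2 n) * cmod (k (x n))" by simp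
      also have "\<dots> \<le> (gap n * variation h2 n)\<^sup>2 / gap n / 2 + gap n * (cmod (k (x n)))\<^sup>2 / 2" by (rule ab)
      also have "(gap n * variation h2 n)\<^sup>2 / gap n = gap n * (variation h2 n)\<^sup>2"
        using d by (simp add: power2_eq_square)
      also have "gap n * (variation h2 n)\<^sup>2 \<le> 1 * (1 * mass h2 n)"
        using mass_bounds(1,3)[OF h(2), of n] d
        by (intro mult_mono order_trans[OF mass_bounds(3)[OF h(2)] mult_right_mono]) auto
      finally show ?thesis by (simp add: b_def)
    qed
    have "gap n * cmod (W n) = cmod (gap n * W n)" using d by (simp add: norm_mult)
    also have "\<dots> \<le> (cmod ((g (x (Suc n)) - of_real \<sigma> * g (x n)) * v (x n)) + cmod (g (x n) * (v (x (Suc n)) - of_real \<sigma> * v (x n))))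
       + gap n * (cmod ((slope g n - right_deriv g g1 n) * v (x n)) + cmod (g (x n) * (slope v n - right_deriv v v1 n)))"
    proof -
      have "cmod (gap n * Z) \<le> gap n * (cmod A + cmod B)" if "Z = A - B" for Z A B :: complex
        using d that norm_triangle_ineq4[of A B] by (simp add: norm_mult)
      then show ?thesis unfolding eq
        by (intro order_trans[OF norm_triangle_ineq4] add_mono norm_triangle_ineq4) simp
    qed
    also have "\<dots> \<le> (s g n + s v n) + (mass g2 n + mass v2 n) + (b g n + b v n)"
    proof -
      have nn: "0 \<le> s g n" "0 \<le> s v n" using d by (auto simp: s_def)
      have mm: "0 \<le> mass g2 n" "0 \<le> mass v2 n" using mass_bounds(1) g v by auto
      show ?thesis
        using e1[of g v] e1[of v g] e2[OF g(1,3), of v] e2[OF v(1,3), of g] nn mm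
        by (simp add: mult.commute[of "g (x n)"] distrib_left)
    qed
    finally show ?thesis .
  qed
  have sumW: "summable (\<lambda>n. gap n * cmod (W n))"
  proof (rule summable_comparison_test')
    show "summable (\<lambda>n. (s g n + s v n) + (mass g2 n + mass v2 n) + (b g n + b v n))"
      unfolding s_def b_def
      by (intro summable_add diff[OF g] diff[OF v] mass_bounds(2) g v summable_node_values[OF g] summable_node_values[OF v])
    show "norm (gap n * cmod (W n)) \<le> (s g n + s v n) + (mass g2 n + mass v2 n) + (b g n + b v n)" for n
      using bound[of n] by (simp add: abs_mult less_imp_le)
  qed
  have "L = 0"
  proof (rule ccontr)
    assume L: "L \<noteq> 0"
    have "(\<lambda>n. cmod (W n)) \<longlonglongrightarrow> cmod L" using WL by (rule tendsto_norm)
    then have "eventually (\<lambda>n. cmod L / 2 < cmod (W n)) sequentially"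
      using L by (intro order_tendstoD) auto
    then obtain N where N: "\<And>n. n \<ge> N \<Longrightarrow> cmod L / 2 < cmod (W n)" by (auto simp: eventually_sequentially)
    have "summable gap"
    proof (rule summable_comparison_test'[of "\<lambda>n. gap n * cmod (W n) * (2 / cmod L)" N])
      show "summable (\<lambda>n. gap n * cmod (W n) * (2 / cmod L))" by (intro summable_mult2 sumW)
      show "norm (gap n) \<le> gap n * cmod (W n) * (2 / cmod L)" if "n \<ge> N" for n
      proof -
        have "1 \<le> cmod (W n) * (2 / cmod L)" using N[OF that] L by (simp add: field_simps)
        then have "gap n * 1 \<le> gap n * (cmod (W n) * (2 / cmod L))" by (intro mult_left_mono) (auto intro: less_imp_le)
        then show ?thesis using gap_pos[of n] by (simp add: mult.assoc del: gap_pos)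
      qed
    qed
    then show False using not_summable_gap by contradiction
  qed
  then show "(LINT t|lebesgue_on {0<..}. g2 t * cnj (v' t)) = (LINT t|lebesgue_on {0<..}. g t * cnj (v2' t))"
    by (simp add: L_def)
qed

lemma self_adjoint_if_bounded_below_up_to_signs:
  fixes \<sigma> :: real
  assumes "(\<sigma> = 1 \<and> (\<forall>n. \<alpha> (Suc n) \<ge> - C * gap (Suc n))) \<or>
      (\<sigma> = -1 \<and> (\<forall>n. \<alpha> (Suc n) \<le> - 2 * (1 / gap (Suc n) + 1 / gap n) + C * gap (Suc n)))" "C \<ge> 0"
  shows "self_adjoint (hamiltonian x \<alpha>)"
  by (rule self_adjoint_if_summable_differences[of \<sigma>]) (rule summable_differences[OF _ _ _ assms])

text \<open>
  On a short gap \<open>\<phi>\<close> is the affine interpolant of its end values up to \<open>2 gap\<^sup>2\<close> times its own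
  maximum, which is absorbed on the left.
\<close>

lemma eigen_sol_bounds:
  assumes phi: "sol \<phi> \<phi>1 (\<lambda>t. - z * \<phi> t)" and z: "cmod z = 1" and w: "gap n \<le> 1/2"
  shows "\<And>t. x n \<le> t \<Longrightarrow> t \<le> x (Suc n) \<Longrightarrow> cmod (\<phi> t) \<le> 2 * (cmod (\<phi> (x n)) + cmod (\<phi> (x (Suc n))))"
    "variation (\<lambda>t. - z * \<phi> t) n \<le> 2 * gap n * (cmod (\<phi> (x n)) + cmod (\<phi> (x (Suc n))))"
proof -
  let ?I = "{x n..x (Suc n)}"
  have c: "continuous_on ?I \<phi>" by (rule continuous_on_subset[OF sol_continuous[OF phi, of "x (Suc n)"]]) auto
  have d: "0 < gap n" "gap n = x (Suc n) - x n" by (simp_all add: gap_def)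
  have "compact ?I" "?I \<noteq> {}" by simp_all
  from continuous_attains_sup[OF this continuous_on_norm[OF c]]
  obtain m where m: "m \<in> ?I" "\<And>t. t \<in> ?I \<Longrightarrow> cmod (\<phi> t) \<le> cmod (\<phi> m)" by blast
  define M where "M = cmod (\<phi> m)"
  define q where "q = variation (\<lambda>t. - z * \<phi> t) n"
  have q: "q \<le> gap n * M"
  proof -
    have "q \<le> integral ?I (\<lambda>_. M)"
      unfolding q_def variation_def
      by (rule integral_le) (use m z in \<open>auto intro!: integrable_continuous_real continuous_intros c simp: norm_mult M_def\<close>)
    then show ?thesis using d by simp
  qed
  have q0: "q \<ge> 0" unfolding q_def by (rule variation_nonneg[OF solD(1)[OF phi]])
  define \<tau> where "\<tau> = (m - x n) / gap n"
  have tau: "0 \<le> \<tau>" "\<tau> \<le> 1" "m - x n = \<tau> * gap n" using m(1) d by (auto simp: \<tau>_def)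
  have "\<phi> m = (1 - of_real \<tau>) * \<phi> (x n) + of_real \<tau> * \<phi> (x (Suc n))
     + (\<phi> m - \<phi> (x n) - of_real (m - x n) * right_deriv \<phi> \<phi>1 n)
     - of_real (m - x n) * (slope \<phi> n - right_deriv \<phi> \<phi>1 n)"
    using d(1) unfolding tau(3) slope_def by (simp add: field_simps)
  then have "M \<le> cmod ((1 - of_real \<tau>) * \<phi> (x n)) + cmod (of_real \<tau> * \<phi> (x (Suc n)))
     + cmod (\<phi> m - \<phi> (x n) - of_real (m - x n) * right_deriv \<phi> \<phi>1 n)
     + cmod (of_real (m - x n) * (slope \<phi> n - right_deriv \<phi> \<phi>1 n))"
  proof -
    have tri: "cmod (a + b + c - d) \<le> cmod a + cmod b + cmod c + cmod d" for a b c d :: complex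
      using norm_triangle_ineq4[of "a + b + c" d] norm_triangle_ineq[of "a + b" c] norm_triangle_ineq[of a b] by linarith
    assume "\<phi> m = (1 - of_real \<tau>) * \<phi> (x n) + of_real \<tau> * \<phi> (x (Suc n))
       + (\<phi> m - \<phi> (x n) - of_real (m - x n) * right_deriv \<phi> \<phi>1 n)
       - of_real (m - x n) * (slope \<phi> n - right_deriv \<phi> \<phi>1 n)"
    then show ?thesis unfolding M_def by (rule ssubst[where P="\<lambda>w. cmod w \<le> _"]) (rule tri)
  qed
  also have "\<dots> \<le> 1 * cmod (\<phi> (x n)) + 1 * cmod (\<phi> (x (Suc n))) + gap n * q + gap n * q"
  proof (intro add_mono)
    have "cmod (1 - complex_of_real \<tau>) = \<bar>1 - \<tau>\<bar>" by (metis norm_of_real of_real_1 of_real_diff)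
    then show "cmod ((1 - of_real \<tau>) * \<phi> (x n)) \<le> 1 * cmod (\<phi> (x n))"
      using tau unfolding norm_mult by (intro mult_right_mono) auto
    show "cmod (of_real \<tau> * \<phi> (x (Suc n))) \<le> 1 * cmod (\<phi> (x (Suc n)))"
      using tau unfolding norm_mult by (intro mult_right_mono) auto
    have "cmod (\<phi> m - \<phi> (x n) - of_real (m - x n) * right_deriv \<phi> \<phi>1 n) \<le> (m - x n) * q"
      unfolding q_def using m(1) by (intro sol_taylor(1)[OF phi]) auto
    also have "\<dots> \<le> gap n * q" using m(1) d q0 by (intro mult_right_mono) auto
    finally show "cmod (\<phi> m - \<phi> (x n) - of_real (m - x n) * right_deriv \<phi> \<phi>1 n) \<le> gap n * q" .
    show "cmod (of_real (m - x n) * (slope \<phi> n - right_deriv \<phi> \<phi>1 n)) \<le> gap n * q"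
      using slope_bound(1)[OF phi, of n] m(1) d q0 unfolding norm_mult norm_of_real q_def[symmetric]
      by (intro mult_mono) auto
  qed
  also have "\<dots> \<le> cmod (\<phi> (x n)) + cmod (\<phi> (x (Suc n))) + M / 2"
  proof -
    have "gap n * q \<le> (1/2) * (1/2 * M)"
      using w d q q0 order_trans[OF q mult_right_mono[OF w, of M]] by (intro mult_mono) (auto simp: M_def)
    then show ?thesis by (simp add: mult.commute)
  qed
  finally have MM: "M \<le> 2 * (cmod (\<phi> (x n)) + cmod (\<phi> (x (Suc n))))" by simp
  show "cmod (\<phi> t) \<le> 2 * (cmod (\<phi> (x n)) + cmod (\<phi> (x (Suc n))))" if "x n \<le> t" "t \<le> x (Suc n)" for t
    using m(2)[of t] that MM by (simp add: M_def)
  have "gap n * M \<le> gap n * (2 * (cmod (\<phi> (x n)) + cmod (\<phi> (x (Suc n)))))"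
    using MM d by (intro mult_left_mono) auto
  then show "variation (\<lambda>t. - z * \<phi> t) n \<le> 2 * gap n * (cmod (\<phi> (x n)) + cmod (\<phi> (x (Suc n))))"
    using q unfolding q_def by (simp only: mult.assoc mult.left_commute[of 2])
qed

end

section \<open>The oscillatory regime and the theorem\<close>

context graded_nodes
begin

text \<open>
  The amplitude \<open>s\<close> is to be chosen such that the Jacobi equation for \<open>u = \<phi>(x\<^sub>n)/s\<^sub>n\<close> has
  off-diagonal entries near \<open>1\<close> and diagonal entries near \<open>2\<kappa>\<close>, with summable errors. The defect
  of \<open>\<phi>\<close> in the Jacobi equation is of order \<open>gap\<close> times the neighbouring values, since \<open>\<phi>'' = - z \<phi>\<close>.
\<close>

lemma eigen_sol_sq_integrable:
  fixes s :: "nat \<Rightarrow> real" and \<kappa> :: real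
  assumes phi: "sol \<phi> \<phi>1 (\<lambda>t. - z * \<phi> t)" and z: "cmod z = 1"
    and s: "\<And>n. s n > 0" "\<And>n. s (Suc n) \<le> s n" and \<kappa>: "\<kappa>\<^sup>2 < 1"
    and small: "eventually (\<lambda>n. gap n \<le> 1/2) sequentially"
    and B: "summable (\<lambda>n. \<bar>s n * s (Suc n) / gap n - 1\<bar>)"
    and Q: "summable (\<lambda>n. \<bar>(s (Suc n))\<^sup>2 * (1 / gap (Suc n) + 1 / gap n + \<alpha> (Suc n)) - 2 * \<kappa>\<bar>)"
    and S: "summable (\<lambda>n. (s n)\<^sup>2 * gap (Suc n))"
  shows "\<phi> sq_integrable_on {0<..}"
proof -
  define y where "y = (\<lambda>n. \<phi> (x n))"
  define u where "u = (\<lambda>n. y n / s n)"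
  have yu: "y n = s n * u n" and ynorm: "cmod (y n) = s n * cmod (u n)" for n
    using s(1)[of n] by (simp_all add: u_def norm_divide)
  define b where "b = (\<lambda>n. s n * s (Suc n) / gap n)"
  define q where "q = (\<lambda>n. (s (Suc n))\<^sup>2 * (1 / gap (Suc n) + 1 / gap n + \<alpha> (Suc n)))"
  define e where "e = (\<lambda>n. \<bar>b (Suc n) - 1\<bar> + \<bar>b n - 1\<bar> + \<bar>q n - 2 * \<kappa>\<bar> + 10 * ((s n)\<^sup>2 * gap (Suc n)))"
  have e0: "e n \<ge> 0" for n by (simp add: e_def)
  have "summable (\<lambda>n. \<bar>b n - 1\<bar>)" using B by (simp add: b_def)
  then have e: "summable e"
    unfolding e_def using Q S by (intro summable_add summable_mult) (simp_all add: q_def summable_Suc_iff[of "\<lambda>n. \<bar>b n - 1\<bar>"])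
  obtain N where N: "\<And>n. n \<ge> N \<Longrightarrow> gap n \<le> 1/2" using small by (auto simp: eventually_sequentially)
  have rec: "cmod (u (Suc (Suc n)) + u n - 2 * \<kappa> * u (Suc n))
      \<le> e n * (cmod (u n) + cmod (u (Suc n)) + cmod (u (Suc (Suc n))))" if n: "n \<ge> N" for n
  proof -
    define r where "r = jacobi \<phi> (Suc n)"
    define U where "U = cmod (u n) + cmod (u (Suc n)) + cmod (u (Suc (Suc n)))"
    have U: "cmod (u n) \<le> U" "cmod (u (Suc n)) \<le> U" "cmod (u (Suc (Suc n))) \<le> U" "0 \<le> U"
      by (auto simp: U_def)
    have r_eq: "r = - ((y (Suc (Suc n)) - y (Suc n)) / gap (Suc n) - (y (Suc n) - y n) / gap n) + \<alpha> (Suc n) * y (Suc n)"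
      by (simp add: r_def jacobi_def slope_def y_def)
    have "s (Suc n) * r = - ((s (Suc n) * s (Suc (Suc n)) / gap (Suc n)) * u (Suc (Suc n)))
        - (s n * s (Suc n) / gap n) * u n + ((s (Suc n))\<^sup>2 * (1 / gap (Suc n) + 1 / gap n + \<alpha> (Suc n))) * u (Suc n)"
      by (simp only: r_eq yu) (simp add: diff_divide_distrib add_divide_distrib algebra_simps power2_eq_square)
    then have sr: "s (Suc n) * r = - (b (Suc n) * u (Suc (Suc n))) - b n * u n + q n * u (Suc n)"
      by (simp add: b_def q_def)
    have id: "u (Suc (Suc n)) + u n - 2 * \<kappa> * u (Suc n) =
       - ((b (Suc n) - 1) * u (Suc (Suc n))) - (b n - 1) * u n + (q n - 2 * \<kappa>) * u (Suc n) - s (Suc n) * r"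
      unfolding sr by (simp add: algebra_simps)
    have tri: "cmod (- A - B' + C - D) \<le> cmod A + cmod B' + cmod C + cmod D" for A B' C D
      using norm_triangle_ineq4[of "- A - B' + C" D] norm_triangle_ineq[of "- A - B'" C] norm_triangle_ineq4[of "- A" B']
      by simp
    \<comment> \<open>The factor \<open>10 = 2 + 2 * 2 * 2\<close> arises because \<open>gap n\<close> may be twice \<open>gap (Suc n)\<close>.\<close>
    have "cmod r \<le> variation (\<lambda>t. - z * \<phi> t) (Suc n) + 2 * variation (\<lambda>t. - z * \<phi> t) n"
      unfolding r_def by (rule jacobi_bound(2)[OF phi])
    also have "\<dots> \<le> 2 * gap (Suc n) * (cmod (y (Suc n)) + cmod (y (Suc (Suc n)))) + 2 * (2 * gap n * (cmod (y n) + cmod (y (Suc n))))"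
      using eigen_sol_bounds(2)[OF phi z N[OF n]] eigen_sol_bounds(2)[OF phi z N[OF le_SucI[OF n]]]
      unfolding y_def by linarith
    also have "\<dots> \<le> 2 * gap (Suc n) * (s n * U) + 2 * (2 * (2 * gap (Suc n)) * (s n * U))"
    proof -
      have ss: "s (Suc n) \<le> s n" "s (Suc (Suc n)) \<le> s n" using s(2)[of n] s(2)[of "Suc n"] by auto
      have "cmod (y (Suc n)) + cmod (y (Suc (Suc n))) \<le> s n * cmod (u (Suc n)) + s n * cmod (u (Suc (Suc n)))"
        unfolding ynorm using ss by (intro add_mono mult_right_mono) auto
      also have "\<dots> \<le> s n * U" using s(1)[of n] by (simp add: U_def distrib_left)
      finally have 1: "cmod (y (Suc n)) + cmod (y (Suc (Suc n))) \<le> s n * U" .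
      have "cmod (y n) + cmod (y (Suc n)) \<le> s n * cmod (u n) + s n * cmod (u (Suc n))"
        unfolding ynorm using ss by (intro add_mono mult_right_mono) auto
      also have "\<dots> \<le> s n * U" using s(1)[of n] by (simp add: U_def distrib_left)
      finally have 2: "cmod (y n) + cmod (y (Suc n)) \<le> s n * U" .
      show ?thesis using 1 2 gap_Suc[of n] by (intro add_mono mult_mono mult_left_mono) auto
    qed
    finally have rb: "cmod r \<le> 10 * gap (Suc n) * (s n * U)" by (simp add: mult_ac)
    have "cmod (s (Suc n) * r) = s (Suc n) * cmod r" using s(1)[of "Suc n"] by (simp add: norm_mult)
    also have "\<dots> \<le> s n * (10 * gap (Suc n) * (s n * U))"
      using s rb by (intro mult_mono) (auto intro: less_imp_le)
    also have "\<dots> = 10 * ((s n)\<^sup>2 * gap (Suc n)) * U" by (simp add: power2_eq_square)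
    finally have srb: "cmod (s (Suc n) * r) \<le> 10 * ((s n)\<^sup>2 * gap (Suc n)) * U" .
    have part: "cmod (complex_of_real c * v) \<le> \<bar>c\<bar> * U" if "cmod v \<le> U" for c v
      using that by (simp add: norm_mult mult_left_mono)
    have "cmod (u (Suc (Suc n)) + u n - 2 * \<kappa> * u (Suc n)) \<le>
       cmod ((b (Suc n) - 1) * u (Suc (Suc n))) + cmod ((b n - 1) * u n) + cmod ((q n - 2 * \<kappa>) * u (Suc n)) + cmod (s (Suc n) * r)"
      unfolding id by (rule tri)
    also have "\<dots> \<le> \<bar>b (Suc n) - 1\<bar> * U + \<bar>b n - 1\<bar> * U + \<bar>q n - 2 * \<kappa>\<bar> * U + 10 * ((s n)\<^sup>2 * gap (Suc n)) * U"
      using part[OF U(3), of "b (Suc n) - 1"] part[OF U(1), of "b n - 1"] part[OF U(2), of "q n - 2 * \<kappa>"] srb by simp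
    also have "\<dots> = e n * U" by (simp add: e_def algebra_simps)
    finally show ?thesis by (simp add: U_def)
  qed
  obtain K where K: "\<And>n. cmod (u n) \<le> K"
    using bounded_if_almost_elliptic_recurrence[OF \<kappa> e e0 rec] by blast
  have K0: "K \<ge> 0" using K[of 0] norm_ge_zero[of "u 0"] by linarith
  have yb: "cmod (y n) \<le> K * s n" "cmod (y (Suc n)) \<le> K * s n" for n
  proof -
    show "cmod (y n) \<le> K * s n" for n
      using K[of n] s(1)[of n] by (simp add: ynorm mult.commute mult_right_mono less_imp_le)
    from this[of "Suc n"] show "cmod (y (Suc n)) \<le> K * s n"
      using mult_left_mono[OF s(2)[of n] K0] by linarith
  qed
  have ci: "(\<lambda>t. (cmod (\<phi> t))\<^sup>2) integrable_on {0..x n}" for n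
    by (intro integrable_continuous_real continuous_intros sol_continuous[OF phi])
  have mass0: "mass \<phi> n \<ge> 0" for n
    unfolding mass_def
    by (rule Henstock_Kurzweil_Integration.integral_nonneg[OF integrable_on_subinterval[OF ci[of "Suc n"]]]) auto
  have "summable (mass \<phi>)"
  proof (rule summable_comparison_test'[of "\<lambda>n. 128 * K\<^sup>2 * ((s n)\<^sup>2 * gap (Suc n))" N])
    show "summable (\<lambda>n. 128 * K\<^sup>2 * ((s n)\<^sup>2 * gap (Suc n)))" by (intro summable_mult S)
    fix n assume n: "n \<ge> N"
    have "mass \<phi> n \<le> integral {x n..x (Suc n)} (\<lambda>_. (4 * K * s n)\<^sup>2)"
      unfolding mass_def
    proof (rule integral_le)
      show "(\<lambda>t. (cmod (\<phi> t))\<^sup>2) integrable_on {x n..x (Suc n)}" by (rule integrable_on_subinterval[OF ci[of "Suc n"]]) auto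
      fix t assume t: "t \<in> {x n..x (Suc n)}"
      have "cmod (\<phi> t) \<le> 2 * (cmod (y n) + cmod (y (Suc n)))"
        unfolding y_def using t by (intro eigen_sol_bounds(1)[OF phi z N[OF n]]) auto
      also have "\<dots> \<le> 4 * K * s n" using yb[of n] by simp
      finally show "(cmod (\<phi> t))\<^sup>2 \<le> (4 * K * s n)\<^sup>2" by (rule power_mono) simp
    qed auto
    also have "\<dots> = gap n * (4 * K * s n)\<^sup>2" by (simp add: gap_def)
    also have "\<dots> \<le> (2 * gap (Suc n)) * (4 * K * s n)\<^sup>2" by (intro mult_right_mono gap_Suc) simp
    also have "\<dots> \<le> 128 * K\<^sup>2 * ((s n)\<^sup>2 * gap (Suc n))"
      by (simp add: power_mult_distrib mult_ac)
    finally show "norm (mass \<phi> n) \<le> 128 * K\<^sup>2 * ((s n)\<^sup>2 * gap (Suc n))" using mass0[of n] by simp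
  qed
  then have "integral {0..x n} (\<lambda>t. (cmod (\<phi> t))\<^sup>2) \<le> suminf (mass \<phi>)" for n
    unfolding sum_mass[OF ci, symmetric] by (intro sum_le_suminf) (auto intro: mass0)
  then show ?thesis
  proof (rule_tac sq_integrable_on_if_bounded[OF _ ci lim])
    show "\<phi> \<in> borel_measurable (lebesgue_on {0<..})"
      by (rule continuous_imp_measurable_on_sets_lebesgue[OF continuous_on_subset[OF solD(5)[OF phi]]]) auto
    show "mono x" by (rule strict_mono_mono[OF strict])
  qed
qed

lemma deficiency_indices_1:
  assumes "\<And>z \<phi> \<phi>1. cmod z = 1 \<Longrightarrow> sol \<phi> \<phi>1 (\<lambda>t. - z * \<phi> t) \<Longrightarrow> \<phi> sq_integrable_on {0<..}"
  shows "deficiency_plus (hamiltonian x \<alpha>) = 1" "deficiency_minus (hamiltonian x \<alpha>) = 1"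
proof -
  have "L2.dim (ker_shift (adjoint (hamiltonian x \<alpha>)) z) = 1" if z: "cmod z = 1" for z
  proof -
    have "z \<noteq> 0" using z by auto
    then obtain \<phi> \<phi>1 where phi: "sol \<phi> \<phi>1 (\<lambda>t. - z * \<phi> t)" "\<phi> 0 = 1" by (rule ex_eigen_sol)
    show ?thesis by (rule dim_ker_shift[OF phi assms[OF z phi(1)]])
  qed
  then show "deficiency_plus (hamiltonian x \<alpha>) = 1" "deficiency_minus (hamiltonian x \<alpha>) = 1"
    by (simp_all add: deficiency_plus_def deficiency_minus_def)
qed

end

lemma summable_bigo_powr:
  fixes f :: "nat \<Rightarrow> real"
  assumes f: "f \<in> O(\<lambda>n. real n powr p)" and p: "p < -1"
  shows "summable (\<lambda>n. \<bar>f n\<bar>)"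
proof -
  have "summable (\<lambda>n. norm (real n powr p))" using p by (simp add: summable_real_powr_iff)
  moreover have "(\<lambda>n. \<bar>f n\<bar>) \<in> O(\<lambda>n. real n powr p)" using f by simp
  ultimately show ?thesis by (rule summable_comparison_test_bigo)
qed

theorem mainTheorem7:
  fixes \<gamma> :: real and x \<alpha> :: "nat \<Rightarrow> real"
  assumes "1/2 < \<gamma>" and "\<gamma> \<le> 1"
    and "x 0 = 0"
    and "\<And>n. n \<ge> 1 \<Longrightarrow> x n = x (n - 1) + 1 / real n powr \<gamma>"
  shows "((\<exists>C1>0. \<forall>n\<ge>1.
            \<alpha> n \<le> - 2 * (real n powr \<gamma> + real (n + 1) powr \<gamma>) + C1 * real n powr (- \<gamma>))
           \<longrightarrow> self_adjoint (hamiltonian x \<alpha>)) \<and>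
         ((\<exists>a. - 2 < a \<and> a < 0 \<and>
            (\<lambda>n. \<alpha> n - a * (real n powr \<gamma> + real (n + 1) powr \<gamma>)) \<in> O(\<lambda>n. real n powr (- \<gamma>)))
           \<longrightarrow> deficiency_plus (hamiltonian x \<alpha>) = 1 \<and> deficiency_minus (hamiltonian x \<alpha>) = 1) \<and>
         ((\<exists>C2>0. \<forall>n\<ge>1. \<alpha> n \<ge> - C2 * real n powr (- \<gamma>))
           \<longrightarrow> self_adjoint (hamiltonian x \<alpha>))"
proof -
  have step: "x (Suc n) - x n = (real n + 1) powr (- \<gamma>)" for n
    using assms(4)[of "Suc n"] by (simp add: powr_minus_divide add.commute)
  have strict: "strict_mono x"
  proof (rule strict_mono_Suc_iff[THEN iffD2], intro allI)
    fix n
    have "0 < x (Suc n) - x n" unfolding step by simp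
    then show "x n < x (Suc n)" by simp
  qed
  \<comment> \<open>As \<open>\<gamma> \<le> 1\<close>, the gaps dominate the terms of the harmonic series.\<close>
  have "harm n \<le> x n" for n
  proof (induction n)
    case (Suc n)
    have "inverse (real (Suc n)) = (real n + 1) powr (- 1)" by (simp add: powr_minus add.commute)
    also have "\<dots> \<le> (real n + 1) powr (- \<gamma>)" using assms(2) by (intro powr_mono) auto
    finally show ?case using Suc step[of n] by (simp add: harm_Suc)
  qed (simp add: harm_def assms(3))
  then have lim: "filterlim x at_top sequentially"
    by (rule filterlim_at_top_mono[OF harm_at_top always_eventually[OF allI]])
  interpret graded_nodes x \<alpha>
  proof
    show "x (Suc n) - x n \<le> 1" for n
    proof -
      have "(real n + 1) powr (- \<gamma>) \<le> (real n + 1) powr 0" using assms(1) by (intro powr_mono) auto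
      then show ?thesis unfolding step by simp
    qed
    show "x (Suc n) - x n \<le> 2 * (x (Suc (Suc n)) - x (Suc n))" for n
    proof -
      have "(real n + 2) powr \<gamma> \<le> (2 * (real n + 1)) powr \<gamma>" using assms(1) by (intro powr_mono2) auto
      also have "\<dots> = 2 powr \<gamma> * (real n + 1) powr \<gamma>" by (rule powr_mult)
      also have "\<dots> \<le> 2 powr 1 * (real n + 1) powr \<gamma>" using assms(2) by (intro mult_right_mono powr_mono) auto
      finally have "(real n + 2) powr \<gamma> \<le> 2 * (real n + 1) powr \<gamma>" by simp
      then have "1 / (real n + 1) powr \<gamma> \<le> 2 * (1 / (real n + 2) powr \<gamma>)" by (simp add: field_simps)
      then show ?thesis unfolding step by (simp add: powr_minus_divide add.commute)
    qed
  qed (use strict lim assms(3) in auto)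
  have gap: "gap n = (real n + 1) powr (- \<gamma>)" for n unfolding gap_def by (rule step)
  have inv_gap: "1 / gap n = real (Suc n) powr \<gamma>" for n
    by (simp add: gap powr_minus_divide add.commute)
  have gap': "real (Suc n) powr (- \<gamma>) = gap n" for n by (simp add: gap add.commute)
  show ?thesis
  proof (intro conjI impI)
    assume "\<exists>C1>0. \<forall>n\<ge>1. \<alpha> n \<le> - 2 * (real n powr \<gamma> + real (n + 1) powr \<gamma>) + C1 * real n powr (- \<gamma>)"
    then obtain C where C: "C > 0" "\<And>n. n \<ge> 1 \<Longrightarrow> \<alpha> n \<le> - 2 * (real n powr \<gamma> + real (n + 1) powr \<gamma>) + C * real n powr (- \<gamma>)"
      by blast
    have "\<alpha> (Suc n) \<le> - 2 * (1 / gap (Suc n) + 1 / gap n) + 2 * C * gap (Suc n)" for n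
    proof -
      have "\<alpha> (Suc n) \<le> - 2 * (1 / gap n + 1 / gap (Suc n)) + C * gap n"
        using C(2)[of "Suc n"] unfolding gap' inv_gap by simp
      also have "C * gap n \<le> C * (2 * gap (Suc n))" using C(1) gap_Suc[of n] by (intro mult_left_mono) auto
      finally show ?thesis by simp
    qed
    then show "self_adjoint (hamiltonian x \<alpha>)"
      using C(1) by (intro self_adjoint_if_bounded_below_up_to_signs[of "-1" "2 * C"]) auto
  next
    assume "\<exists>C2>0. \<forall>n\<ge>1. \<alpha> n \<ge> - C2 * real n powr (- \<gamma>)"
    then obtain C where C: "C > 0" "\<And>n. n \<ge> 1 \<Longrightarrow> \<alpha> n \<ge> - C * real n powr (- \<gamma>)" by blast
    have "\<alpha> (Suc n) \<ge> - (2 * C) * gap (Suc n)" for n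
    proof -
      have "- C * gap n \<le> \<alpha> (Suc n)" using C(2)[of "Suc n"] unfolding gap' by simp
      moreover have "C * gap n \<le> C * (2 * gap (Suc n))" using C(1) gap_Suc[of n] by (intro mult_left_mono) auto
      ultimately show ?thesis by simp
    qed
    then show "self_adjoint (hamiltonian x \<alpha>)"
      using C(1) by (intro self_adjoint_if_bounded_below_up_to_signs[of 1 "2 * C"]) auto
  next
    assume "\<exists>a. - 2 < a \<and> a < 0 \<and> (\<lambda>n. \<alpha> n - a * (real n powr \<gamma> + real (n + 1) powr \<gamma>)) \<in> O(\<lambda>n. real n powr (- \<gamma>))"
    then obtain a where a: "- 2 < a" "a < 0"
      and O: "(\<lambda>n. \<alpha> n - a * (real n powr \<gamma> + real (n + 1) powr \<gamma>)) \<in> O(\<lambda>n. real n powr (- \<gamma>))" by blast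
    \<comment> \<open>The half-integer shift makes \<open>s n * s (Suc n)\<close> agree with \<open>gap n\<close> to relative order
      \<open>n\<^sup>-\<^sup>2\<close>; without it the error would be of order \<open>1/n\<close> and not summable.\<close>
    define s where "s = (\<lambda>n. (real n + 1/2) powr (- \<gamma> / 2))"
    have sS: "s (Suc n) = (real n + 3/2) powr (- \<gamma> / 2)" for n by (simp add: s_def add.commute)
    have p: "- 2 * \<gamma> < - 1" using assms(1) by simp
    have "\<phi> sq_integrable_on {0<..}" if z: "cmod z = 1" and phi: "sol \<phi> \<phi>1 (\<lambda>t. - z * \<phi> t)" for z \<phi> \<phi>1
    proof (rule eigen_sol_sq_integrable[OF phi z, of s "1 + a"])
      show "s n > 0" for n by (simp add: s_def)
      show "s (Suc n) \<le> s n" for n unfolding s_def using assms(1) by (intro powr_mono2') auto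
      have "(1 + a)\<^sup>2 < 1\<^sup>2" using a by (intro power2_strict_mono) auto
      then show "(1 + a)\<^sup>2 < 1" by simp
      show "eventually (\<lambda>n. gap n \<le> 1/2) sequentially"
        unfolding gap using assms(1,2) by real_asymp
      have "(\<lambda>n. s n * s (Suc n) / gap n - 1) \<in> O(\<lambda>n. real n powr (-2))"
        unfolding sS s_def gap using assms(1,2) by real_asymp
      then show "summable (\<lambda>n. \<bar>s n * s (Suc n) / gap n - 1\<bar>)" by (rule summable_bigo_powr) simp
      have "(\<lambda>n. (s n)\<^sup>2 * gap (Suc n)) \<in> O(\<lambda>n. real n powr (- 2 * \<gamma>))"
        unfolding s_def gap using assms(1,2) by real_asymp
      from summable_bigo_powr[OF this p] show "summable (\<lambda>n. (s n)\<^sup>2 * gap (Suc n))"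
        by (simp add: abs_mult)
      define \<eta> where "\<eta> = (\<lambda>n. \<alpha> n - a * (real n powr \<gamma> + real (n + 1) powr \<gamma>))"
      define h where "h = (\<lambda>n. (s (Suc n))\<^sup>2 * (1 / gap (Suc n) + 1 / gap n) - 2)"
      have "h \<in> O(\<lambda>n. real n powr (-2))"
        unfolding h_def sS gap using assms(1,2) by real_asymp
      then have h: "summable (\<lambda>n. \<bar>h n\<bar>)" by (rule summable_bigo_powr) simp
      have "(\<lambda>n. \<eta> (Suc n)) \<in> O(\<lambda>n. real (Suc n) powr (- \<gamma>))"
        using O unfolding \<eta>_def by (rule landau_o.big.compose) (rule filterlim_Suc)
      then have "(\<lambda>n. (s (Suc n))\<^sup>2 * \<eta> (Suc n)) \<in> O(\<lambda>n. (s (Suc n))\<^sup>2 * real (Suc n) powr (- \<gamma>))"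
        by (intro landau_o.big.mult_left)
      also have "(\<lambda>n. (s (Suc n))\<^sup>2 * real (Suc n) powr (- \<gamma>)) \<in> O(\<lambda>n. real n powr (- 2 * \<gamma>))"
        unfolding sS of_nat_Suc using assms(1,2) by real_asymp
      finally have k: "summable (\<lambda>n. \<bar>(s (Suc n))\<^sup>2 * \<eta> (Suc n)\<bar>)" using p by (rule summable_bigo_powr)
      have eq: "(s (Suc n))\<^sup>2 * (1 / gap (Suc n) + 1 / gap n + \<alpha> (Suc n)) - 2 * (1 + a) = (1 + a) * h n + (s (Suc n))\<^sup>2 * \<eta> (Suc n)" for n
      proof -
        have "\<alpha> (Suc n) = a * (1 / gap (Suc n) + 1 / gap n) + \<eta> (Suc n)"
          by (simp add: \<eta>_def inv_gap algebra_simps)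
        moreover have "c * (P + (a * P + E)) - 2 * (1 + a) = (1 + a) * (c * P - 2) + c * E" for c P E
          by (simp add: algebra_simps)
        ultimately show ?thesis by (simp only: h_def)
      qed
      show "summable (\<lambda>n. \<bar>(s (Suc n))\<^sup>2 * (1 / gap (Suc n) + 1 / gap n + \<alpha> (Suc n)) - 2 * (1 + a)\<bar>)"
        unfolding eq
      proof (rule summable_comparison_test')
        show "summable (\<lambda>n. \<bar>1 + a\<bar> * \<bar>h n\<bar> + \<bar>(s (Suc n))\<^sup>2 * \<eta> (Suc n)\<bar>)"
          by (intro summable_add summable_mult h k)
        show "norm \<bar>(1 + a) * h n + (s (Suc n))\<^sup>2 * \<eta> (Suc n)\<bar> \<le> \<bar>1 + a\<bar> * \<bar>h n\<bar> + \<bar>(s (Suc n))\<^sup>2 * \<eta> (Suc n)\<bar>" for n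
          using abs_triangle_ineq[of "(1 + a) * h n" "(s (Suc n))\<^sup>2 * \<eta> (Suc n)"] by (simp add: abs_mult)
      qed
    qed
    then show "deficiency_plus (hamiltonian x \<alpha>) = 1" "deficiency_minus (hamiltonian x \<alpha>) = 1"
      using deficiency_indices_1 by blast+
  qed
qed

end
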